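(* Let $\Omega$ be a bounded domain in $\mathbb C^n$ and let $D\subset\mathbb R$ be open. Suppose that $\varphi$ is real-valued and $\varphi\in C^\infty(\overline\Omega\times D)$, and set $\varphi_t=\varphi(\cdot,t)$. Then $K_{\varphi_t}(z,w)$ depends smoothly on $t\in D$. Moreover, for every $(z,w,t)\in\Omega\times\Omega\times D$ and every $m=1,2,\ldots$, $$\partial_t^mK_{\varphi_t}(z,w)=\sum_{\alpha\in\Lambda_m}\frac{m!}{\alpha!}\,P_{\varphi_t,\alpha}\bigl(K_{\varphi_t}(\cdot,w)\bigr)(z).$$
   Context: $dV$ is Lebesgue measure. $\varphi\in C^\infty(\overline\Omega\times D)$ means that, for every compact interval $J\subset D$, $\varphi$ extends smoothly to a neighborhood of $\overline\Omega\times J$ (no regularity of $\partial\Omega$ is assumed). $L^2(\Omega,\varphi_t)$ is the Hilbert space of measurable $f$ with $\|f\|_{\varphi_t}^2=\int_\Omega|f|^2e^{-\varphi_t}\,dV<\infty$, and $A^2(\Omega,\varphi_t)$ is its closed subspace of holomorphic functions. $P_{\varphi_t}$ is the orthogonal projection of $L^2(\Omega,\varphi_t)$ onto $A^2(\Omega,\varphi_t)$, and $K_{\varphi_t}(z,w)$ is the reproducing kernel of $A^2(\Omega,\varphi_t)$ (holomorphic in $z$, with $f(w)=\int_\Omega f\,\overline{K_{\varphi_t}(\cdot,w)}e^{-\varphi_t}dV$ for $f\in A^2(\Omega,\varphi_t)$). $\Lambda_m$ is the set of ordered compositions $\alpha=(\alpha_1,\ldots,\alpha_r)$, $1\le r\le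 m$, of $m$ into positive integers ($\alpha_1+\cdots+\alpha_r=m$), and $\alpha!:=\prod_{j=1}^r\alpha_j!$. $B_k(x_1,\ldots,x_k)$ is the $k$th complete exponential Bell polynomial: $B_k(x_1,\dots,x_k)=\sum \frac{k!}{n_1!\cdots n_k!}\prod_{j=1}^k\left(\frac{x_j}{j!}\right)^{n_j}$, the sum being over nonnegative integers $n_1,\dots,n_k$ with $\sum_j jn_j=k$; equivalently $\partial_t^k e^{f}=e^fB_k(f',\ldots,f^{(k)})$. Write $B_k(-\varphi_t):=B_k(\partial_t(-\varphi_t),\ldots,\partial_t^k(-\varphi_t))$. For $k\ge1$ set $P_{\varphi_t,k}(f):=P_{\varphi_t}\bigl(-f\,B_k(-\varphi_t)\bigr)$, and for $\alpha=(\alpha_1,\ldots,\alpha_r)$ set $P_{\varphi_t,\alpha}:=P_{\varphi_t,\alpha_r}\circ\cdots\circ P_{\varphi_t,\alpha_1}$. *)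

theory Defs
  imports "HOL-Analysis.Analysis"
begin

section \<open>Smooth functions\<close>

text \<open>\<open>C\<^sup>k\<close> and \<open>C\<^sup>\<infinity>\<close> functions on an open set \<open>S\<close>, via iterated directional derivatives. The
  derivatives are taken at (not within) the points of \<open>S\<close>, so this is meant for open \<open>S\<close> only.\<close>

fun higher_differentiable_on ::
  "'a::real_normed_vector set \<Rightarrow> ('a \<Rightarrow> 'b::real_normed_vector) \<Rightarrow> nat \<Rightarrow> bool" where
  "higher_differentiable_on S f 0 \<longleftrightarrow> continuous_on S f"
| "higher_differentiable_on S f (Suc k) \<longleftrightarrow>
     (\<forall>x\<in>S. f differentiable (at x)) \<and>
     (\<forall>v. higher_differentiable_on S (\<lambda>x. frechet_derivative f (at x) v) k)"

definition smooth_on :: "'a::real_normed_vector set \<Rightarrow> ('a \<Rightarrow> 'b::real_normed_vector) \<Rightarrow> bool" where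
  "smooth_on S f \<longleftrightarrow> (\<forall>k. higher_differentiable_on S f k)"

definition smooth_on_closure_times ::
  "'a::real_normed_vector set \<Rightarrow> real set \<Rightarrow> ('a \<Rightarrow> real \<Rightarrow> 'b::real_normed_vector) \<Rightarrow> bool" where
  "smooth_on_closure_times \<Omega> D \<phi> \<longleftrightarrow>
     (\<forall>a b. a \<le> b \<longrightarrow> {a..b} \<subseteq> D \<longrightarrow>
        (\<exists>U \<Phi>. open U \<and> closure \<Omega> \<times> {a..b} \<subseteq> U \<and> smooth_on U \<Phi> \<and>
               (\<forall>z\<in>closure \<Omega>. \<forall>t\<in>{a..b}. \<Phi> (z, t) = \<phi> z t)))"

definition nth_vector_derivative :: "nat \<Rightarrow> (real \<Rightarrow> 'b::real_normed_vector) \<Rightarrow> real \<Rightarrow> 'b" where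
  "nth_vector_derivative k g = ((\<lambda>h t. vector_derivative h (at t)) ^^ k) g"


section \<open>Weighted Bergman spaces\<close>

text \<open>Holomorphy in several variables on an open set: the Frechet derivative exists and is
  complex-linear.\<close>

definition holomorphic_vec_on :: "(complex ^ 'n \<Rightarrow> complex) \<Rightarrow> (complex ^ 'n) set \<Rightarrow> bool" where
  "holomorphic_vec_on f \<Omega> \<longleftrightarrow>
     (\<forall>z\<in>\<Omega>. \<exists>f'. (f has_derivative f') (at z) \<and> (\<forall>c v. f' (c *s v) = c * f' v))"

text \<open>Elements of the Lebesgue space are represented by functions; values off \<open>\<Omega>\<close> are irrelevant.\<close>

definition weighted_L2 :: "(complex ^ 'n) set \<Rightarrow> (complex ^ 'n \<Rightarrow> real) \<Rightarrow> (complex ^ 'n \<Rightarrow> complex) set"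
  where "weighted_L2 \<Omega> \<psi> =
    {f. f \<in> borel_measurable (lebesgue_on \<Omega>) \<and>
        integrable (lebesgue_on \<Omega>) (\<lambda>z. (cmod (f z))\<^sup>2 * exp (- \<psi> z))}"

definition weighted_inner ::
  "(complex ^ 'n) set \<Rightarrow> (complex ^ 'n \<Rightarrow> real) \<Rightarrow>
   (complex ^ 'n \<Rightarrow> complex) \<Rightarrow> (complex ^ 'n \<Rightarrow> complex) \<Rightarrow> complex" where
  "weighted_inner \<Omega> \<psi> f g =
     (LINT z|lebesgue_on \<Omega>. f z * cnj (g z) * complex_of_real (exp (- \<psi> z)))"

text \<open>A holomorphic function on \<open>\<Omega>\<close> is represented by its extension by zero, so that distinct
  elements of this set are distinct as elements of the Bergman space.\<close>

definition bergman_space :: "(complex ^ 'n) set \<Rightarrow> (complex ^ 'n \<Rightarrow> real) \<Rightarrow> (complex ^ 'n \<Rightarrow> complex) set"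
  where "bergman_space \<Omega> \<psi> =
    {f \<in> weighted_L2 \<Omega> \<psi>. holomorphic_vec_on f \<Omega> \<and> (\<forall>z. z \<notin> \<Omega> \<longrightarrow> f z = 0)}"

definition bergman_projection ::
  "(complex ^ 'n) set \<Rightarrow> (complex ^ 'n \<Rightarrow> real) \<Rightarrow>
   (complex ^ 'n \<Rightarrow> complex) \<Rightarrow> (complex ^ 'n \<Rightarrow> complex)" where
  "bergman_projection \<Omega> \<psi> f =
     (THE g. g \<in> bergman_space \<Omega> \<psi> \<and>
             (\<forall>h\<in>bergman_space \<Omega> \<psi>. weighted_inner \<Omega> \<psi> (\<lambda>z. f z - g z) h = 0))"

definition bergman_kernel ::
  "(complex ^ 'n) set \<Rightarrow> (complex ^ 'n \<Rightarrow> real) \<Rightarrow> complex ^ 'n \<Rightarrow> complex ^ 'n \<Rightarrow> complex" where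
  "bergman_kernel \<Omega> \<psi> z w =
     (THE k. k \<in> bergman_space \<Omega> \<psi> \<and>
             (\<forall>f\<in>bergman_space \<Omega> \<psi>. f w = weighted_inner \<Omega> \<psi> f k)) z"


section \<open>Compositions, Bell polynomials and the iterated operators\<close>

definition compositions :: "nat \<Rightarrow> nat list set" where
  "compositions m =
     {\<alpha>. 1 \<le> length \<alpha> \<and> length \<alpha> \<le> m \<and> (\<forall>a\<in>set \<alpha>. 1 \<le> a) \<and> sum_list \<alpha> = m}"

definition complete_bell :: "nat \<Rightarrow> (nat \<Rightarrow> real) \<Rightarrow> real" where
  "complete_bell k x =
     (\<Sum>n | n \<in> ({1..k} \<rightarrow>\<^sub>E (UNIV :: nat set)) \<and> (\<Sum>j=1..k. j * n j) = k.
        fact k / (\<Prod>j=1..k. fact (n j)) * (\<Prod>j=1..k. (x j / fact j) ^ n j))"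

definition bell_neg_weight :: "nat \<Rightarrow> (complex ^ 'n \<Rightarrow> real \<Rightarrow> real) \<Rightarrow> real \<Rightarrow> complex ^ 'n \<Rightarrow> real" where
  "bell_neg_weight k \<phi> t z = complete_bell k (\<lambda>j. nth_vector_derivative j (\<lambda>s. - \<phi> z s) t)"

definition bergman_op ::
  "(complex ^ 'n) set \<Rightarrow> (complex ^ 'n \<Rightarrow> real \<Rightarrow> real) \<Rightarrow> real \<Rightarrow> nat \<Rightarrow>
   (complex ^ 'n \<Rightarrow> complex) \<Rightarrow> (complex ^ 'n \<Rightarrow> complex)" where
  "bergman_op \<Omega> \<phi> t k f =
     bergman_projection \<Omega> (\<lambda>z. \<phi> z t) (\<lambda>z. - f z * complex_of_real (bell_neg_weight k \<phi> t z))"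

text \<open>\<open>fold\<close> applies the operator of the first part of the composition first, hence this is
  \<open>P\<^bsub>\<alpha>\<^sub>r\<^esub> \<circ> \<dots> \<circ> P\<^bsub>\<alpha>\<^sub>1\<^esub>\<close>.\<close>

definition bergman_op_comp ::
  "(complex ^ 'n) set \<Rightarrow> (complex ^ 'n \<Rightarrow> real \<Rightarrow> real) \<Rightarrow> real \<Rightarrow> nat list \<Rightarrow>
   (complex ^ 'n \<Rightarrow> complex) \<Rightarrow> (complex ^ 'n \<Rightarrow> complex)" where
  "bergman_op_comp \<Omega> \<phi> t \<alpha> = fold (bergman_op \<Omega> \<phi> t) \<alpha>"

end

theory Submission
  imports Defs "HOL-Complex_Analysis.Complex_Analysis"
begin

text \<open>
  Write \<open>\<rho>\<^sub>t = exp (- \<phi>\<^sub>t)\<close>. Since \<open>\<Omega>\<close> is bounded and \<open>\<phi>\<close> is smooth up to the closure, each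
  \<open>\<rho>\<^sub>t\<close> is bounded above and bounded away from zero, so all the spaces \<open>A\<^sup>2(\<Omega>, \<phi>\<^sub>t)\<close> consist of
  the same functions. Call this common space \<open>A\<close>. The kernel \<open>K\<^sub>t = K\<^sub>t(\<sqdot>, w)\<close> is determined by
  \<open>\<integral> f cnj(K\<^sub>t) \<rho>\<^sub>t = f w\<close> for all \<open>f\<close> in \<open>A\<close>, and neither the test functions nor the right-hand
  side depend on \<open>t\<close>. Differentiating \<open>m\<close> times with the Leibniz rule, and using
  \<open>\<partial>\<^sub>t\<^sup>j \<rho>\<^sub>t = \<rho>\<^sub>t B\<^sub>j(- \<phi>\<^sub>t)\<close>, gives
  \<open>\<Sum>\<^sub>j (m choose j) \<integral> f cnj(\<partial>\<^sub>t\<^bsup>m-j\<^esup> K\<^sub>t) B\<^sub>j(- \<phi>\<^sub>t) \<rho>\<^sub>t = 0\<close>. By the definition of the projection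
  this says \<open>\<partial>\<^sub>t\<^sup>m K\<^sub>t = \<Sum>\<^sub>j (m choose j) P\<^sub>j (\<partial>\<^sub>t\<^bsup>m-j\<^esup> K\<^sub>t)\<close> with \<open>j = 1, \<dots>, m\<close>, and unrolling the
  recursion produces the sum over compositions: \<open>j\<close> is the last part of the composition.

  To make this rigorous, the functions on the right-hand side of the claimed formula are taken as
  the definition of \<open>kernel_derivative m t\<close>. They satisfy the integrated recursion for each fixed
  \<open>t\<close> (\<open>kernel_derivative_pairing\<close>), and an induction on \<open>m\<close> shows that the difference quotients of
  \<open>kernel_derivative m\<close> converge in \<open>L\<^sup>2\<close> to \<open>kernel_derivative (Suc m)\<close>. The induction step is an
  implicit differentiation in \<open>L\<^sup>2\<close> (\<open>l2_has_derivative_implicit\<close>): a family in \<open>A\<close> is differentiable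
  when its weighted pairings with \<open>A\<close> are those of a differentiable family, because the weighted
  norm controls the \<open>L\<^sup>2\<close> norm uniformly near \<open>t\<close>. Finally, evaluation at a point of \<open>\<Omega>\<close> is
  continuous on \<open>A\<close>, which turns derivatives in \<open>L\<^sup>2\<close> into pointwise derivatives.

  The facts on Bergman spaces that enter are the sub-mean value inequality
  (\<open>holomorphic_vec_submean_square\<close>), which bounds point evaluations and yields completeness of \<open>A\<close>,
  and the Riesz representation theorem, which provides the kernel and the projection. The mean value
  property needs no polydiscs: averaging the one-variable mean value property along the complex
  lines through the centre of a ball reduces it to the invariance of Lebesgue measure under
  \<open>v \<mapsto> e\<^bsup>i\<theta>\<^esup> v\<close>.
\<close>

section \<open>Square integrable functions and the Riesz representation\<close>

definition l2_space :: "'a measure \<Rightarrow> ('a \<Rightarrow> complex) set" where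
  "l2_space M = {f \<in> borel_measurable M. integrable M (\<lambda>z. (cmod (f z))\<^sup>2)}"

definition l2_norm :: "'a measure \<Rightarrow> ('a \<Rightarrow> complex) \<Rightarrow> real" where
  "l2_norm M f = sqrt (LINT z|M. (cmod (f z))\<^sup>2)"

definition l2_pair :: "'a measure \<Rightarrow> ('a \<Rightarrow> complex) \<Rightarrow> ('a \<Rightarrow> complex) \<Rightarrow> complex" where
  "l2_pair M f g = (LINT z|M. f z * cnj (g z))"

lemma l2_space_measurable [measurable_dest]: "f \<in> l2_space M \<Longrightarrow> f \<in> borel_measurable M"
  by (simp add: l2_space_def)

lemma l2_space_integrable: "f \<in> l2_space M \<Longrightarrow> integrable M (\<lambda>z. (cmod (f z))\<^sup>2)"
  by (simp add: l2_space_def)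

lemma l2_norm_nonneg [simp]: "0 \<le> l2_norm M f"
  by (simp add: l2_norm_def)

lemma l2_norm_square: "(l2_norm M f)\<^sup>2 = (LINT z|M. (cmod (f z))\<^sup>2)"
  by (simp add: l2_norm_def)

lemma l2_spaceI_bounded:
  assumes f: "f \<in> l2_space M" and h: "h \<in> borel_measurable M"
    and le: "\<And>z. z \<in> space M \<Longrightarrow> cmod (h z) \<le> C * cmod (f z)"
  shows "h \<in> l2_space M" and "C \<ge> 0 \<Longrightarrow> l2_norm M h \<le> C * l2_norm M f"
proof -
  have sq: "(cmod (h z))\<^sup>2 \<le> C\<^sup>2 * (cmod (f z))\<^sup>2" if "z \<in> space M" for z
    using power_mono[OF le[OF that], of 2] by (simp add: power_mult_distrib)
  have i: "integrable M (\<lambda>z. C\<^sup>2 * (cmod (f z))\<^sup>2)"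
    using f by (simp add: l2_space_def)
  have j: "integrable M (\<lambda>z. (cmod (h z))\<^sup>2)"
    by (rule Bochner_Integration.integrable_bound[OF i]) (use h sq in auto)
  then show "h \<in> l2_space M" using h by (simp add: l2_space_def)
  assume C: "C \<ge> 0"
  have "(LINT z|M. (cmod (h z))\<^sup>2) \<le> (LINT z|M. C\<^sup>2 * (cmod (f z))\<^sup>2)"
    by (intro integral_mono i j sq)
  then have "l2_norm M h \<le> sqrt (C\<^sup>2 * (LINT z|M. (cmod (f z))\<^sup>2))"
    by (simp add: l2_norm_def)
  then show "l2_norm M h \<le> C * l2_norm M f"
    using C by (simp add: l2_norm_def real_sqrt_mult)
qed

lemma l2_space_scale [intro]: "f \<in> l2_space M \<Longrightarrow> (\<lambda>z. c * f z) \<in> l2_space M"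
  by (rule l2_spaceI_bounded(1)[where C = "cmod c"]) (auto simp: norm_mult)

lemma l2_norm_scale: "l2_norm M (\<lambda>z. c * f z) = cmod c * l2_norm M f"
  by (simp add: l2_norm_def norm_mult power_mult_distrib real_sqrt_mult)

lemma l2_space_add [intro]:
  assumes "f \<in> l2_space M" "g \<in> l2_space M"
  shows "(\<lambda>z. f z + g z) \<in> l2_space M"
proof -
  have le: "(cmod (f z + g z))\<^sup>2 \<le> 2 * (cmod (f z))\<^sup>2 + 2 * (cmod (g z))\<^sup>2" for z
  proof -
    have "(cmod (f z + g z))\<^sup>2 \<le> (cmod (f z) + cmod (g z))\<^sup>2"
      by (intro power_mono norm_triangle_ineq) simp
    also have "\<dots> \<le> 2 * (cmod (f z))\<^sup>2 + 2 * (cmod (g z))\<^sup>2"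
      using sum_squares_bound[of "cmod (f z)" "cmod (g z)"] by (simp add: power2_sum)
    finally show ?thesis .
  qed
  have i: "integrable M (\<lambda>z. 2 * (cmod (f z))\<^sup>2 + 2 * (cmod (g z))\<^sup>2)"
    using assms by (simp add: l2_space_def)
  have [measurable]: "f \<in> borel_measurable M" "g \<in> borel_measurable M"
    using assms by (auto simp: l2_space_def)
  have "integrable M (\<lambda>z. (cmod (f z + g z))\<^sup>2)"
    by (rule Bochner_Integration.integrable_bound[OF i]) (use le in auto)
  then show ?thesis by (simp add: l2_space_def)
qed

lemma l2_space_diff [intro]:
  assumes "f \<in> l2_space M" "g \<in> l2_space M"
  shows "(\<lambda>z. f z - g z) \<in> l2_space M"
  using l2_space_add[OF assms(1) l2_space_scale[OF assms(2), of "-1"]] by simp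

lemma l2_space_zero [simp]: "(\<lambda>z. 0) \<in> l2_space M"
  by (simp add: l2_space_def)

lemma l2_space_sum [intro]:
  "(\<And>i. i \<in> I \<Longrightarrow> f i \<in> l2_space M) \<Longrightarrow> (\<lambda>z. \<Sum>i\<in>I. f i z) \<in> l2_space M"
  by (induction I rule: infinite_finite_induct) (auto intro!: l2_space_add)

lemma borel_measurable_cnj [measurable]:
  "f \<in> borel_measurable M \<Longrightarrow> (\<lambda>z. cnj (f z)) \<in> borel_measurable M"
  by (rule borel_measurable_continuous_on[where f = cnj]) (intro continuous_intros)

lemma l2_pair_integrable:
  assumes "f \<in> l2_space M" "g \<in> l2_space M"
  shows "integrable M (\<lambda>z. f z * cnj (g z))" "integrable M (\<lambda>z. cmod (f z) * cmod (g z))"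
proof -
  have i: "integrable M (\<lambda>z. (cmod (f z))\<^sup>2 + (cmod (g z))\<^sup>2)"
    using assms by (simp add: l2_space_def)
  have le: "cmod (f z) * cmod (g z) \<le> (cmod (f z))\<^sup>2 + (cmod (g z))\<^sup>2" for z
    using sum_squares_bound[of "cmod (f z)" "cmod (g z)"]
      mult_nonneg_nonneg[OF norm_ge_zero[of "f z"] norm_ge_zero[of "g z"]]
    by linarith
  have [measurable]: "f \<in> borel_measurable M" "g \<in> borel_measurable M"
    using assms by (auto simp: l2_space_def)
  show "integrable M (\<lambda>z. cmod (f z) * cmod (g z))"
    by (rule Bochner_Integration.integrable_bound[OF i]) (use le in auto)
  show "integrable M (\<lambda>z. f z * cnj (g z))"
    by (rule Bochner_Integration.integrable_bound[OF i]) (use le in \<open>auto simp: norm_mult\<close>)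
qed

text \<open>
  The quadratic polynomial \<open>x \<mapsto> \<integral> (x \<bar>f\<bar> - \<bar>g\<bar>)\<^sup>2\<close> has no negative values. Evaluate it at its
  minimum, or let it degenerate to a linear function if \<open>f\<close> has norm zero.
\<close>

lemma l2_Cauchy_Schwarz:
  assumes f: "f \<in> l2_space M" and g: "g \<in> l2_space M"
  shows "cmod (l2_pair M f g) \<le> l2_norm M f * l2_norm M g"
proof -
  let ?F = "LINT z|M. (cmod (f z))\<^sup>2" and ?G = "LINT z|M. (cmod (g z))\<^sup>2"
  let ?I = "LINT z|M. cmod (f z) * cmod (g z)"
  note int = l2_space_integrable[OF f] l2_space_integrable[OF g] l2_pair_integrable(2)[OF f g]
  have poly: "0 \<le> ?F * x\<^sup>2 + (- 2 * ?I) * x + ?G" for x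
  proof -
    have "0 \<le> (LINT z|M. (x * cmod (f z) - cmod (g z))\<^sup>2)" by simp
    also have "\<dots> = (LINT z|M. x\<^sup>2 * (cmod (f z))\<^sup>2 - 2 * x * (cmod (f z) * cmod (g z)) + (cmod (g z))\<^sup>2)"
      by (simp add: power2_diff power_mult_distrib mult_ac diff_add_eq)
    also have "\<dots> = x\<^sup>2 * ?F - 2 * x * ?I + ?G" using int by simp
    finally show ?thesis by (simp add: algebra_simps)
  qed
  have "?I\<^sup>2 \<le> ?F * ?G"
  proof (cases "?F = 0")
    case True
    have "?I = 0"
    proof (rule ccontr)
      assume "?I \<noteq> 0"
      then show False using poly[of "(?G + 1) / (2 * ?I)"] True by simp
    qed
    then show ?thesis using True by simp
  next
    case False
    have F: "?F > 0" using False by (simp add: order_less_le)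
    have "0 \<le> ?F * (?F * (?I/?F)\<^sup>2 + (- 2 * ?I) * (?I/?F) + ?G)"
      using F poly[of "?I / ?F"] by (intro mult_nonneg_nonneg) auto
    then show ?thesis using False by (simp add: field_simps power2_eq_square)
  qed
  then have "\<bar>?I\<bar> \<le> sqrt (?F * ?G)" by (metis real_sqrt_abs real_sqrt_le_iff)
  moreover have "cmod (l2_pair M f g) \<le> ?I"
    unfolding l2_pair_def using integral_norm_bound[of M "\<lambda>z. f z * cnj (g z)"] by (simp add: norm_mult)
  ultimately show ?thesis by (simp add: l2_norm_def real_sqrt_mult)
qed

lemma l2_pair_self: "l2_pair M f f = of_real ((l2_norm M f)\<^sup>2)"
  unfolding l2_pair_def l2_norm_square complex_norm_square[symmetric]
  by (simp add: integral_complex_of_real del: of_real_power)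

lemma l2_pair_cnj: "cnj (l2_pair M f g) = l2_pair M g f"
  unfolding l2_pair_def by (subst Bochner_Integration.integral_cnj[symmetric]) (simp add: mult.commute)

lemma l2_pair_add_left:
  "f \<in> l2_space M \<Longrightarrow> g \<in> l2_space M \<Longrightarrow> h \<in> l2_space M \<Longrightarrow>
    l2_pair M (\<lambda>z. f z + g z) h = l2_pair M f h + l2_pair M g h"
  by (simp add: l2_pair_def distrib_right l2_pair_integrable)

lemma l2_pair_scale_left: "l2_pair M (\<lambda>z. c * f z) h = c * l2_pair M f h"
  by (simp add: l2_pair_def mult.assoc)

lemma l2_pair_add_right:
  "f \<in> l2_space M \<Longrightarrow> g \<in> l2_space M \<Longrightarrow> h \<in> l2_space M \<Longrightarrow>
    l2_pair M h (\<lambda>z. f z + g z) = l2_pair M h f + l2_pair M h g"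
  by (simp add: l2_pair_def distrib_left l2_pair_integrable)

lemma l2_pair_diff_right:
  "f \<in> l2_space M \<Longrightarrow> g \<in> l2_space M \<Longrightarrow> h \<in> l2_space M \<Longrightarrow>
    l2_pair M h (\<lambda>z. f z - g z) = l2_pair M h f - l2_pair M h g"
  by (simp add: l2_pair_def right_diff_distrib l2_pair_integrable)

lemma l2_pair_scale_right: "l2_pair M h (\<lambda>z. c * f z) = cnj c * l2_pair M h f"
  by (simp add: l2_pair_def mult.assoc mult.left_commute[of _ "cnj c"])

lemma l2_pair_sum_right:
  assumes "\<And>i. i \<in> I \<Longrightarrow> f i \<in> l2_space M" "h \<in> l2_space M"
  shows "l2_pair M h (\<lambda>z. \<Sum>i\<in>I. f i z) = (\<Sum>i\<in>I. l2_pair M h (f i))"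
  using assms by (simp add: l2_pair_def sum_distrib_left l2_pair_integrable)

lemma l2_norm_triangle:
  assumes f: "f \<in> l2_space M" and g: "g \<in> l2_space M"
  shows "l2_norm M (\<lambda>z. f z + g z) \<le> l2_norm M f + l2_norm M g"
proof -
  have "complex_of_real ((l2_norm M (\<lambda>z. f z + g z))\<^sup>2) = l2_pair M (\<lambda>z. f z + g z) (\<lambda>z. f z + g z)"
    by (simp only: l2_pair_self)
  also have "\<dots> = l2_pair M f f + l2_pair M f g + l2_pair M g f + l2_pair M g g"
    using f g by (simp add: l2_pair_add_left l2_pair_add_right l2_space_add)
  finally have "(l2_norm M (\<lambda>z. f z + g z))\<^sup>2 = Re (l2_pair M f f + l2_pair M f g + l2_pair M g f + l2_pair M g g)"
    by (metis Re_complex_of_real)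
  also have "\<dots> = (l2_norm M f)\<^sup>2 + Re (l2_pair M f g) + Re (l2_pair M g f) + (l2_norm M g)\<^sup>2"
    by (simp add: l2_pair_self)
  also have "\<dots> \<le> (l2_norm M f + l2_norm M g)\<^sup>2"
    using l2_Cauchy_Schwarz[OF f g] l2_Cauchy_Schwarz[OF g f]
      complex_Re_le_cmod[of "l2_pair M f g"] complex_Re_le_cmod[of "l2_pair M g f"]
    unfolding power2_sum mult.commute[of "l2_norm M g"] by linarith
  finally show ?thesis by (rule power2_le_imp_le) simp
qed

lemma l2_norm_triangle_diff:
  assumes "f \<in> l2_space M" "g \<in> l2_space M"
  shows "l2_norm M (\<lambda>z. f z - g z) \<le> l2_norm M f + l2_norm M g"
  using l2_norm_triangle[OF assms(1) l2_space_scale[OF assms(2), of "-1"]]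
    l2_norm_scale[of M "-1" g] by simp

lemma l2_pair_cong:
  "(\<And>z. z \<in> space M \<Longrightarrow> f z = f' z) \<Longrightarrow> (\<And>z. z \<in> space M \<Longrightarrow> g z = g' z) \<Longrightarrow> l2_pair M f g = l2_pair M f' g'"
  unfolding l2_pair_def by (simp cong: Bochner_Integration.integral_cong)

lemma l2_parallelogram:
  assumes f: "f \<in> l2_space M" and g: "g \<in> l2_space M"
  shows "(l2_norm M (\<lambda>z. f z + g z))\<^sup>2 + (l2_norm M (\<lambda>z. f z - g z))\<^sup>2
       = 2 * (l2_norm M f)\<^sup>2 + 2 * (l2_norm M g)\<^sup>2"
proof -
  have pl: "(cmod (a + b))\<^sup>2 + (cmod (a - b))\<^sup>2 = 2 * (cmod a)\<^sup>2 + 2 * (cmod b)\<^sup>2" for a b :: complex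
    unfolding cmod_power2 by (simp add: power2_eq_square algebra_simps)
  have "(LINT z|M. (cmod (f z + g z))\<^sup>2) + (LINT z|M. (cmod (f z - g z))\<^sup>2)
      = (LINT z|M. (cmod (f z + g z))\<^sup>2 + (cmod (f z - g z))\<^sup>2)"
    using l2_space_integrable[OF l2_space_add[OF f g]] l2_space_integrable[OF l2_space_diff[OF f g]] by simp
  also have "\<dots> = 2 * (LINT z|M. (cmod (f z))\<^sup>2) + 2 * (LINT z|M. (cmod (g z))\<^sup>2)"
    unfolding pl using l2_space_integrable[OF f] l2_space_integrable[OF g] by simp
  finally show ?thesis by (simp add: l2_norm_square)
qed

text \<open>
  Fatou's lemma. It replaces completeness of \<open>L\<^sup>2\<close> below: for holomorphic functions the candidate for
  the limit is known pointwise.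
\<close>

lemma l2_space_pointwise_limit:
  fixes G :: "nat \<Rightarrow> 'a \<Rightarrow> complex"
  assumes G: "\<And>n. G n \<in> l2_space M" and le: "\<And>n. l2_norm M (G n) \<le> e"
    and lim: "\<And>z. z \<in> space M \<Longrightarrow> (\<lambda>n. G n z) \<longlonglongrightarrow> g z"
  shows "g \<in> l2_space M" "l2_norm M g \<le> e"
proof -
  have e: "e \<ge> 0" using le[of 0] l2_norm_nonneg[of M "G 0"] by linarith
  have Gm [measurable]: "G n \<in> borel_measurable M" for n using G by (simp add: l2_space_def)
  have gm [measurable]: "g \<in> borel_measurable M"
    by (rule borel_measurable_LIMSEQ_metric[OF Gm lim])
  have "(\<integral>\<^sup>+z. ennreal ((cmod (g z))\<^sup>2) \<partial>M) = (\<integral>\<^sup>+z. liminf (\<lambda>n. ennreal ((cmod (G n z))\<^sup>2)) \<partial>M)"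
  proof (rule nn_integral_cong)
    fix z assume "z \<in> space M"
    then have "(\<lambda>n. ennreal ((cmod (G n z))\<^sup>2)) \<longlonglongrightarrow> ennreal ((cmod (g z))\<^sup>2)"
      by (intro tendsto_intros lim)
    then show "ennreal ((cmod (g z))\<^sup>2) = liminf (\<lambda>n. ennreal ((cmod (G n z))\<^sup>2))"
      by (intro lim_imp_Liminf[symmetric]) auto
  qed
  also have "\<dots> \<le> liminf (\<lambda>n. \<integral>\<^sup>+z. ennreal ((cmod (G n z))\<^sup>2) \<partial>M)"
    by (rule nn_integral_liminf) measurable
  also have "\<dots> \<le> liminf (\<lambda>n::nat. ennreal (e\<^sup>2))"
  proof (intro Liminf_mono always_eventually allI)
    fix n
    have "(\<integral>\<^sup>+z. ennreal ((cmod (G n z))\<^sup>2) \<partial>M) = ennreal ((l2_norm M (G n))\<^sup>2)"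
      unfolding l2_norm_square by (intro nn_integral_eq_integral l2_space_integrable G) auto
    also have "\<dots> \<le> ennreal (e\<^sup>2)" by (intro ennreal_leI power_mono le l2_norm_nonneg)
    finally show "(\<integral>\<^sup>+z. ennreal ((cmod (G n z))\<^sup>2) \<partial>M) \<le> ennreal (e\<^sup>2)" .
  qed
  finally have nn: "(\<integral>\<^sup>+z. ennreal ((cmod (g z))\<^sup>2) \<partial>M) \<le> ennreal (e\<^sup>2)"
    by (simp add: Liminf_const)
  have int: "integrable M (\<lambda>z. (cmod (g z))\<^sup>2)"
    by (rule integrableI_bounded) (use nn in \<open>auto intro: le_less_trans\<close>)
  then show "g \<in> l2_space M" by (simp add: l2_space_def)
  have "(l2_norm M g)\<^sup>2 \<le> e\<^sup>2"
    using nn unfolding l2_norm_square by (subst (asm) nn_integral_eq_integral[OF int]) (auto simp: e)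
  then show "l2_norm M g \<le> e" using e by (rule power2_le_imp_le)
qed

definition l2_complete_subspace :: "'a measure \<Rightarrow> ('a \<Rightarrow> complex) set \<Rightarrow> bool" where
  "l2_complete_subspace M V \<longleftrightarrow> V \<noteq> {} \<and> V \<subseteq> l2_space M \<and>
     (\<forall>f\<in>V. \<forall>g\<in>V. (\<lambda>z. f z + g z) \<in> V) \<and> (\<forall>c. \<forall>f\<in>V. (\<lambda>z. c * f z) \<in> V) \<and>
     (\<forall>F :: nat \<Rightarrow> 'a \<Rightarrow> complex. (\<forall>n. F n \<in> V) \<longrightarrow>
        (\<forall>e>0. \<exists>N. \<forall>m\<ge>N. \<forall>n\<ge>N. l2_norm M (\<lambda>z. F m z - F n z) < e) \<longrightarrow>
        (\<exists>f\<in>V. (\<lambda>n. l2_norm M (\<lambda>z. F n z - f z)) \<longlonglongrightarrow> 0))"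

text \<open>
  The representing vector minimises \<open>J u = \<parallel>u\<parallel>\<^sup>2 - 2 Re (l u)\<close> over \<open>V\<close>. The functional is bounded below
  because \<open>l\<close> is bounded, the parallelogram law makes a minimising sequence Cauchy, and the vanishing
  of the first variation at the limit is the representation of the real part of \<open>l\<close>. The imaginary part
  follows by testing with \<open>\<i> f\<close>.
\<close>

theorem l2_Riesz_representation:
  fixes l :: "('a \<Rightarrow> complex) \<Rightarrow> complex"
  assumes V: "l2_complete_subspace M V"
    and l_add: "\<And>f g. f \<in> V \<Longrightarrow> g \<in> V \<Longrightarrow> l (\<lambda>z. f z + g z) = l f + l g"
    and l_scale: "\<And>c f. f \<in> V \<Longrightarrow> l (\<lambda>z. c * f z) = c * l f"
    and l_bound: "\<And>f. f \<in> V \<Longrightarrow> cmod (l f) \<le> C * l2_norm M f"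
  shows "\<exists>u\<in>V. \<forall>f\<in>V. l2_pair M f u = l f"
proof -
  have VL: "f \<in> l2_space M" if "f \<in> V" for f using V that unfolding l2_complete_subspace_def by blast
  have Vadd: "(\<lambda>z. f z + g z) \<in> V" if "f \<in> V" "g \<in> V" for f g
    using V that unfolding l2_complete_subspace_def by blast
  have Vscale: "(\<lambda>z. c * f z) \<in> V" if "f \<in> V" for c f
    using V that unfolding l2_complete_subspace_def by blast
  define J where "J u = (l2_norm M u)\<^sup>2 - 2 * Re (l u)" for u
  define d where "d = Inf (J ` V)"
  \<comment> \<open>complete the square: \<open>x\<^sup>2 - 2 C x \<ge> - C\<^sup>2\<close>\<close>
  have J_lower: "J u \<ge> - C\<^sup>2" if "u \<in> V" for u
  proof -
    have "Re (l u) \<le> C * l2_norm M u" using l_bound[OF that] complex_Re_le_cmod[of "l u"] by linarith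
    moreover have "0 \<le> (l2_norm M u - C)\<^sup>2" by simp
    ultimately show ?thesis unfolding J_def power2_diff by (simp add: mult.commute)
  qed
  have bdd: "bdd_below (J ` V)" using J_lower by (auto simp: bdd_below_def)
  have ne: "J ` V \<noteq> {}" using V by (simp add: l2_complete_subspace_def)
  have dJ: "d \<le> J u" if "u \<in> V" for u unfolding d_def using bdd that by (simp add: cInf_lower)
  have "\<exists>u\<in>V. J u < d + 1 / Suc n" for n
    using cInf_lessD[OF ne, of "d + 1 / Suc n"] by (auto simp: d_def)
  then obtain u where u: "\<And>n. u n \<in> V" and uJ: "\<And>n. J (u n) < d + 1 / Suc n" by metis
  \<comment> \<open>the midpoint of \<open>u m\<close> and \<open>u n\<close> cannot do better than the infimum\<close>
  have dist: "(l2_norm M (\<lambda>z. u m z - u n z))\<^sup>2 \<le> 2 / Suc m + 2 / Suc n" for m n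
  proof -
    let ?w = "\<lambda>z. (1/2) * (u m z + u n z)"
    have w: "4 * J ?w = (l2_norm M (\<lambda>z. u m z + u n z))\<^sup>2 - 4 * Re (l (u m)) - 4 * Re (l (u n))"
      unfolding J_def l_scale[OF Vadd[OF u u]] l_add[OF u u] l2_norm_scale
      by (simp add: power_mult_distrib power_divide field_simps)
    have dw: "4 * d \<le> 4 * J ?w" using dJ[OF Vscale[OF Vadd[OF u u]], of "1/2" m n] by simp
    have J2: "4 * d + 2 / Suc m + 2 / Suc n \<ge> 2 * J (u m) + 2 * J (u n)"
      using uJ[of m] uJ[of n] times_divide_eq_right[of 2 1 "real (Suc m)"]
        times_divide_eq_right[of 2 1 "real (Suc n)"] by linarith
    have "(l2_norm M (\<lambda>z. u m z - u n z))\<^sup>2 = 2 * J (u m) + 2 * J (u n) - 4 * J ?w"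
      using l2_parallelogram[OF VL[OF u] VL[OF u], of m n] unfolding w unfolding J_def by simp
    then show ?thesis using dw J2 by linarith
  qed
  have "\<forall>e>0. \<exists>N. \<forall>m\<ge>N. \<forall>n\<ge>N. l2_norm M (\<lambda>z. u m z - u n z) < e"
  proof (intro allI impI)
    fix e :: real assume e: "e > 0"
    obtain N :: nat where N: "N > 4 / e\<^sup>2" using reals_Archimedean2 by blast
    have "l2_norm M (\<lambda>z. u m z - u n z) < e" if "m \<ge> N" "n \<ge> N" for m n
    proof -
      have *: "2 / Suc k < e\<^sup>2 / 2" if "k \<ge> N" for k
      proof -
        have "real (Suc k) > 4 / e\<^sup>2" using N that by linarith
        then show ?thesis using e by (simp add: field_simps)
      qed
      then have "(l2_norm M (\<lambda>z. u m z - u n z))\<^sup>2 < e\<^sup>2" 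
        using dist[of m n] *[OF \<open>m \<ge> N\<close>] *[OF \<open>n \<ge> N\<close>] by linarith
      then show ?thesis using e by (simp add: power_less_imp_less_base)
    qed
    then show "\<exists>N. \<forall>m\<ge>N. \<forall>n\<ge>N. l2_norm M (\<lambda>z. u m z - u n z) < e" by blast
  qed
  then obtain v where v: "v \<in> V" and uv: "(\<lambda>n. l2_norm M (\<lambda>z. u n z - v z)) \<longlonglongrightarrow> 0"
    using V u unfolding l2_complete_subspace_def by blast
  have pair_lim: "(\<lambda>n. l2_pair M f (u n)) \<longlonglongrightarrow> l2_pair M f v" if f: "f \<in> V" for f
  proof (rule LIM_zero_cancel, rule tendsto_0_le[where K = "l2_norm M f"])
    show "(\<lambda>n. l2_norm M (\<lambda>z. u n z - v z)) \<longlonglongrightarrow> 0" by (rule uv)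
    show "\<forall>\<^sub>F n in sequentially. norm (l2_pair M f (u n) - l2_pair M f v)
        \<le> norm (l2_norm M (\<lambda>z. u n z - v z)) * l2_norm M f"
      using l2_Cauchy_Schwarz[OF VL[OF f] l2_space_diff[OF VL[OF u] VL[OF v]]]
      by (simp add: l2_pair_diff_right VL u v f mult.commute)
  qed
  have real_part: "Re (l2_pair M f v - l f) = 0" if f: "f \<in> V" for f
  proof -
    have quad: "0 \<le> x\<^sup>2 * (l2_norm M f)\<^sup>2 + 2 * x * Re (l2_pair M f v - l f)" for x :: real
    proof -
      have low: "0 \<le> 1 / Suc n + (x\<^sup>2 * (l2_norm M f)\<^sup>2 + 2 * x * Re (l2_pair M f (u n) - l f))" for n
      proof -
        let ?w = "\<lambda>z. u n z + of_real x * f z"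
        have w: "?w \<in> V" by (intro Vadd Vscale u f)
        have "complex_of_real ((l2_norm M ?w)\<^sup>2) = l2_pair M ?w ?w" by (simp only: l2_pair_self)
        also have "\<dots> = l2_pair M (u n) (u n) + of_real x * l2_pair M (u n) f
            + of_real x * l2_pair M f (u n) + of_real (x\<^sup>2) * l2_pair M f f"
          using VL[OF u] VL[OF f]
          by (simp add: l2_pair_add_left l2_pair_add_right l2_pair_scale_left l2_pair_scale_right
              l2_space_add l2_space_scale algebra_simps power2_eq_square)
        also have "\<dots> = complex_of_real ((l2_norm M (u n))\<^sup>2) + of_real x * cnj (l2_pair M f (u n))
            + of_real x * l2_pair M f (u n) + of_real (x\<^sup>2 * (l2_norm M f)\<^sup>2)"
          by (simp add: l2_pair_self l2_pair_cnj)
        finally have "(l2_norm M ?w)\<^sup>2 = Re (complex_of_real ((l2_norm M (u n))\<^sup>2) + of_real x * cnj (l2_pair M f (u n))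
            + of_real x * l2_pair M f (u n) + of_real (x\<^sup>2 * (l2_norm M f)\<^sup>2))"
          by (metis Re_complex_of_real)
        also have "\<dots> = (l2_norm M (u n))\<^sup>2 + 2 * x * Re (l2_pair M f (u n)) + x\<^sup>2 * (l2_norm M f)\<^sup>2"
          by (simp del: of_real_power of_real_mult)
        finally have "J ?w = J (u n) + (x\<^sup>2 * (l2_norm M f)\<^sup>2 + 2 * x * Re (l2_pair M f (u n) - l f))"
          unfolding J_def l_add[OF u Vscale[OF f]] l_scale[OF f] by (simp add: algebra_simps)
        then show ?thesis using dJ[OF w] uJ[of n] by linarith
      qed
      have "(\<lambda>n. 1 / Suc n + (x\<^sup>2 * (l2_norm M f)\<^sup>2 + 2 * x * Re (l2_pair M f (u n) - l f)))
         \<longlonglongrightarrow> 0 + (x\<^sup>2 * (l2_norm M f)\<^sup>2 + 2 * x * Re (l2_pair M f v - l f))"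
        by (intro tendsto_intros pair_lim f LIMSEQ_Suc lim_1_over_n)
      from LIMSEQ_le_const[OF this] low show ?thesis by auto
    qed
    \<comment> \<open>at this \<open>x\<close> the polynomial is negative unless the linear coefficient vanishes; \<open>a + 1\<close> avoids a zero denominator\<close>
    define a b where "a = (l2_norm M f)\<^sup>2" and "b = Re (l2_pair M f v - l f)"
    have a: "a \<ge> 0" by (simp add: a_def)
    have "0 \<le> (- b / (a + 1))\<^sup>2 * a + 2 * (- b / (a + 1)) * b"
      using quad[of "- b / (a + 1)"] by (simp add: a_def b_def)
    also have "\<dots> = - (b\<^sup>2 * (a + 2) / (a + 1)\<^sup>2)"
      using a by (simp add: field_simps power2_eq_square add_nonneg_eq_0_iff)
    finally have "b\<^sup>2 * (a + 2) / (a + 1)\<^sup>2 \<le> 0" by linarith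
    then have "b\<^sup>2 * (a + 2) \<le> 0" using a by (simp add: divide_le_0_iff)
    then have "b\<^sup>2 \<le> 0" using a by (simp add: mult_le_0_iff)
    then show ?thesis by (simp add: b_def)
  qed
  have "l2_pair M f v = l f" if f: "f \<in> V" for f
  proof -
    have "Re (\<i> * (l2_pair M f v - l f)) = 0"
      using real_part[OF Vscale[OF f, of \<i>]] by (simp add: l2_pair_scale_left l_scale f algebra_simps)
    with real_part[OF f] show ?thesis by (simp add: complex_eq_iff)
  qed
  with v show ?thesis by blast
qed

section \<open>Differentiation in the mean\<close>

definition l2_has_derivative ::
  "'a measure \<Rightarrow> (real \<Rightarrow> 'a \<Rightarrow> complex) \<Rightarrow> ('a \<Rightarrow> complex) \<Rightarrow> real \<Rightarrow> bool" where
  "l2_has_derivative M u u' t \<longleftrightarrow>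
     ((\<lambda>s. l2_norm M (\<lambda>z. (u s z - u t z) / of_real (s - t) - u' z)) \<longlongrightarrow> 0) (at t)"

text \<open>
  Differentiability of a family of bounded real factors, uniformly over the space. The quadratic
  remainder is what a bound on the second derivative provides, and it lets a single constant serve for
  all the estimates that a product of the factor with an \<open>L\<^sup>2\<close> family requires.
\<close>

definition multiplier_has_derivative ::
  "'a measure \<Rightarrow> (real \<Rightarrow> 'a \<Rightarrow> real) \<Rightarrow> ('a \<Rightarrow> real) \<Rightarrow> real \<Rightarrow> bool" where
  "multiplier_has_derivative M b b' t \<longleftrightarrow> b' \<in> borel_measurable M \<and>
     (\<exists>C\<ge>0. (\<forall>z\<in>space M. \<bar>b' z\<bar> \<le> C) \<and> (\<forall>\<^sub>F s in nhds t. b s \<in> borel_measurable M \<and>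
        (\<forall>z\<in>space M. \<bar>b s z\<bar> \<le> C \<and> \<bar>b s z - b t z\<bar> \<le> C * \<bar>s - t\<bar> \<and>
           \<bar>(b s z - b t z) - (s - t) * b' z\<bar> \<le> C * (s - t)\<^sup>2)))"

lemma l2_space_multiplier:
  assumes "f \<in> l2_space M" "b \<in> borel_measurable M" "\<And>z. z \<in> space M \<Longrightarrow> \<bar>b z\<bar> \<le> C"
  shows "(\<lambda>z. complex_of_real (b z) * f z) \<in> l2_space M"
  by (rule l2_spaceI_bounded(1)[OF assms(1), where C = C])
     (use assms in \<open>auto simp: norm_mult intro!: mult_right_mono\<close>)

lemma l2_norm_multiplier:
  assumes "f \<in> l2_space M" "b \<in> borel_measurable M" "\<And>z. z \<in> space M \<Longrightarrow> \<bar>b z\<bar> \<le> C" "C \<ge> 0"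
  shows "l2_norm M (\<lambda>z. complex_of_real (b z) * f z) \<le> C * l2_norm M f"
  by (rule l2_spaceI_bounded(2)[OF assms(1), where C = C])
     (use assms in \<open>auto simp: norm_mult intro!: mult_right_mono\<close>)

lemma multiplier_remainder_bound:
  fixes s t :: real
  assumes "\<bar>x - (s - t) * y\<bar> \<le> C * (s - t)\<^sup>2" "s \<noteq> t"
  shows "\<bar>x / (s - t) - y\<bar> \<le> C * \<bar>s - t\<bar>"
proof -
  have "\<bar>x / (s - t) - y\<bar> = \<bar>x - (s - t) * y\<bar> / \<bar>s - t\<bar>"
    using assms(2) by (simp add: abs_divide[symmetric] diff_divide_distrib)
  also have "\<dots> \<le> C * \<bar>s - t\<bar>\<^sup>2 / \<bar>s - t\<bar>"
    using assms(1) by (intro divide_right_mono) simp_all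
  also have "\<dots> = C * \<bar>s - t\<bar>"
    using assms(2) by (cases "s \<le> t") (simp_all add: power2_eq_square)
  finally show ?thesis .
qed

text \<open>
  Besides \<open>b\<^sub>s\<close> times the error of the difference quotient of \<open>u\<close>, the error for the product consists of
  \<open>(b\<^sub>s - b\<^sub>t) u'\<close> and of the error of the difference quotient of \<open>b\<close> times \<open>u\<^sub>t\<close>, both of order \<open>\<bar>s - t\<bar>\<close>.
\<close>

lemma l2_has_derivative_mult:
  fixes b :: "real \<Rightarrow> 'a \<Rightarrow> real"
  assumes b: "multiplier_has_derivative M b b' t"
    and u: "l2_has_derivative M u u' t"
    and uL: "\<forall>\<^sub>F s in nhds t. u s \<in> l2_space M" and u'L: "u' \<in> l2_space M"
  shows "l2_has_derivative M (\<lambda>s z. of_real (b s z) * u s z)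
           (\<lambda>z. of_real (b t z) * u' z + of_real (b' z) * u t z) t"
proof -
  obtain C where C: "C \<ge> 0" and b'm [measurable]: "b' \<in> borel_measurable M"
    and b'C: "\<And>z. z \<in> space M \<Longrightarrow> \<bar>b' z\<bar> \<le> C"
    and near: "\<forall>\<^sub>F s in nhds t. b s \<in> borel_measurable M \<and>
        (\<forall>z\<in>space M. \<bar>b s z\<bar> \<le> C \<and> \<bar>b s z - b t z\<bar> \<le> C * \<bar>s - t\<bar> \<and>
           \<bar>(b s z - b t z) - (s - t) * b' z\<bar> \<le> C * (s - t)\<^sup>2)"
    using b unfolding multiplier_has_derivative_def by blast
  have utL: "u t \<in> l2_space M" using eventually_nhds_x_imp_x[OF uL] .
  have btm [measurable]: "b t \<in> borel_measurable M" using eventually_nhds_x_imp_x[OF near] by blast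
  define q where "q s z = (u s z - u t z) / of_real (s - t) - u' z" for s z
  have q0: "((\<lambda>s. l2_norm M (q s)) \<longlongrightarrow> 0) (at t)"
    using u unfolding l2_has_derivative_def q_def .
  have est: "\<forall>\<^sub>F s in at t. norm (l2_norm M (\<lambda>z. (of_real (b s z) * u s z - of_real (b t z) * u t z) / of_real (s - t)
        - (of_real (b t z) * u' z + of_real (b' z) * u t z)))
      \<le> C * l2_norm M (q s) + (C * \<bar>s - t\<bar> * l2_norm M u' + C * \<bar>s - t\<bar> * l2_norm M (u t))"
    using near[THEN eventually_nhds_conv_at[THEN iffD1, THEN conjunct1]]
      uL[THEN eventually_nhds_conv_at[THEN iffD1, THEN conjunct1]]
      eventually_neq_at_within[of t t UNIV]
  proof eventually_elim
    case (elim s)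
    then have [measurable]: "b s \<in> borel_measurable M" and st: "s \<noteq> t" and usL: "u s \<in> l2_space M" by auto
    have qL: "q s \<in> l2_space M"
      unfolding q_def using l2_space_diff[OF l2_space_scale[OF l2_space_diff[OF usL utL], of "1 / of_real (s - t)"] u'L]
      by simp
    let ?d = "\<lambda>z. b s z - b t z" and ?r = "\<lambda>z. (b s z - b t z) / (s - t) - b' z"
    have L1: "(\<lambda>z. of_real (b s z) * q s z) \<in> l2_space M"
      and N1: "l2_norm M (\<lambda>z. of_real (b s z) * q s z) \<le> C * l2_norm M (q s)"
      using l2_space_multiplier[OF qL, of "b s" C] l2_norm_multiplier[OF qL, of "b s" C] elim C by auto
    have d: "\<bar>?d z\<bar> \<le> C * \<bar>s - t\<bar>" if "z \<in> space M" for z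
      using elim that by auto
    have dm: "?d \<in> borel_measurable M" and rm: "?r \<in> borel_measurable M" by measurable
    have C': "0 \<le> C * \<bar>s - t\<bar>" using C by simp
    note L2 = l2_space_multiplier[OF u'L dm d] and N2 = l2_norm_multiplier[OF u'L dm d C']
    have r: "\<bar>?r z\<bar> \<le> C * \<bar>s - t\<bar>" if "z \<in> space M" for z
      by (rule multiplier_remainder_bound) (use elim that in auto)
    note L3 = l2_space_multiplier[OF utL rm r] and N3 = l2_norm_multiplier[OF utL rm r C']
    have "l2_norm M (\<lambda>z. (of_real (b s z) * u s z - of_real (b t z) * u t z) / of_real (s - t)
        - (of_real (b t z) * u' z + of_real (b' z) * u t z))
      = l2_norm M (\<lambda>z. of_real (b s z) * q s z + (of_real (?d z) * u' z + of_real (?r z) * u t z))"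
      by (simp add: q_def divide_inverse algebra_simps)
    also have "\<dots> \<le> l2_norm M (\<lambda>z. of_real (b s z) * q s z)
        + (l2_norm M (\<lambda>z. of_real (?d z) * u' z) + l2_norm M (\<lambda>z. of_real (?r z) * u t z))"
      using l2_norm_triangle[OF L1 l2_space_add[OF L2 L3]] l2_norm_triangle[OF L2 L3] by linarith
    finally show ?case using N1 N2 N3 by simp
  qed
  have "((\<lambda>s. C * l2_norm M (q s) + (C * \<bar>s - t\<bar> * l2_norm M u' + C * \<bar>s - t\<bar> * l2_norm M (u t)))
      \<longlongrightarrow> C * 0 + (C * \<bar>t - t\<bar> * l2_norm M u' + C * \<bar>t - t\<bar> * l2_norm M (u t))) (at t)"
    by (intro tendsto_intros q0)
  then show ?thesis
    unfolding l2_has_derivative_def by (intro Lim_null_comparison[OF est]) simp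
qed

lemma l2_has_derivative_sum:
  fixes u :: "'i \<Rightarrow> real \<Rightarrow> 'a \<Rightarrow> complex"
  assumes u: "\<And>i. i \<in> I \<Longrightarrow> l2_has_derivative M (u i) (u' i) t"
    and uL: "\<And>i. i \<in> I \<Longrightarrow> \<forall>\<^sub>F s in nhds t. u i s \<in> l2_space M"
    and u'L: "\<And>i. i \<in> I \<Longrightarrow> u' i \<in> l2_space M" and I: "finite I"
  shows "l2_has_derivative M (\<lambda>s z. \<Sum>i\<in>I. c i * u i s z) (\<lambda>z. \<Sum>i\<in>I. c i * u' i z) t"
proof -
  define q where "q i s z = (u i s z - u i t z) / of_real (s - t) - u' i z" for i s z
  have q0: "((\<lambda>s. l2_norm M (q i s)) \<longlongrightarrow> 0) (at t)" if "i \<in> I" for i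
    using u[OF that] unfolding l2_has_derivative_def q_def .
  have norm_sum: "l2_norm M (\<lambda>z. \<Sum>i\<in>J. c i * g i z) \<le> (\<Sum>i\<in>J. cmod (c i) * l2_norm M (g i))"
    if "\<And>i. i \<in> J \<Longrightarrow> g i \<in> l2_space M" for J and g :: "'i \<Rightarrow> 'a \<Rightarrow> complex"
    using that
  proof (induction J rule: infinite_finite_induct)
    case (insert j J)
    have "l2_norm M (\<lambda>z. \<Sum>i\<in>insert j J. c i * g i z) = l2_norm M (\<lambda>z. c j * g j z + (\<Sum>i\<in>J. c i * g i z))"
      using insert by simp
    also have "\<dots> \<le> l2_norm M (\<lambda>z. c j * g j z) + l2_norm M (\<lambda>z. \<Sum>i\<in>J. c i * g i z)"
      using insert by (intro l2_norm_triangle l2_space_sum l2_space_scale) auto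
    also have "\<dots> \<le> cmod (c j) * l2_norm M (g j) + (\<Sum>i\<in>J. cmod (c i) * l2_norm M (g i))"
      using insert by (simp add: l2_norm_scale)
    finally show ?case using insert by simp
  qed (auto simp: l2_norm_def)
  have ev: "\<forall>\<^sub>F s in nhds t. \<forall>i\<in>I. u i s \<in> l2_space M"
    using uL I by (simp add: eventually_ball_finite_distrib)
  have est: "\<forall>\<^sub>F s in at t. norm (l2_norm M (\<lambda>z. ((\<Sum>i\<in>I. c i * u i s z) - (\<Sum>i\<in>I. c i * u i t z)) / of_real (s - t)
        - (\<Sum>i\<in>I. c i * u' i z))) \<le> (\<Sum>i\<in>I. cmod (c i) * l2_norm M (q i s))"
    using ev[THEN eventually_nhds_conv_at[THEN iffD1, THEN conjunct1]]
  proof eventually_elim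
    case (elim s)
    have qL: "q i s \<in> l2_space M" if "i \<in> I" for i
    proof -
      have "u i s \<in> l2_space M" "u i t \<in> l2_space M" using elim that eventually_nhds_x_imp_x[OF ev] by auto
      from l2_space_diff[OF l2_space_scale[OF l2_space_diff[OF this], of "1 / of_real (s - t)"] u'L[OF that]]
      show ?thesis unfolding q_def by simp
    qed
    have "(\<lambda>z. ((\<Sum>i\<in>I. c i * u i s z) - (\<Sum>i\<in>I. c i * u i t z)) / of_real (s - t)
        - (\<Sum>i\<in>I. c i * u' i z)) = (\<lambda>z. \<Sum>i\<in>I. c i * q i s z)"
      by (simp add: q_def sum_subtractf[symmetric] sum_divide_distrib algebra_simps diff_divide_distrib)
    then show ?case using norm_sum[of I "\<lambda>i. q i s", OF qL] by simp
  qed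
  have "((\<lambda>s. \<Sum>i\<in>I. cmod (c i) * l2_norm M (q i s)) \<longlongrightarrow> (\<Sum>i\<in>I. cmod (c i) * 0)) (at t)"
    by (intro tendsto_intros q0)
  then show ?thesis
    unfolding l2_has_derivative_def by (intro Lim_null_comparison[OF est]) simp
qed

lemma l2_pair_multiplier_coercive:
  fixes \<rho> :: "'a \<Rightarrow> real"
  assumes f: "f \<in> l2_space M" and \<rho>: "\<rho> \<in> borel_measurable M" "\<And>z. z \<in> space M \<Longrightarrow> \<bar>\<rho> z\<bar> \<le> C"
    and m: "\<And>z. z \<in> space M \<Longrightarrow> m \<le> \<rho> z"
  shows "m * (l2_norm M f)\<^sup>2 \<le> cmod (l2_pair M f (\<lambda>z. of_real (\<rho> z) * f z))"
proof -
  have e: "f z * cnj (of_real (\<rho> z) * f z) = of_real (\<rho> z * (cmod (f z))\<^sup>2)" for z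
    unfolding of_real_mult complex_norm_square by (simp add: mult.left_commute)
  have i: "integrable M (\<lambda>z. \<rho> z * (cmod (f z))\<^sup>2)"
    using l2_pair_integrable(1)[OF f l2_space_multiplier[OF f \<rho>]] unfolding e complex_of_real_integrable_eq .
  have "m * (l2_norm M f)\<^sup>2 = (LINT z|M. m * (cmod (f z))\<^sup>2)" by (simp add: l2_norm_square)
  also have "\<dots> \<le> (LINT z|M. \<rho> z * (cmod (f z))\<^sup>2)"
    by (intro integral_mono i mult_right_mono m) (use l2_space_integrable[OF f] in auto)
  also have "\<dots> = Re (l2_pair M f (\<lambda>z. of_real (\<rho> z) * f z))"
    unfolding l2_pair_def e by (simp add: integral_complex_of_real del: of_real_mult of_real_power)
  also have "\<dots> \<le> cmod (l2_pair M f (\<lambda>z. of_real (\<rho> z) * f z))" by (rule complex_Re_le_cmod)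
  finally show ?thesis .
qed

text \<open>
  Implicit differentiation of a family that is known only through its weighted pairings with \<open>A\<close>, as are
  the Bergman kernels. Let \<open>q\<^sub>s\<close> be the difference quotient of \<open>u\<close> minus the proposed derivative. It lies
  in \<open>A\<close>, so the equations at \<open>s\<close> and \<open>t\<close> compute its pairings with weight \<open>\<rho>\<^sub>s\<close>: they agree with the
  pairings of a function that tends to zero in \<open>L\<^sup>2\<close>. Testing with \<open>q\<^sub>s\<close> itself, the lower bound on \<open>\<rho>\<^sub>s\<close>
  and the Cauchy-Schwarz inequality force \<open>q\<^sub>s\<close> to zero. Pairing with \<open>\<rho>\<^sub>s\<close> rather than \<open>\<rho>\<^sub>t\<close> leaves
  only the fixed functions \<open>u\<^sub>t\<close> and \<open>u'\<close> in the error terms, while the norm of \<open>u\<^sub>s\<close> is not yet under control.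
\<close>

theorem l2_has_derivative_implicit:
  fixes \<rho> :: "real \<Rightarrow> 'a \<Rightarrow> real"
  assumes A: "A \<subseteq> l2_space M" and A_diff: "\<And>f g. f \<in> A \<Longrightarrow> g \<in> A \<Longrightarrow> (\<lambda>z. f z - g z) \<in> A"
    and A_scale: "\<And>c f. f \<in> A \<Longrightarrow> (\<lambda>z. c * f z) \<in> A"
    and \<rho>: "multiplier_has_derivative M \<rho> \<rho>' t"
    and m: "m > 0" "\<forall>\<^sub>F s in nhds t. \<forall>z\<in>space M. m \<le> \<rho> s z"
    and uA: "\<forall>\<^sub>F s in nhds t. u s \<in> A" and u'A: "u' \<in> A"
    and vL: "\<forall>\<^sub>F s in nhds t. v s \<in> l2_space M" and v'L: "v' \<in> l2_space M"
    and v: "l2_has_derivative M v v' t"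
    and eq: "\<forall>\<^sub>F s in nhds t. \<forall>f\<in>A. l2_pair M f (\<lambda>z. of_real (\<rho> s z) * u s z) = c f + l2_pair M f (v s)"
    and eq': "\<And>f. f \<in> A \<Longrightarrow> l2_pair M f (\<lambda>z. of_real (\<rho> t z) * u' z) = l2_pair M f (\<lambda>z. v' z - of_real (\<rho>' z) * u t z)"
  shows "l2_has_derivative M u u' t"
proof -
  obtain C where C: "C \<ge> 0" and \<rho>'m [measurable]: "\<rho>' \<in> borel_measurable M"
    and \<rho>'C: "\<And>z. z \<in> space M \<Longrightarrow> \<bar>\<rho>' z\<bar> \<le> C"
    and near: "\<forall>\<^sub>F s in nhds t. \<rho> s \<in> borel_measurable M \<and>
        (\<forall>z\<in>space M. \<bar>\<rho> s z\<bar> \<le> C \<and> \<bar>\<rho> s z - \<rho> t z\<bar> \<le> C * \<bar>s - t\<bar> \<and>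
           \<bar>(\<rho> s z - \<rho> t z) - (s - t) * \<rho>' z\<bar> \<le> C * (s - t)\<^sup>2)"
    using \<rho> unfolding multiplier_has_derivative_def by blast
  have [measurable]: "\<rho> t \<in> borel_measurable M" and \<rho>tC: "\<And>z. z \<in> space M \<Longrightarrow> \<bar>\<rho> t z\<bar> \<le> C"
    using eventually_nhds_x_imp_x[OF near] by auto
  have utA: "u t \<in> A" using eventually_nhds_x_imp_x[OF uA] .
  have vtL: "v t \<in> l2_space M" using eventually_nhds_x_imp_x[OF vL] .
  have eqt: "l2_pair M f (\<lambda>z. of_real (\<rho> t z) * u t z) = c f + l2_pair M f (v t)" if "f \<in> A" for f
    using eventually_nhds_x_imp_x[OF eq] that by blast
  have utL: "u t \<in> l2_space M" and u'L: "u' \<in> l2_space M" using A utA u'A by auto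
  define q where "q s z = (u s z - u t z) / of_real (s - t) - u' z" for s z
  define p where "p s z = (v s z - v t z) / of_real (s - t) - v' z" for s z
  have p0: "((\<lambda>s. l2_norm M (p s)) \<longlongrightarrow> 0) (at t)"
    using v unfolding l2_has_derivative_def p_def .
  have "\<forall>\<^sub>F s in nhds t. (\<rho> s \<in> borel_measurable M \<and>
        (\<forall>z\<in>space M. \<bar>\<rho> s z\<bar> \<le> C \<and> \<bar>\<rho> s z - \<rho> t z\<bar> \<le> C * \<bar>s - t\<bar> \<and>
           \<bar>(\<rho> s z - \<rho> t z) - (s - t) * \<rho>' z\<bar> \<le> C * (s - t)\<^sup>2)) \<and> (\<forall>z\<in>space M. m \<le> \<rho> s z) \<and>
      u s \<in> A \<and> v s \<in> l2_space M \<and>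
      (\<forall>f\<in>A. l2_pair M f (\<lambda>z. of_real (\<rho> s z) * u s z) = c f + l2_pair M f (v s))"
    by (intro eventually_conj near m uA vL eq)
  then have "\<forall>\<^sub>F s in at t. (\<rho> s \<in> borel_measurable M \<and>
        (\<forall>z\<in>space M. \<bar>\<rho> s z\<bar> \<le> C \<and> \<bar>\<rho> s z - \<rho> t z\<bar> \<le> C * \<bar>s - t\<bar> \<and>
           \<bar>(\<rho> s z - \<rho> t z) - (s - t) * \<rho>' z\<bar> \<le> C * (s - t)\<^sup>2)) \<and> (\<forall>z\<in>space M. m \<le> \<rho> s z) \<and>
      u s \<in> A \<and> v s \<in> l2_space M \<and>
      (\<forall>f\<in>A. l2_pair M f (\<lambda>z. of_real (\<rho> s z) * u s z) = c f + l2_pair M f (v s))"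
    by (simp add: eventually_nhds_conv_at)
  with eventually_neq_at_within[of t t UNIV]
  have est: "\<forall>\<^sub>F s in at t. norm (l2_norm M (q s))
      \<le> (l2_norm M (p s) + C * \<bar>s - t\<bar> * l2_norm M (u t) + C * \<bar>s - t\<bar> * l2_norm M u') / m"
  proof eventually_elim
    case (elim s)
    then have [measurable]: "\<rho> s \<in> borel_measurable M" and st: "s \<noteq> t" and usA: "u s \<in> A"
      and vsL: "v s \<in> l2_space M" and \<rho>sC: "\<And>z. z \<in> space M \<Longrightarrow> \<bar>\<rho> s z\<bar> \<le> C"
      and d: "\<And>z. z \<in> space M \<Longrightarrow> \<bar>\<rho> s z - \<rho> t z\<bar> \<le> C * \<bar>s - t\<bar>"
      and eqs: "\<And>f. f \<in> A \<Longrightarrow> l2_pair M f (\<lambda>z. of_real (\<rho> s z) * u s z) = c f + l2_pair M f (v s)"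
      by auto
    define k where "k = 1 / complex_of_real (s - t)"
    have usL: "u s \<in> l2_space M" using usA A by auto
    have qA: "q s \<in> A"
      unfolding q_def using A_diff[OF A_scale[OF A_diff[OF usA utA], of k] u'A] by (simp add: k_def)
    then have qL: "q s \<in> l2_space M" using A by auto
    have pL: "p s \<in> l2_space M"
      unfolding p_def using l2_space_diff[OF l2_space_scale[OF l2_space_diff[OF vsL vtL], of k] v'L]
      by (simp add: k_def)
    let ?r = "\<lambda>z. (\<rho> s z - \<rho> t z) / (s - t) - \<rho>' z" and ?d = "\<lambda>z. \<rho> s z - \<rho> t z"
    have r: "\<bar>?r z\<bar> \<le> C * \<bar>s - t\<bar>" if "z \<in> space M" for z
      by (rule multiplier_remainder_bound) (use elim that in auto)
    define R1 where "R1 = (\<lambda>z. complex_of_real (?r z) * u t z)"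
    define R2 where "R2 = (\<lambda>z. complex_of_real (?d z) * u' z)"
    have dm: "?d \<in> borel_measurable M" and rm: "?r \<in> borel_measurable M" by measurable
    have C': "0 \<le> C * \<bar>s - t\<bar>" using C by simp
    have R1: "R1 \<in> l2_space M" "l2_norm M R1 \<le> C * \<bar>s - t\<bar> * l2_norm M (u t)"
      unfolding R1_def using l2_space_multiplier[OF utL rm r] l2_norm_multiplier[OF utL rm r C'] by auto
    have R2: "R2 \<in> l2_space M" "l2_norm M R2 \<le> C * \<bar>s - t\<bar> * l2_norm M u'"
      unfolding R2_def using l2_space_multiplier[OF u'L dm d] l2_norm_multiplier[OF u'L dm d C'] by auto
    have \<rho>'u: "(\<lambda>z. complex_of_real (\<rho>' z) * u t z) \<in> l2_space M"
      by (rule l2_space_multiplier[OF utL _ \<rho>'C]) auto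
    have \<rho>tu: "(\<lambda>z. complex_of_real (\<rho> t z) * u t z) \<in> l2_space M"
      and \<rho>tu': "(\<lambda>z. complex_of_real (\<rho> t z) * u' z) \<in> l2_space M"
      by (rule l2_space_multiplier[OF _ _ \<rho>tC]; use utL u'L in auto)+
    have \<rho>su: "(\<lambda>z. complex_of_real (\<rho> s z) * u s z) \<in> l2_space M"
      by (rule l2_space_multiplier[OF usL _ \<rho>sC]) auto
    \<comment> \<open>the first bracket is known from the equations, the second one is small up to the term with \<open>\<rho>'\<close>\<close>
    have split: "complex_of_real (\<rho> s z) * q s z =
        (k * (of_real (\<rho> s z) * u s z - of_real (\<rho> t z) * u t z) - of_real (\<rho> t z) * u' z)
          - ((R1 z + of_real (\<rho>' z) * u t z) + R2 z)" for z
      using st by (simp add: q_def R1_def R2_def k_def divide_simps) (simp add: algebra_simps)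
    have pair: "l2_pair M f (\<lambda>z. of_real (\<rho> s z) * q s z) = l2_pair M f (\<lambda>z. p s z - (R1 z + R2 z))"
      if f: "f \<in> A" for f
    proof -
      have fL: "f \<in> l2_space M" using f A by auto
      have "l2_pair M f (\<lambda>z. of_real (\<rho> s z) * q s z) =
          cnj k * ((c f + l2_pair M f (v s)) - (c f + l2_pair M f (v t)))
           - (l2_pair M f v' - l2_pair M f (\<lambda>z. complex_of_real (\<rho>' z) * u t z))
           - (l2_pair M f R1 + l2_pair M f (\<lambda>z. complex_of_real (\<rho>' z) * u t z) + l2_pair M f R2)"
        unfolding split eqs[OF f, symmetric] eqt[OF f, symmetric]
        unfolding l2_pair_diff_right[OF v'L \<rho>'u fL, symmetric] eq'[OF f, symmetric]
        using \<rho>su \<rho>tu \<rho>tu' \<rho>'u R1(1) R2(1) fL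
        by (simp add: l2_pair_diff_right l2_pair_add_right l2_pair_scale_right l2_space_diff l2_space_add
            l2_space_scale)
      also have "\<dots> = l2_pair M f (\<lambda>z. (k * (v s z - v t z) - v' z) - (R1 z + R2 z))"
        using vsL vtL v'L R1(1) R2(1) fL
        by (simp add: l2_pair_diff_right l2_pair_add_right l2_pair_scale_right l2_space_diff l2_space_add
            l2_space_scale)
      finally show ?thesis by (simp add: p_def k_def)
    qed
    have "m * (l2_norm M (q s))\<^sup>2 \<le> cmod (l2_pair M (q s) (\<lambda>z. of_real (\<rho> s z) * q s z))"
      by (rule l2_pair_multiplier_coercive[OF qL _ \<rho>sC]) (use elim in auto)
    also have "\<dots> \<le> l2_norm M (q s) * l2_norm M (\<lambda>z. p s z - (R1 z + R2 z))"
      unfolding pair[OF qA] by (intro l2_Cauchy_Schwarz qL l2_space_diff pL l2_space_add R1 R2)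
    finally have "l2_norm M (q s) * (m * l2_norm M (q s)) \<le> l2_norm M (q s) * l2_norm M (\<lambda>z. p s z - (R1 z + R2 z))"
      by (simp add: power2_eq_square mult_ac)
    then have "m * l2_norm M (q s) \<le> l2_norm M (\<lambda>z. p s z - (R1 z + R2 z))"
      by (cases "l2_norm M (q s) = 0") (auto simp: mult_le_cancel_left_pos order_less_le)
    also have "\<dots> \<le> l2_norm M (p s) + (l2_norm M R1 + l2_norm M R2)"
      using l2_norm_triangle_diff[OF pL l2_space_add[OF R1(1) R2(1)]] l2_norm_triangle[OF R1(1) R2(1)] by linarith
    finally show ?case using R1(2) R2(2) m(1) by (simp add: pos_le_divide_eq mult.commute)
  qed
  have "((\<lambda>s. (l2_norm M (p s) + C * \<bar>s - t\<bar> * l2_norm M (u t) + C * \<bar>s - t\<bar> * l2_norm M u') / m)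
      \<longlongrightarrow> (0 + C * \<bar>t - t\<bar> * l2_norm M (u t) + C * \<bar>t - t\<bar> * l2_norm M u') / m) (at t)"
    using m(1) by (intro tendsto_intros p0) auto
  then have "((\<lambda>s. l2_norm M (q s)) \<longlongrightarrow> 0) (at t)"
    by (intro Lim_null_comparison[OF est]) simp
  then show ?thesis unfolding l2_has_derivative_def q_def .
qed

section \<open>Holomorphic functions of several variables\<close>

lemma nn_integral_lborel_translate:
  fixes g :: "'a::euclidean_space \<Rightarrow> ennreal"
  assumes "g \<in> borel_measurable borel"
  shows "(\<integral>\<^sup>+x. g (x + c) \<partial>lborel) = (\<integral>\<^sup>+x. g x \<partial>lborel)"
proof -
  have "(\<integral>\<^sup>+x. g x \<partial>lborel) = (\<integral>\<^sup>+x. g x \<partial>distr lborel borel ((+) c))"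
    by (simp add: lborel_distr_plus)
  also have "\<dots> = (\<integral>\<^sup>+x. g (c + x) \<partial>lborel)"
    by (rule nn_integral_distr) (use assms in auto)
  finally show ?thesis by (simp add: add.commute)
qed

text \<open>
  Uniqueness of translation invariant measures, in the form needed here. With \<open>B\<close> the unit ball, the
  double integral of \<open>g (R x + y) 1\<^sub>B y\<close> over \<open>x\<close> and \<open>y\<close> is evaluated in both orders. Translation in
  \<open>x\<close> by the preimage of \<open>y\<close> removes \<open>y\<close> from \<open>g\<close>; translation in \<open>y\<close> removes \<open>R x\<close> from \<open>g\<close> and moves
  it into the ball, whose preimages under the isometry are balls of the same volume.
\<close>

lemma nn_integral_lborel_isometry:
  fixes R :: "'a::euclidean_space \<Rightarrow> 'a" and g :: "'a \<Rightarrow> ennreal"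
  assumes R: "orthogonal_transformation R" and g: "g \<in> borel_measurable borel"
  shows "(\<integral>\<^sup>+x. g (R x) \<partial>lborel) = (\<integral>\<^sup>+x. g x \<partial>lborel)"
proof -
  define B :: "'a \<Rightarrow> ennreal" where "B = indicator (ball 0 1)"
  define V where "V = emeasure lborel (ball (0::'a) 1)"
  define S where "S = inv R"
  have [measurable]: "B \<in> borel_measurable borel" unfolding B_def by (intro borel_measurable_indicator) auto
  note g[measurable]
  have RS: "R (S y) = y" for y
    unfolding S_def using orthogonal_transformation_surj[OF R] by (simp add: surj_f_inv_f)
  have lin: "linear R" using R by (simp add: orthogonal_transformation_def)
  have cR: "continuous_on UNIV R"
    using lin by (simp add: linear_continuous_on linear_linear)
  have [measurable]: "R \<in> borel_measurable borel"
    by (rule borel_measurable_continuous_onI[OF cR])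
  have nR: "norm (R x) = norm x" for x using R by (simp add: orthogonal_transformation)
  have Vfin: "V \<noteq> \<infinity>" by (simp add: V_def emeasure_ball)
  have "measure lborel (ball (0::'a) 1) > 0" by simp
  then have V0: "V \<noteq> 0" by (auto simp: V_def measure_def)
  have "(\<integral>\<^sup>+x. g (R x) \<partial>lborel) * V = (\<integral>\<^sup>+y. (\<integral>\<^sup>+x. g (R x) \<partial>lborel) * B y \<partial>lborel)"
    by (subst nn_integral_cmult) (auto simp: B_def V_def intro!: borel_measurable_indicator)
  also have "\<dots> = (\<integral>\<^sup>+y. (\<integral>\<^sup>+x. g (R (x + S y)) \<partial>lborel) * B y \<partial>lborel)"
    by (subst nn_integral_lborel_translate[where g = "\<lambda>x. g (R x)"]) auto
  also have "\<dots> = (\<integral>\<^sup>+y. (\<integral>\<^sup>+x. g (R x + y) * B y \<partial>lborel) \<partial>lborel)"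
    by (subst nn_integral_multc) (auto simp: linear_add[OF lin] RS)
  also have "\<dots> = (\<integral>\<^sup>+x. (\<integral>\<^sup>+y. g (R x + y) * B y \<partial>lborel) \<partial>lborel)"
    by (rule lborel_pair.Fubini') measurable
  also have "\<dots> = (\<integral>\<^sup>+x. (\<integral>\<^sup>+y. g y * B (y - R x) \<partial>lborel) \<partial>lborel)"
  proof (rule nn_integral_cong)
    fix x
    show "(\<integral>\<^sup>+y. g (R x + y) * B y \<partial>lborel) = (\<integral>\<^sup>+y. g y * B (y - R x) \<partial>lborel)"
      using nn_integral_lborel_translate[where c = "- R x" and g = "\<lambda>y. g (R x + y) * B y"] by simp
  qed
  also have "\<dots> = (\<integral>\<^sup>+y. (\<integral>\<^sup>+x. g y * B (y - R x) \<partial>lborel) \<partial>lborel)"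
    by (rule lborel_pair.Fubini'[symmetric]) measurable
  also have "\<dots> = (\<integral>\<^sup>+y. g y * V \<partial>lborel)"
  proof (rule nn_integral_cong)
    fix y
    have "B (y - R x) = indicator (ball (S y) 1) x" for x
    proof -
      have "y - R x = R (S y - x)" by (simp add: linear_diff[OF lin] RS)
      then have "norm (y - R x) = dist (S y) x" by (simp add: nR dist_norm)
      then show ?thesis by (simp add: B_def indicator_def norm_minus_commute dist_norm)
    qed
    then have "(\<integral>\<^sup>+x. g y * B (y - R x) \<partial>lborel) = g y * emeasure lborel (ball (S y) 1)"
      by (simp add: nn_integral_cmult_indicator)
    then show "(\<integral>\<^sup>+x. g y * B (y - R x) \<partial>lborel) = g y * V"
      by (simp add: V_def emeasure_ball)
  qed
  also have "\<dots> = (\<integral>\<^sup>+y. g y \<partial>lborel) * V"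
    by (subst nn_integral_multc) auto
  finally show ?thesis
    using V0 Vfin by (metis ennreal_mult_cancel_left mult.commute infinity_ennreal_def)
qed

lemma norm_vector_scalar_mult_complex:
  fixes v :: "complex ^ 'n"
  shows "norm (c *s v) = cmod c * norm v"
  by (simp add: norm_vec_def norm_mult L2_set_right_distrib)

lemma orthogonal_transformation_unimodular:
  assumes "cmod c = 1"
  shows "orthogonal_transformation (\<lambda>v. c *s (v :: complex ^ 'n))"
  unfolding orthogonal_transformation
proof (intro conjI allI)
  show "linear (\<lambda>v. c *s (v :: complex ^ 'n))"
    by (rule linearI) (auto simp: vec_eq_iff algebra_simps scaleR_conv_of_real)
qed (simp add: norm_vector_scalar_mult_complex assms)

text \<open>
  The mean value property applied to \<open>g\<^sup>2\<close>, which is holomorphic too; this avoids a separate use of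
  Jensen's or the Cauchy-Schwarz inequality.
\<close>

lemma disc_submean_square:
  assumes holo: "g holomorphic_on cball 0 1"
  shows "ennreal ((cmod (g 0))\<^sup>2) \<le>
    (\<integral>\<^sup>+\<theta>. indicator {0..1} \<theta> * ennreal ((cmod (g (exp (2 * of_real pi * \<i> * of_real \<theta>))))\<^sup>2) \<partial>lborel)"
proof -
  let ?e = "\<lambda>\<theta>::real. exp (2 * of_real pi * \<i> * of_real \<theta>) :: complex"
  have cp: "circlepath 0 1 = ?e"
    by (simp add: circlepath)
  have ne: "cmod (?e \<theta>) = 1" for \<theta> by (simp add: norm_exp_eq_Re)
  have "(\<lambda>z. (g z)\<^sup>2) holomorphic_on cball 0 1" by (intro holomorphic_intros holo)
  from Cauchy_integral_circlepath_simple[OF this, of 0]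
  have "((\<lambda>u. (g u)\<^sup>2 / u) has_contour_integral (2 * of_real pi * \<i> * (g 0)\<^sup>2)) (circlepath 0 1)"
    by simp
  then have "((\<lambda>x. (g (?e x))\<^sup>2 / ?e x * vector_derivative (circlepath 0 1) (at x within {0..1}))
      has_integral (2 * of_real pi * \<i> * (g 0)\<^sup>2)) {0..1}"
    unfolding has_contour_integral_def by (simp add: cp)
  then have "((\<lambda>x. (2 * of_real pi * \<i>) * (g (?e x))\<^sup>2) has_integral ((2 * of_real pi * \<i>) * (g 0)\<^sup>2)) {0..1}"
    by (rule has_integral_eq[rotated]) (simp add: vector_derivative_circlepath01)
  then have I: "((\<lambda>x. (g (?e x))\<^sup>2) has_integral (g 0)\<^sup>2) {0..1}"
    by (drule_tac has_integral_mult_right[where c = "inverse (2 * of_real pi * \<i>)"])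
      (simp add: field_simps)
  have cont: "continuous_on {0..1} (\<lambda>x. (cmod (g (?e x)))\<^sup>2)"
    by (intro continuous_intros continuous_on_compose2[OF holomorphic_on_imp_continuous_on[OF holo]])
       (auto simp: ne)
  have si: "set_integrable lborel {0..1} (\<lambda>x. (cmod (g (?e x)))\<^sup>2)"
    by (rule borel_integrable_atLeastAtMost'[OF cont])
  have "(cmod (g 0))\<^sup>2 = norm (integral {0..1} (\<lambda>x. (g (?e x))\<^sup>2))"
    using I by (simp add: integral_unique norm_power)
  also have "\<dots> \<le> integral {0..1} (\<lambda>x. (cmod (g (?e x)))\<^sup>2)"
    by (rule integral_norm_bound_integral)
       (use I cont in \<open>auto simp: norm_power integrable_continuous_interval has_integral_iff\<close>)
  also have "\<dots> = (LINT x:{0..1}|lborel. (cmod (g (?e x)))\<^sup>2)"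
    using set_borel_integral_eq_integral(2)[OF si] by simp
  finally have "ennreal ((cmod (g 0))\<^sup>2) \<le> ennreal (LINT x:{0..1}|lborel. (cmod (g (?e x)))\<^sup>2)"
    by (rule ennreal_leI)
  also have "\<dots> = (\<integral>\<^sup>+x. ennreal (indicator {0..1} x *\<^sub>R (cmod (g (?e x)))\<^sup>2) \<partial>lborel)"
    unfolding set_lebesgue_integral_def
    using si unfolding set_integrable_def
    by (subst nn_integral_eq_integral) auto
  also have "\<dots> = (\<integral>\<^sup>+\<theta>. indicator {0..1} \<theta> * ennreal ((cmod (g (?e \<theta>)))\<^sup>2) \<partial>lborel)"
    by (rule nn_integral_cong) (auto simp: indicator_def)
  finally show ?thesis .
qed

lemma holomorphic_vec_on_subset:
  "holomorphic_vec_on f S \<Longrightarrow> T \<subseteq> S \<Longrightarrow> holomorphic_vec_on f T"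
  unfolding holomorphic_vec_on_def by blast

lemma holomorphic_vec_on_imp_continuous_on:
  "holomorphic_vec_on f S \<Longrightarrow> continuous_on S f"
  unfolding holomorphic_vec_on_def
  by (meson continuous_at_imp_continuous_on has_derivative_continuous)

lemma holomorphic_vec_on_diff:
  assumes "holomorphic_vec_on f S" "holomorphic_vec_on g S"
  shows "holomorphic_vec_on (\<lambda>x. f x - g x) S"
  unfolding holomorphic_vec_on_def
proof
  fix z assume "z \<in> S"
  with assms obtain f' g' where "(f has_derivative f') (at z)" "\<forall>c v. f' (c *s v) = c * f' v"
    "(g has_derivative g') (at z)" "\<forall>c v. g' (c *s v) = c * g' v"
    unfolding holomorphic_vec_on_def by meson
  then show "\<exists>h'. ((\<lambda>x. f x - g x) has_derivative h') (at z) \<and> (\<forall>c v. h' (c *s v) = c * h' v)"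
    by (intro exI[of _ "\<lambda>v. f' v - g' v"]) (auto intro: has_derivative_diff simp: right_diff_distrib)
qed

lemma holomorphic_vec_on_const: "holomorphic_vec_on (\<lambda>z. c) S"
  unfolding holomorphic_vec_on_def by (intro ballI exI[of _ "\<lambda>v. 0"]) auto

lemma holomorphic_vec_on_add:
  assumes "holomorphic_vec_on f S" "holomorphic_vec_on g S"
  shows "holomorphic_vec_on (\<lambda>x. f x + g x) S"
  using holomorphic_vec_on_diff[OF assms(1) holomorphic_vec_on_diff[OF holomorphic_vec_on_const[of 0] assms(2)]]
  by simp

lemma holomorphic_vec_on_cmult:
  assumes "holomorphic_vec_on f S"
  shows "holomorphic_vec_on (\<lambda>x. c * f x) S"
  unfolding holomorphic_vec_on_def
proof
  fix z assume "z \<in> S"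
  with assms obtain f' where "(f has_derivative f') (at z)" "\<forall>c v. f' (c *s v) = c * f' v"
    unfolding holomorphic_vec_on_def by meson
  then show "\<exists>h'. ((\<lambda>x. c * f x) has_derivative h') (at z) \<and> (\<forall>c v. h' (c *s v) = c * h' v)"
    by (intro exI[of _ "\<lambda>v. c * f' v"]) (auto intro: has_derivative_mult_right)
qed

lemma holomorphic_vec_on_line_deriv:
  fixes f :: "complex ^ 'n \<Rightarrow> complex"
  assumes "(f has_derivative f') (at (z + \<xi> *s v))" "\<And>c v. f' (c *s v) = c * f' v"
  shows "((\<lambda>\<xi>. f (z + \<xi> *s v)) has_field_derivative f' v) (at \<xi>)"
proof -
  have l: "linear (\<lambda>h::complex. h *s v)"
    by (rule linearI) (auto simp: vec_eq_iff algebra_simps)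
  have "((\<lambda>\<xi>. z + \<xi> *s v) has_derivative (\<lambda>h. h *s v)) (at \<xi>)"
    using linear_imp_has_derivative[OF l] by (auto intro!: derivative_eq_intros)
  then have "((\<lambda>\<xi>. f (z + \<xi> *s v)) has_derivative (\<lambda>h. f' (h *s v))) (at \<xi>)"
    using assms(1) by (rule has_derivative_compose)
  then show ?thesis
    by (simp add: assms(2) has_field_derivative_def mult.commute[of _ "f' v"])
qed

lemma holomorphic_vec_on_line:
  assumes "holomorphic_vec_on f S" "\<And>\<xi>. \<xi> \<in> T \<Longrightarrow> z + \<xi> *s v \<in> S"
  shows "(\<lambda>\<xi>. f (z + \<xi> *s v)) holomorphic_on T"
proof -
  have "(\<lambda>\<xi>. f (z + \<xi> *s v)) field_differentiable at \<xi> within T" if \<xi>: "\<xi> \<in> T" for \<xi>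
  proof -
    obtain f' where "(f has_derivative f') (at (z + \<xi> *s v))" "\<And>c v. f' (c *s v) = c * f' v"
      using assms(1) assms(2)[OF \<xi>] unfolding holomorphic_vec_on_def by blast
    from holomorphic_vec_on_line_deriv[OF this] show ?thesis
      using field_differentiable_at_within field_differentiable_def by blast
  qed
  then show ?thesis by (auto simp: holomorphic_on_def)
qed

text \<open>
  Restricting \<open>f\<close> to the complex line through \<open>z\<close> in direction \<open>v\<close> bounds \<open>\<bar>f z\<bar>\<^sup>2\<close> by the average of
  \<open>\<bar>f\<bar>\<^sup>2\<close> over the circle \<open>z + e\<^bsup>i\<theta>\<^esup> v\<close>. Integrate over \<open>v\<close> in the ball and exchange the integrals: for
  each \<open>\<theta>\<close> the rotation \<open>v \<mapsto> e\<^bsup>i\<theta>\<^esup> v\<close> preserves the integral over the ball.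
\<close>

lemma holomorphic_vec_submean_square:
  fixes f :: "complex ^ 'n \<Rightarrow> complex"
  assumes f: "holomorphic_vec_on f (ball z r)" and r: "r > 0"
  shows "ennreal ((cmod (f z))\<^sup>2) * emeasure lborel (ball z r) \<le>
         (\<integral>\<^sup>+x\<in>ball z r. ennreal ((cmod (f x))\<^sup>2) \<partial>lborel)"
proof -
  let ?e = "\<lambda>\<theta>::real. exp (2 * of_real pi * \<i> * of_real \<theta>) :: complex"
  have ne: "cmod (?e \<theta>) = 1" for \<theta> by (simp add: norm_exp_eq_Re)
  define G :: "complex ^ 'n \<Rightarrow> ennreal"
    where "G = (\<lambda>x. ennreal (indicator (ball z r) x *\<^sub>R (cmod (f x))\<^sup>2))"
  have "(\<lambda>x. indicator (ball z r) x *\<^sub>R (cmod (f x))\<^sup>2) \<in> borel_measurable borel"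
    by (intro borel_measurable_continuous_on_indicator continuous_intros
        holomorphic_vec_on_imp_continuous_on[OF f]) auto
  then have [measurable]: "G \<in> borel_measurable borel"
    unfolding G_def by measurable
  have cont: "continuous_on UNIV (\<lambda>p::(complex^'n) \<times> real. z + ?e (snd p) *s fst p)"
    unfolding vector_scalar_mult_def
    by (intro continuous_intros)
  have "(\<lambda>p::(complex^'n) \<times> real. z + ?e (snd p) *s fst p) \<in> borel_measurable borel"
    by (rule borel_measurable_continuous_onI[OF cont])
  then have [measurable]:
    "(\<lambda>p::(complex^'n) \<times> real. z + ?e (snd p) *s fst p) \<in> borel_measurable (lborel \<Otimes>\<^sub>M lborel)"
    by (simp add: borel_prod[symmetric] cong: measurable_cong_sets)
  have pointwise: "indicator (ball 0 r) v * ennreal ((cmod (f z))\<^sup>2) \<le>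
      (\<integral>\<^sup>+\<theta>. indicator {0..1} \<theta> * G (z + ?e \<theta> *s v) \<partial>lborel)" for v
  proof (cases "v \<in> ball 0 r")
    case True
    then have inb: "z + \<xi> *s v \<in> ball z r" if "\<xi> \<in> cball 0 1" for \<xi>
    proof -
      have "cmod \<xi> * norm v \<le> 1 * norm v" using that by (intro mult_right_mono) auto
      then show ?thesis using True by (simp add: dist_norm norm_vector_scalar_mult_complex)
    qed
    have "(\<lambda>\<xi>. f (z + \<xi> *s v)) holomorphic_on cball 0 1"
      by (rule holomorphic_vec_on_line[OF f inb])
    from disc_submean_square[OF this]
    have "ennreal ((cmod (f z))\<^sup>2) \<le>
       (\<integral>\<^sup>+\<theta>. indicator {0..1} \<theta> * ennreal ((cmod (f (z + ?e \<theta> *s v)))\<^sup>2) \<partial>lborel)"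
      by simp
    also have "\<dots> = (\<integral>\<^sup>+\<theta>. indicator {0..1} \<theta> * G (z + ?e \<theta> *s v) \<partial>lborel)"
      using inb[of "?e _"] by (simp add: G_def ne)
    finally show ?thesis using True by simp
  qed simp
  have "ennreal ((cmod (f z))\<^sup>2) * emeasure lborel (ball z r)
      = (\<integral>\<^sup>+v. indicator (ball (0::complex^'n) r) v * ennreal ((cmod (f z))\<^sup>2) \<partial>lborel)"
    using r by (subst nn_integral_multc) (auto simp: emeasure_ball mult.commute intro!: borel_measurable_indicator)
  also have "\<dots> \<le> (\<integral>\<^sup>+v. (\<integral>\<^sup>+\<theta>. indicator {0..1} \<theta> * G (z + ?e \<theta> *s v) \<partial>lborel) \<partial>lborel)"
    by (intro nn_integral_mono pointwise)
  also have "\<dots> = (\<integral>\<^sup>+\<theta>. (\<integral>\<^sup>+v. indicator {0..1} \<theta> * G (z + ?e \<theta> *s v) \<partial>lborel) \<partial>lborel)"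
    by (rule lborel_pair.Fubini'[symmetric]) (simp add: split_def)
  also have "\<dots> = (\<integral>\<^sup>+\<theta>. indicator {0..1::real} \<theta> * (\<integral>\<^sup>+x. G x \<partial>lborel) \<partial>lborel)"
  proof (rule nn_integral_cong)
    fix \<theta> :: real
    have "(\<integral>\<^sup>+v. G (z + ?e \<theta> *s v) \<partial>lborel) = (\<integral>\<^sup>+v. G (z + v) \<partial>lborel)"
      by (rule nn_integral_lborel_isometry[OF orthogonal_transformation_unimodular[OF ne]]) measurable
    also have "\<dots> = (\<integral>\<^sup>+x. G x \<partial>lborel)"
      using nn_integral_lborel_translate[of G z] by (simp add: add.commute)
    finally have e: "(\<integral>\<^sup>+v. G (z + ?e \<theta> *s v) \<partial>lborel) = (\<integral>\<^sup>+x. G x \<partial>lborel)" .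
    have "(\<lambda>v::complex^'n. z + ?e \<theta> *s v) \<in> borel_measurable borel"
      unfolding vector_scalar_mult_def
      by (intro borel_measurable_continuous_onI continuous_intros)
    then have "(\<lambda>v. G (z + ?e \<theta> *s v)) \<in> borel_measurable lborel" by measurable
    then show "(\<integral>\<^sup>+v. indicator {0..1} \<theta> * G (z + ?e \<theta> *s v) \<partial>lborel)
        = indicator {0..1} \<theta> * (\<integral>\<^sup>+x. G x \<partial>lborel)"
      by (subst nn_integral_cmult) (simp_all add: e)
  qed
  also have "\<dots> = (\<integral>\<^sup>+x. G x \<partial>lborel)"
    by (subst nn_integral_multc) auto
  also have "\<dots> = (\<integral>\<^sup>+x\<in>ball z r. ennreal ((cmod (f x))\<^sup>2) \<partial>lborel)"
    unfolding G_def by (rule nn_integral_cong) (auto simp: indicator_def)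
  finally show ?thesis .
qed

text \<open>
  The Cauchy inequality on the disc that \<open>z + \<xi> *s v\<close> cuts out of the ball. The disc of half the radius
  is used, hence the factor 2: there \<open>f\<close> is holomorphic and bounded on the closed disc.
\<close>

lemma holomorphic_vec_Cauchy_estimate:
  fixes f :: "complex ^ 'n \<Rightarrow> complex"
  assumes f: "holomorphic_vec_on f (ball z r)" and r: "r > 0"
    and f': "(f has_derivative f') (at z)" "\<And>c v. f' (c *s v) = c * f' v"
    and B: "\<And>x. x \<in> ball z r \<Longrightarrow> cmod (f x) \<le> B"
  shows "cmod (f' v) \<le> 2 * B / r * norm v"
proof (cases "v = 0")
  case True
  then show ?thesis using f'(2)[of 0 v] by simp
next
  case False
  define s where "s = r / (2 * norm v)"
  have s: "s > 0" using r False by (simp add: s_def)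
  have inb: "z + \<xi> *s v \<in> ball z r" if "\<xi> \<in> cball 0 s" for \<xi>
  proof -
    have "cmod \<xi> * norm v \<le> s * norm v" using that by (intro mult_right_mono) auto
    also have "\<dots> < r" using r False by (simp add: s_def)
    finally show ?thesis by (simp add: dist_norm norm_vector_scalar_mult_complex)
  qed
  have h: "(\<lambda>\<xi>. f (z + \<xi> *s v)) holomorphic_on cball 0 s"
    by (rule holomorphic_vec_on_line[OF f inb])
  have "((\<lambda>\<xi>. f (z + \<xi> *s v)) has_field_derivative f' v) (at 0)"
    by (rule holomorphic_vec_on_line_deriv) (use f' in auto)
  then have d: "deriv (\<lambda>\<xi>. f (z + \<xi> *s v)) 0 = f' v" by (rule DERIV_imp_deriv)
  have "cmod ((deriv ^^ 1) (\<lambda>\<xi>. f (z + \<xi> *s v)) 0) \<le> fact 1 * B / s ^ 1"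
    by (rule Cauchy_inequality)
       (use h s inb B in \<open>auto intro: holomorphic_on_subset holomorphic_on_imp_continuous_on\<close>)
  then show ?thesis using r False by (simp add: d s_def field_simps)
qed

text \<open>
  By the Cauchy estimate the derivatives are locally uniformly Cauchy as linear maps as well, so the
  theorem on termwise differentiation applies, and complex linearity passes to the limit.
\<close>

lemma holomorphic_vec_on_locally_uniform_limit:
  fixes F :: "nat \<Rightarrow> complex ^ 'n \<Rightarrow> complex"
  assumes holo: "\<And>n. holomorphic_vec_on (F n) S"
    and cauchy: "\<And>z. z \<in> S \<Longrightarrow> \<exists>r>0. ball z r \<subseteq> S \<and>
      (\<forall>e>0. \<exists>N. \<forall>m\<ge>N. \<forall>n\<ge>N. \<forall>x\<in>ball z r. cmod (F m x - F n x) \<le> e)"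
    and lim: "\<And>x. x \<in> S \<Longrightarrow> (\<lambda>n. F n x) \<longlonglongrightarrow> f x"
  shows "holomorphic_vec_on f S"
  unfolding holomorphic_vec_on_def
proof
  fix z assume z: "z \<in> S"
  obtain r where r: "r > 0" "ball z r \<subseteq> S"
    and uc: "\<And>e. e > 0 \<Longrightarrow> \<exists>N. \<forall>m\<ge>N. \<forall>n\<ge>N. \<forall>x\<in>ball z r. cmod (F m x - F n x) \<le> e"
    using cauchy[OF z] by blast
  \<comment> \<open>at points of the half ball there is still room \<open>r/2\<close> for the Cauchy estimate\<close>
  define B where "B = ball z (r/2)"
  have zB: "z \<in> B" using r by (simp add: B_def)
  have Bsub: "ball x (r/2) \<subseteq> ball z r" if "x \<in> B" for x
  proof
    fix y assume "y \<in> ball x (r/2)"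
    then have "dist z y < r" using that dist_triangle[of z y x] by (simp add: B_def)
    then show "y \<in> ball z r" by simp
  qed
  have BS: "x \<in> S" if "x \<in> B" for x using Bsub[OF that] r that by (auto simp: B_def)
  have "\<forall>n. \<forall>x\<in>S. \<exists>f'. (F n has_derivative f') (at x) \<and> (\<forall>c v. f' (c *s v) = c * f' v)"
    using holo unfolding holomorphic_vec_on_def by blast
  then obtain D where D: "\<And>n x. x \<in> S \<Longrightarrow> (F n has_derivative D n x) (at x)"
    and Dc: "\<And>n x c v. x \<in> S \<Longrightarrow> D n x (c *s v) = c * D n x v"
    by metis
  have Dcauchy: "\<exists>N. \<forall>m\<ge>N. \<forall>n\<ge>N. \<forall>x\<in>B. \<forall>v. cmod (D m x v - D n x v) \<le> e * norm v"
    if e: "e > 0" for e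
  proof -
    obtain N where N: "\<And>m n x. m \<ge> N \<Longrightarrow> n \<ge> N \<Longrightarrow> x \<in> ball z r \<Longrightarrow> cmod (F m x - F n x) \<le> e * r / 4"
      using uc[of "e * r / 4"] e r by (metis divide_pos_pos mult_pos_pos zero_less_numeral)
    have "cmod (D m x v - D n x v) \<le> e * norm v" if "m \<ge> N" "n \<ge> N" "x \<in> B" for m n x v
    proof -
      have "cmod (D m x v - D n x v) \<le> 2 * (e * r / 4) / (r/2) * norm v"
      proof (rule holomorphic_vec_Cauchy_estimate)
        show "holomorphic_vec_on (\<lambda>x. F m x - F n x) (ball x (r/2))"
          by (rule holomorphic_vec_on_subset[OF holomorphic_vec_on_diff[OF holo holo]])
            (use Bsub[OF that(3)] r in auto)
        show "((\<lambda>x. F m x - F n x) has_derivative (\<lambda>v. D m x v - D n x v)) (at x)"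
          by (intro has_derivative_diff D BS that)
        show "D m x (c *s v) - D n x (c *s v) = c * (D m x v - D n x v)" for c v
          using BS[OF that(3)] by (simp add: Dc right_diff_distrib)
        show "cmod (F m y - F n y) \<le> e * r / 4" if "y \<in> ball x (r/2)" for y
          using N Bsub \<open>m \<ge> N\<close> \<open>n \<ge> N\<close> \<open>x \<in> B\<close> that by blast
      qed (use r in auto)
      then show ?thesis using r by simp
    qed
    then show ?thesis by blast
  qed
  define g' where "g' x v = lim (\<lambda>n. D n x v)" for x v
  have Dlim: "(\<lambda>n. D n x v) \<longlonglongrightarrow> g' x v" if xB: "x \<in> B" for x v
  proof -
    have "Cauchy (\<lambda>n. D n x v)"
    proof (rule CauchyI)
      fix e :: real assume e: "e > 0"
      have "e / (norm v + 1) > 0" using e by (simp add: add_nonneg_pos)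
      from Dcauchy[OF this] obtain N where
        N: "\<And>m n. m \<ge> N \<Longrightarrow> n \<ge> N \<Longrightarrow> cmod (D m x v - D n x v) \<le> e / (norm v + 1) * norm v"
        using xB by blast
      have "e / (norm v + 1) * norm v < e"
        using e by (simp add: pos_divide_less_eq add_nonneg_pos distrib_left)
      then show "\<exists>M. \<forall>m\<ge>M. \<forall>n\<ge>M. cmod (D m x v - D n x v) < e"
        using N by (meson le_less_trans)
    qed
    then show ?thesis unfolding g'_def using Cauchy_convergent convergent_LIMSEQ_iff by blast
  qed
  have "\<exists>g. \<forall>x\<in>B. (\<lambda>n. F n x) \<longlonglongrightarrow> g x \<and> (g has_derivative g' x) (at x within B)"
  proof (rule has_derivative_sequence)
    show "convex B" by (simp add: B_def)
    show "z \<in> B" by fact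
    show "(\<lambda>n. F n z) \<longlonglongrightarrow> f z" by (rule lim[OF z])
    show "(F n has_derivative D n x) (at x within B)" if "x \<in> B" for n x
      using D[OF BS[OF that]] by (rule has_derivative_at_withinI)
    show "\<forall>\<^sub>F n in sequentially. \<forall>x\<in>B. \<forall>v. cmod (D n x v - g' x v) \<le> e * norm v" if e: "e > 0" for e
    proof -
      obtain N where N: "\<And>m n x v. m \<ge> N \<Longrightarrow> n \<ge> N \<Longrightarrow> x \<in> B \<Longrightarrow> cmod (D m x v - D n x v) \<le> e * norm v"
        using Dcauchy[OF e] by blast
      have "cmod (D n x v - g' x v) \<le> e * norm v" if "n \<ge> N" "x \<in> B" for n x v
      proof (rule LIMSEQ_le_const2)
        show "(\<lambda>m. cmod (D n x v - D m x v)) \<longlonglongrightarrow> cmod (D n x v - g' x v)"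
          by (intro tendsto_intros Dlim that)
        show "\<exists>M. \<forall>m\<ge>M. cmod (D n x v - D m x v) \<le> e * norm v" using N that by blast
      qed
      then show ?thesis by (auto simp: eventually_sequentially)
    qed
  qed
  then obtain g where g: "\<And>x. x \<in> B \<Longrightarrow> (\<lambda>n. F n x) \<longlonglongrightarrow> g x"
    and g': "\<And>x. x \<in> B \<Longrightarrow> (g has_derivative g' x) (at x within B)" by blast
  have fg: "g x = f x" if "x \<in> B" for x
    using LIMSEQ_unique[OF g[OF that] lim[OF BS[OF that]]] .
  have "(g has_derivative g' z) (at z)"
    using g'[OF zB] zB by (simp add: B_def at_within_open[of _ "ball z (r/2)"])
  then have "(f has_derivative g' z) (at z)"
    by (rule has_derivative_transform_within_open[of _ _ _ _ B]) (use zB fg in \<open>auto simp: B_def\<close>)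
  moreover have "g' z (c *s v) = c * g' z v" for c v
  proof (rule LIMSEQ_unique[OF Dlim[OF zB]])
    show "(\<lambda>n. D n z (c *s v)) \<longlonglongrightarrow> c * g' z v"
      unfolding Dc[OF z] by (intro tendsto_intros Dlim zB)
  qed
  ultimately show "\<exists>f'. (f has_derivative f') (at z) \<and> (\<forall>c v. f' (c *s v) = c * f' v)"
    by blast
qed

section \<open>Bergman spaces with bounded weights\<close>

text \<open>
  The Bergman space of every bounded continuous weight on \<open>\<Omega>\<close>, as a set: a space of test functions that is
  independent of the parameter.
\<close>

definition unweighted_bergman_space :: "(complex ^ 'n) set \<Rightarrow> (complex ^ 'n \<Rightarrow> complex) set" where
  "unweighted_bergman_space \<Omega> =
     {f \<in> l2_space (lebesgue_on \<Omega>). holomorphic_vec_on f \<Omega> \<and> (\<forall>z. z \<notin> \<Omega> \<longrightarrow> f z = 0)}"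

lemma unweighted_bergman_space_linear:
  assumes "f \<in> unweighted_bergman_space \<Omega>"
  shows "g \<in> unweighted_bergman_space \<Omega> \<Longrightarrow> (\<lambda>z. f z + g z) \<in> unweighted_bergman_space \<Omega>"
    and "g \<in> unweighted_bergman_space \<Omega> \<Longrightarrow> (\<lambda>z. f z - g z) \<in> unweighted_bergman_space \<Omega>"
    and "(\<lambda>z. c * f z) \<in> unweighted_bergman_space \<Omega>"
  using assms unfolding unweighted_bergman_space_def
  by (auto intro: holomorphic_vec_on_add holomorphic_vec_on_diff holomorphic_vec_on_cmult)

lemma zero_in_unweighted_bergman_space: "(\<lambda>z. 0) \<in> unweighted_bergman_space \<Omega>"
  by (simp add: unweighted_bergman_space_def holomorphic_vec_on_const)

lemma unweighted_bergman_space_sum: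
  "(\<And>i. i \<in> I \<Longrightarrow> f i \<in> unweighted_bergman_space \<Omega>) \<Longrightarrow>
    (\<lambda>z. \<Sum>i\<in>I. c i * f i z) \<in> unweighted_bergman_space \<Omega>"
  by (induction I rule: infinite_finite_induct)
     (auto intro!: zero_in_unweighted_bergman_space unweighted_bergman_space_linear(1)
        unweighted_bergman_space_linear(3))

lemma unweighted_bergman_space_l2: "f \<in> unweighted_bergman_space \<Omega> \<Longrightarrow> f \<in> l2_space (lebesgue_on \<Omega>)"
  by (simp add: unweighted_bergman_space_def)

lemma bergman_evaluation_bound:
  fixes f :: "complex ^ 'n \<Rightarrow> complex"
  assumes \<Omega>: "open \<Omega>" and f: "f \<in> unweighted_bergman_space \<Omega>" and r: "r > 0" and sub: "ball z r \<subseteq> \<Omega>"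
  shows "cmod (f z) \<le> inverse (sqrt (measure lborel (ball (0 :: complex ^ 'n) r))) * l2_norm (lebesgue_on \<Omega>) f"
proof -
  let ?M = "lebesgue_on \<Omega>"
  define V where "V = measure lborel (ball (0 :: complex ^ 'n) r)"
  have V: "V > 0" using r unfolding V_def by simp
  have hol: "holomorphic_vec_on f (ball z r)" and fL: "f \<in> l2_space ?M"
    using f sub holomorphic_vec_on_subset by (auto simp: unweighted_bergman_space_def)
  have \<Omega>m: "\<Omega> \<in> sets lebesgue" using \<Omega> by (simp add: lebesgue_openin)
  have emV: "emeasure lborel (ball z r) = ennreal V"
    using r by (simp add: V_def measure_def emeasure_ball)
  have [measurable]: "(\<lambda>x. indicator (ball z r) x *\<^sub>R (cmod (f x))\<^sup>2) \<in> borel_measurable borel"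
    by (intro borel_measurable_continuous_on_indicator continuous_intros
        holomorphic_vec_on_imp_continuous_on[OF hol]) auto
  have Gm: "(\<lambda>x. ennreal (indicator (ball z r) x *\<^sub>R (cmod (f x))\<^sup>2)) \<in> borel_measurable lborel"
    by measurable
  have "ennreal ((cmod (f z))\<^sup>2 * V) = ennreal ((cmod (f z))\<^sup>2) * emeasure lborel (ball z r)"
    using V by (simp add: ennreal_mult emV)
  also have "\<dots> \<le> (\<integral>\<^sup>+x\<in>ball z r. ennreal ((cmod (f x))\<^sup>2) \<partial>lborel)"
    by (rule holomorphic_vec_submean_square[OF hol r])
  also have "\<dots> = (\<integral>\<^sup>+x. ennreal (indicator (ball z r) x *\<^sub>R (cmod (f x))\<^sup>2) \<partial>lborel)"
    by (rule nn_integral_cong) (auto simp: indicator_def)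
  also have "\<dots> = (\<integral>\<^sup>+x. ennreal (indicator (ball z r) x *\<^sub>R (cmod (f x))\<^sup>2) \<partial>lebesgue)"
    by (simp add: nn_integral_completion)
  also have "\<dots> \<le> (\<integral>\<^sup>+x\<in>\<Omega>. ennreal ((cmod (f x))\<^sup>2) \<partial>lebesgue)"
    using sub by (intro nn_integral_mono) (auto simp: indicator_def)
  also have "\<dots> = (\<integral>\<^sup>+x. ennreal ((cmod (f x))\<^sup>2) \<partial>?M)"
    using \<Omega>m by (subst nn_integral_restrict_space) auto
  also have "\<dots> = ennreal ((l2_norm ?M f)\<^sup>2)"
    unfolding l2_norm_square by (intro nn_integral_eq_integral l2_space_integrable fL) auto
  finally have "(cmod (f z))\<^sup>2 * V \<le> (l2_norm ?M f)\<^sup>2" by (subst (asm) ennreal_le_iff) auto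
  then have "(cmod (f z))\<^sup>2 \<le> (inverse (sqrt V) * l2_norm ?M f)\<^sup>2"
    using V by (simp add: power_mult_distrib power_inverse field_simps)
  then show ?thesis unfolding V_def[symmetric] by (rule power2_le_imp_le) (use V in auto)
qed

text \<open>
  Point evaluations are locally uniformly bounded, so a sequence that is Cauchy in \<open>L\<^sup>2\<close> converges
  locally uniformly to a holomorphic function, and Fatou's lemma shows that the convergence takes place
  in \<open>L\<^sup>2\<close> too.
\<close>

lemma unweighted_bergman_space_complete:
  fixes \<Omega> :: "(complex ^ 'n) set"
  assumes \<Omega>: "open \<Omega>"
  shows "l2_complete_subspace (lebesgue_on \<Omega>) (unweighted_bergman_space \<Omega>)"
proof -
  let ?A = "unweighted_bergman_space \<Omega>" and ?M = "lebesgue_on \<Omega>"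
  have "\<exists>f\<in>?A. (\<lambda>n. l2_norm ?M (\<lambda>z. F n z - f z)) \<longlonglongrightarrow> 0"
    if FA: "\<And>n. F n \<in> ?A" and C: "\<And>e. e > 0 \<Longrightarrow> \<exists>N. \<forall>m\<ge>N. \<forall>n\<ge>N. l2_norm ?M (\<lambda>z. F m z - F n z) < e"
    for F :: "nat \<Rightarrow> complex ^ 'n \<Rightarrow> complex"
  proof -
    have FL: "F n \<in> l2_space ?M" for n using FA by (simp add: unweighted_bergman_space_def)
    have loc: "\<exists>r>0. ball z r \<subseteq> \<Omega> \<and> (\<forall>e>0. \<exists>N. \<forall>m\<ge>N. \<forall>n\<ge>N. \<forall>x\<in>ball z r. cmod (F m x - F n x) \<le> e)"
      if z: "z \<in> \<Omega>" for z
    proof -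
      obtain R where R: "R > 0" "ball z R \<subseteq> \<Omega>" using \<Omega> z openE by blast
      define r where "r = R / 2"
      have r: "r > 0" "ball z r \<subseteq> \<Omega>" using R by (auto simp: r_def)
      define c where "c = inverse (sqrt (measure lborel (ball (0 :: complex ^ 'n) r)))"
      have c: "c > 0" using r by (simp add: c_def)
      have est: "cmod (F m x - F n x) \<le> c * l2_norm ?M (\<lambda>z. F m z - F n z)" if "x \<in> ball z r" for m n x
        unfolding c_def
      proof (rule bergman_evaluation_bound[OF \<Omega> unweighted_bergman_space_linear(2)[OF FA FA] r(1)])
        show "ball x r \<subseteq> \<Omega>"
        proof
          fix y assume "y \<in> ball x r"
          then have "dist z y < R" using that dist_triangle[of z y x] by (simp add: r_def)
          then show "y \<in> \<Omega>" using R by auto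
        qed
      qed
      have "\<exists>N. \<forall>m\<ge>N. \<forall>n\<ge>N. \<forall>x\<in>ball z r. cmod (F m x - F n x) \<le> e" if e: "e > 0" for e
      proof -
        obtain N where N: "\<And>m n. m \<ge> N \<Longrightarrow> n \<ge> N \<Longrightarrow> l2_norm ?M (\<lambda>z. F m z - F n z) < e / c"
          using C[of "e / c"] e c by auto
        have "c * l2_norm ?M (\<lambda>z. F m z - F n z) \<le> e" if "m \<ge> N" "n \<ge> N" for m n
          using N[OF that] c by (simp add: field_simps)
        then show ?thesis using est by (meson order_trans)
      qed
      then show ?thesis using r by blast
    qed
    define f where "f z = lim (\<lambda>n. F n z)" for z
    have lim: "(\<lambda>n. F n z) \<longlonglongrightarrow> f z" if z: "z \<in> \<Omega>" for z
    proof -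
      obtain r where r: "r > 0" and
        u: "\<And>e. e > 0 \<Longrightarrow> \<exists>N. \<forall>m\<ge>N. \<forall>n\<ge>N. \<forall>x\<in>ball z r. cmod (F m x - F n x) \<le> e"
        using loc[OF z] by blast
      have "Cauchy (\<lambda>n. F n z)"
      proof (rule CauchyI)
        fix e :: real assume "e > 0"
        then obtain N where "\<forall>m\<ge>N. \<forall>n\<ge>N. \<forall>x\<in>ball z r. cmod (F m x - F n x) \<le> e / 2"
          using u[of "e / 2"] by auto
        then have "\<forall>m\<ge>N. \<forall>n\<ge>N. cmod (F m z - F n z) < e"
          using r \<open>e > 0\<close> by (metis centre_in_ball half_gt_zero_iff field_less_half_sum le_less_trans field_sum_of_halves less_add_same_cancel1)
        then show "\<exists>N. \<forall>m\<ge>N. \<forall>n\<ge>N. cmod (F m z - F n z) < e" by blast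
      qed
      then show ?thesis unfolding f_def using Cauchy_convergent convergent_LIMSEQ_iff by blast
    qed
    have hol: "holomorphic_vec_on f \<Omega>"
      by (rule holomorphic_vec_on_locally_uniform_limit[of F])
         (use FA loc lim in \<open>auto simp: unweighted_bergman_space_def\<close>)
    have off: "f z = 0" if "z \<notin> \<Omega>" for z
      using that FA by (simp add: f_def unweighted_bergman_space_def)
    have close: "(\<lambda>z. F n z - f z) \<in> l2_space ?M \<and> l2_norm ?M (\<lambda>z. F n z - f z) \<le> e"
      if n: "n \<ge> N" and N: "\<And>m n. m \<ge> N \<Longrightarrow> n \<ge> N \<Longrightarrow> l2_norm ?M (\<lambda>z. F m z - F n z) < e" for N n e
    proof -
      have L: "(\<lambda>z. F n z - F (m + N) z) \<in> l2_space ?M" for m by (intro l2_space_diff FL)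
      have le: "l2_norm ?M (\<lambda>z. F n z - F (m + N) z) \<le> e" for m using N[of n "m + N"] n by simp
      have "(\<lambda>m. F n z - F (m + N) z) \<longlonglongrightarrow> F n z - f z" if "z \<in> space ?M" for z
        using that lim[of z] by (intro tendsto_intros LIMSEQ_ignore_initial_segment) auto
      from l2_space_pointwise_limit[OF L le this] show ?thesis by blast
    qed
    obtain N1 where "\<And>m n. m \<ge> N1 \<Longrightarrow> n \<ge> N1 \<Longrightarrow> l2_norm ?M (\<lambda>z. F m z - F n z) < 1"
      using C[of 1] by auto
    from close[OF order_refl this] have "(\<lambda>z. F N1 z - f z) \<in> l2_space ?M" by simp
    then have "(\<lambda>z. F N1 z - (F N1 z - f z)) \<in> l2_space ?M" by (rule l2_space_diff[OF FL])
    then have "f \<in> ?A" using hol off by (simp add: unweighted_bergman_space_def)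
    moreover have "(\<lambda>n. l2_norm ?M (\<lambda>z. F n z - f z)) \<longlonglongrightarrow> 0"
    proof (rule LIMSEQ_I)
      fix e :: real assume e: "e > 0"
      obtain N where N: "\<And>m n. m \<ge> N \<Longrightarrow> n \<ge> N \<Longrightarrow> l2_norm ?M (\<lambda>z. F m z - F n z) < e / 2"
        using C[of "e / 2"] e by auto
      have "norm (l2_norm ?M (\<lambda>z. F n z - f z) - 0) < e" if "n \<ge> N" for n
        using close[OF that N] e by simp
      then show "\<exists>N. \<forall>n\<ge>N. norm (l2_norm ?M (\<lambda>z. F n z - f z) - 0) < e" by blast
    qed
    ultimately show ?thesis by blast
  qed
  then show ?thesis
    unfolding l2_complete_subspace_def
    by (intro conjI allI impI ballI unweighted_bergman_space_linear subsetI unweighted_bergman_space_l2)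
       (use zero_in_unweighted_bergman_space[of \<Omega>] in auto)
qed

locale bounded_weight =
  fixes \<Omega> :: "(complex ^ 'n) set" and \<psi> :: "complex ^ 'n \<Rightarrow> real"
  assumes open_domain: "open \<Omega>" and weight_continuous: "continuous_on \<Omega> \<psi>"
    and weight_bounded: "bounded (\<psi> ` \<Omega>)"
begin

abbreviation "M \<equiv> lebesgue_on \<Omega>"
abbreviation "A \<equiv> unweighted_bergman_space \<Omega>"
abbreviation "\<rho> \<equiv> \<lambda>z. exp (- \<psi> z)"

text \<open>
  With the weight absorbed into the measure, the weighted inner product becomes the plain pairing, and the
  Riesz representation theorem applies to it.
\<close>

definition "W = density M (\<lambda>z. ennreal (\<rho> z))"

lemma weight_measurable [measurable]: "\<psi> \<in> borel_measurable M"
  by (rule continuous_imp_measurable_on_sets_lebesgue[OF weight_continuous])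
     (simp add: open_domain lebesgue_openin)

lemma density_bounds: "\<exists>m>0. \<exists>C>0. \<forall>z\<in>\<Omega>. m \<le> \<rho> z \<and> \<rho> z \<le> C"
proof -
  obtain B where "\<forall>z\<in>\<Omega>. \<bar>\<psi> z\<bar> \<le> B" using weight_bounded by (auto simp: bounded_iff)
  then have "\<forall>z\<in>\<Omega>. exp (- B) \<le> \<rho> z \<and> \<rho> z \<le> exp B" by fastforce
  then show ?thesis using exp_gt_zero by blast
qed

lemma weighted_L2_iff: "f \<in> l2_space W \<longleftrightarrow> f \<in> weighted_L2 \<Omega> \<psi>"
proof -
  have "integrable W (\<lambda>z. (cmod (f z))\<^sup>2) \<longleftrightarrow> integrable M (\<lambda>z. (cmod (f z))\<^sup>2 * \<rho> z)"
    if "f \<in> borel_measurable M"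
    unfolding W_def using that by (subst integrable_real_density) (auto simp: mult.commute)
  then show ?thesis by (auto simp: l2_space_def weighted_L2_def W_def)
qed

lemma weighted_L2_eq: "weighted_L2 \<Omega> \<psi> = l2_space M"
proof -
  obtain m C where m: "m > 0" and C: "C > 0" and mC: "\<And>z. z \<in> \<Omega> \<Longrightarrow> m \<le> \<rho> z \<and> \<rho> z \<le> C"
    using density_bounds by blast
  have "integrable M (\<lambda>z. (cmod (f z))\<^sup>2 * \<rho> z) \<longleftrightarrow> integrable M (\<lambda>z. (cmod (f z))\<^sup>2)"
    if [measurable]: "f \<in> borel_measurable M" for f
  proof
    assume "integrable M (\<lambda>z. (cmod (f z))\<^sup>2 * \<rho> z)"
    then have "integrable M (\<lambda>z. (1 / m) * ((cmod (f z))\<^sup>2 * \<rho> z))" by (rule integrable_mult_right)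
    then show "integrable M (\<lambda>z. (cmod (f z))\<^sup>2)"
    proof (rule Bochner_Integration.integrable_bound, measurable, intro AE_I2)
      fix z assume "z \<in> space M"
      then have "(cmod (f z))\<^sup>2 * m \<le> (cmod (f z))\<^sup>2 * \<rho> z" using mC by (intro mult_left_mono) auto
      then show "norm ((cmod (f z))\<^sup>2) \<le> norm ((1 / m) * ((cmod (f z))\<^sup>2 * \<rho> z))"
        using m by (simp add: field_simps)
    qed
  next
    assume "integrable M (\<lambda>z. (cmod (f z))\<^sup>2)"
    then have "integrable M (\<lambda>z. C * (cmod (f z))\<^sup>2)" by (rule integrable_mult_right)
    then show "integrable M (\<lambda>z. (cmod (f z))\<^sup>2 * \<rho> z)"
    proof (rule Bochner_Integration.integrable_bound, measurable, intro AE_I2)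
      fix z assume "z \<in> space M"
      then have "\<rho> z * (cmod (f z))\<^sup>2 \<le> C * (cmod (f z))\<^sup>2" using mC by (intro mult_right_mono) auto
      then show "norm ((cmod (f z))\<^sup>2 * \<rho> z) \<le> norm (C * (cmod (f z))\<^sup>2)"
        using C by (simp add: mult.commute)
    qed
  qed
  then show ?thesis by (auto simp: weighted_L2_def l2_space_def)
qed

lemma bergman_space_eq: "bergman_space \<Omega> \<psi> = A"
  by (simp add: bergman_space_def unweighted_bergman_space_def weighted_L2_eq)

lemma weighted_inner_eq: "weighted_inner \<Omega> \<psi> f g = l2_pair M f (\<lambda>z. of_real (\<rho> z) * g z)"
  by (simp add: weighted_inner_def l2_pair_def mult_ac)

lemma weighted_pair_eq:
  assumes "f \<in> l2_space M" "g \<in> l2_space M"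
  shows "l2_pair W f g = weighted_inner \<Omega> \<psi> f g"
proof -
  have [measurable]: "f \<in> borel_measurable M" "g \<in> borel_measurable M"
    using assms by (auto simp: l2_space_def)
  show ?thesis unfolding l2_pair_def W_def weighted_inner_def
    by (subst integral_density) (auto simp: scaleR_conv_of_real mult_ac)
qed

lemma weighted_norm_bounds:
  "\<exists>m>0. \<exists>C>0. \<forall>f\<in>l2_space M. m * l2_norm M f \<le> l2_norm W f \<and> l2_norm W f \<le> C * l2_norm M f"
proof -
  obtain m C where m: "m > 0" and C: "C > 0" and mC: "\<And>z. z \<in> \<Omega> \<Longrightarrow> m \<le> \<rho> z \<and> \<rho> z \<le> C"
    using density_bounds by blast
  have "sqrt m * l2_norm M f \<le> l2_norm W f \<and> l2_norm W f \<le> sqrt C * l2_norm M f"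
    if f: "f \<in> l2_space M" for f
  proof -
    have [measurable]: "f \<in> borel_measurable M" using f by (simp add: l2_space_def)
    have e: "(LINT z|W. (cmod (f z))\<^sup>2) = (LINT z|M. \<rho> z * (cmod (f z))\<^sup>2)"
      unfolding W_def by (subst integral_real_density) auto
    have i: "integrable M (\<lambda>z. \<rho> z * (cmod (f z))\<^sup>2)"
      using f weighted_L2_eq by (auto simp: weighted_L2_def mult.commute)
    have j: "integrable M (\<lambda>z. (cmod (f z))\<^sup>2)" by (rule l2_space_integrable[OF f])
    have "(LINT z|M. m * (cmod (f z))\<^sup>2) \<le> (LINT z|M. \<rho> z * (cmod (f z))\<^sup>2)"
      using mC by (intro integral_mono i integrable_mult_right j mult_right_mono) auto
    moreover have "(LINT z|M. \<rho> z * (cmod (f z))\<^sup>2) \<le> (LINT z|M. C * (cmod (f z))\<^sup>2)"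
      using mC by (intro integral_mono i integrable_mult_right j mult_right_mono) auto
    ultimately show ?thesis
      by (simp add: l2_norm_def e real_sqrt_mult[symmetric])
  qed
  then show ?thesis using m C by (meson real_sqrt_gt_zero)
qed

lemma bergman_space_complete: "l2_complete_subspace W A"
proof -
  obtain m C where m: "m > 0" and C: "C > 0"
    and mC: "\<And>f. f \<in> l2_space M \<Longrightarrow> m * l2_norm M f \<le> l2_norm W f \<and> l2_norm W f \<le> C * l2_norm M f"
    using weighted_norm_bounds by blast
  note M_complete = unweighted_bergman_space_complete[OF open_domain]
  have "\<exists>f\<in>A. (\<lambda>n. l2_norm W (\<lambda>z. F n z - f z)) \<longlonglongrightarrow> 0"
    if FA: "\<forall>n. F n \<in> A" and cau: "\<forall>e>0. \<exists>N. \<forall>m\<ge>N. \<forall>n\<ge>N. l2_norm W (\<lambda>z. F m z - F n z) < e"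
    for F :: "nat \<Rightarrow> complex ^ 'n \<Rightarrow> complex"
  proof -
    have L: "(\<lambda>z. F k z - F n z) \<in> l2_space M" for k n
      using FA unweighted_bergman_space_l2 by (intro l2_space_diff) auto
    have "\<forall>e>0. \<exists>N. \<forall>k\<ge>N. \<forall>n\<ge>N. l2_norm M (\<lambda>z. F k z - F n z) < e"
    proof (intro allI impI)
      fix e :: real assume "e > 0"
      then obtain N where N: "\<forall>k\<ge>N. \<forall>n\<ge>N. l2_norm W (\<lambda>z. F k z - F n z) < m * e"
        using cau m by (meson mult_pos_pos)
      have "l2_norm M (\<lambda>z. F k z - F n z) < e" if "k \<ge> N" "n \<ge> N" for k n
      proof -
        have "m * l2_norm M (\<lambda>z. F k z - F n z) < m * e" using mC[OF L, of k n] N that by fastforce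
        then show ?thesis using m by simp
      qed
      then show "\<exists>N. \<forall>k\<ge>N. \<forall>n\<ge>N. l2_norm M (\<lambda>z. F k z - F n z) < e" by blast
    qed
    then obtain f where f: "f \<in> A" and lim: "(\<lambda>n. l2_norm M (\<lambda>z. F n z - f z)) \<longlonglongrightarrow> 0"
      using M_complete FA unfolding l2_complete_subspace_def by blast
    have "(\<lambda>z. F n z - f z) \<in> l2_space M" for n
      using FA f unweighted_bergman_space_l2 by (intro l2_space_diff) auto
    then have "(\<lambda>n. l2_norm W (\<lambda>z. F n z - f z)) \<longlonglongrightarrow> 0"
      using mC by (intro tendsto_0_le[OF lim, where K = C]) (auto simp: mult.commute)
    then show ?thesis using f by blast
  qed
  moreover have "A \<subseteq> l2_space W"
    using unweighted_bergman_space_l2 by (auto simp: weighted_L2_iff weighted_L2_eq)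
  ultimately show ?thesis
    using M_complete unfolding l2_complete_subspace_def by (intro conjI) blast+
qed

text \<open>
  Existence is the Riesz representation theorem for the measure \<open>W\<close>. Uniqueness as functions, and not
  only almost everywhere, holds because elements of \<open>A\<close> of norm zero vanish: point evaluations are
  bounded, and off \<open>\<Omega>\<close> the elements are zero by convention.
\<close>

lemma bergman_space_Riesz:
  assumes l_add: "\<And>f g. f \<in> A \<Longrightarrow> g \<in> A \<Longrightarrow> l (\<lambda>z. f z + g z) = l f + l g"
    and l_scale: "\<And>c f. f \<in> A \<Longrightarrow> l (\<lambda>z. c * f z) = c * l f"
    and l_bound: "\<And>f. f \<in> A \<Longrightarrow> cmod (l f) \<le> K * l2_norm M f"
  shows "\<exists>!u. u \<in> A \<and> (\<forall>f\<in>A. weighted_inner \<Omega> \<psi> f u = l f)"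
proof -
  obtain m where m: "m > 0"
    and mC: "\<And>f. f \<in> l2_space M \<Longrightarrow> m * l2_norm M f \<le> l2_norm W f"
    using weighted_norm_bounds by blast
  have AL: "f \<in> l2_space M" "f \<in> l2_space W" if "f \<in> A" for f
    using that unweighted_bergman_space_l2 by (auto simp: weighted_L2_iff weighted_L2_eq)
  have "cmod (l f) \<le> (\<bar>K\<bar> / m) * l2_norm W f" if f: "f \<in> A" for f
  proof -
    have "cmod (l f) \<le> \<bar>K\<bar> * l2_norm M f"
      using l_bound[OF f] mult_right_mono[OF abs_ge_self[of K] l2_norm_nonneg[of M f]] by linarith
    also have "\<dots> \<le> \<bar>K\<bar> * (l2_norm W f / m)"
      using mC[OF AL(1)[OF f]] m by (intro mult_left_mono) (auto simp: pos_le_divide_eq mult.commute)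
    finally show ?thesis by simp
  qed
  from l2_Riesz_representation[OF bergman_space_complete l_add l_scale this]
  obtain u where u: "u \<in> A" "\<forall>f\<in>A. l2_pair W f u = l f" by blast
  show ?thesis
  proof (rule ex1I[of _ u])
    show "u \<in> A \<and> (\<forall>f\<in>A. weighted_inner \<Omega> \<psi> f u = l f)"
      using u weighted_pair_eq AL by auto
    fix v assume v: "v \<in> A \<and> (\<forall>f\<in>A. weighted_inner \<Omega> \<psi> f v = l f)"
    define d where "d = (\<lambda>z. v z - u z)"
    have dA: "d \<in> A" unfolding d_def using u v unweighted_bergman_space_linear by blast
    have "l2_pair W d d = l2_pair W d v - l2_pair W d u"
      unfolding d_def using AL u v dA[unfolded d_def] by (intro l2_pair_diff_right) auto
    also have "\<dots> = 0" using u v dA AL weighted_pair_eq by simp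
    finally have "l2_norm W d = 0" by (simp add: l2_pair_self)
    then have "m * l2_norm M d \<le> 0" using mC[OF AL(1)[OF dA]] by simp
    then have d0: "l2_norm M d = 0" using m l2_norm_nonneg[of M d] by (simp add: mult_le_0_iff)
    have "d z = 0" for z
    proof (cases "z \<in> \<Omega>")
      case True
      then obtain r where "r > 0" "ball z r \<subseteq> \<Omega>" using open_domain openE by blast
      from bergman_evaluation_bound[OF open_domain dA this] show ?thesis by (simp add: d0)
    next
      case False
      then show ?thesis using dA by (simp add: unweighted_bergman_space_def)
    qed
    then show "v = u" by (auto simp: d_def)
  qed
qed

lemma bergman_kernel_characterization:
  assumes w: "w \<in> \<Omega>"
  shows "(\<lambda>z. bergman_kernel \<Omega> \<psi> z w) \<in> A"
    and "f \<in> A \<Longrightarrow> weighted_inner \<Omega> \<psi> f (\<lambda>z. bergman_kernel \<Omega> \<psi> z w) = f w"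
proof -
  obtain r where r: "r > 0" "ball w r \<subseteq> \<Omega>" using open_domain w openE by blast
  have "\<exists>!k. k \<in> A \<and> (\<forall>f\<in>A. weighted_inner \<Omega> \<psi> f k = f w)"
    by (rule bergman_space_Riesz) (use bergman_evaluation_bound[OF open_domain _ r] in auto)
  then have "\<exists>!k. k \<in> bergman_space \<Omega> \<psi> \<and> (\<forall>f\<in>bergman_space \<Omega> \<psi>. f w = weighted_inner \<Omega> \<psi> f k)"
    unfolding bergman_space_eq by (simp add: eq_commute)
  from theI'[OF this] show "(\<lambda>z. bergman_kernel \<Omega> \<psi> z w) \<in> A"
    "f \<in> A \<Longrightarrow> weighted_inner \<Omega> \<psi> f (\<lambda>z. bergman_kernel \<Omega> \<psi> z w) = f w"
    unfolding bergman_kernel_def bergman_space_eq by auto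
qed

lemma bergman_projection_characterization:
  assumes g: "g \<in> l2_space M"
  shows "bergman_projection \<Omega> \<psi> g \<in> A"
    and "f \<in> A \<Longrightarrow> weighted_inner \<Omega> \<psi> f (bergman_projection \<Omega> \<psi> g) = weighted_inner \<Omega> \<psi> f g"
proof -
  obtain m C where "m > 0" "C > 0" and mC: "\<And>z. z \<in> \<Omega> \<Longrightarrow> m \<le> \<rho> z \<and> \<rho> z \<le> C"
    using density_bounds by blast
  have rho: "(\<lambda>z. of_real (\<rho> z) * h z) \<in> l2_space M" if "h \<in> l2_space M" for h
    by (rule l2_space_multiplier[OF that, of _ C]) (use mC in auto)
  have ex: "\<exists>!p. p \<in> A \<and> (\<forall>f\<in>A. weighted_inner \<Omega> \<psi> f p = weighted_inner \<Omega> \<psi> f g)"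
  proof (rule bergman_space_Riesz)
    show "cmod (weighted_inner \<Omega> \<psi> f g) \<le> l2_norm M (\<lambda>z. of_real (\<rho> z) * g z) * l2_norm M f" if "f \<in> A" for f
      using l2_Cauchy_Schwarz[OF unweighted_bergman_space_l2[OF that] rho[OF g]]
      by (simp add: weighted_inner_eq mult.commute)
  qed (simp_all add: weighted_inner_eq l2_pair_add_left l2_pair_scale_left unweighted_bergman_space_l2 rho g)
  have orth: "weighted_inner \<Omega> \<psi> (\<lambda>z. g z - p z) f = 0 \<longleftrightarrow> weighted_inner \<Omega> \<psi> f p = weighted_inner \<Omega> \<psi> f g"
    if "p \<in> A" "f \<in> A" for p f
  proof -
    have L: "p \<in> l2_space M" "f \<in> l2_space M" using that unweighted_bergman_space_l2 by auto
    have "weighted_inner \<Omega> \<psi> (\<lambda>z. g z - p z) f = l2_pair M (\<lambda>z. of_real (\<rho> z) * g z - of_real (\<rho> z) * p z) f"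
      unfolding weighted_inner_def l2_pair_def by (intro Bochner_Integration.integral_cong) (auto simp: algebra_simps)
    also have "\<dots> = cnj (l2_pair M f (\<lambda>z. of_real (\<rho> z) * g z) - l2_pair M f (\<lambda>z. of_real (\<rho> z) * p z))"
      unfolding l2_pair_diff_right[OF rho[OF g] rho[OF L(1)] L(2), symmetric] by (rule l2_pair_cnj[symmetric])
    finally show ?thesis by (auto simp: weighted_inner_eq)
  qed
  have "\<exists>!p. p \<in> bergman_space \<Omega> \<psi> \<and> (\<forall>h\<in>bergman_space \<Omega> \<psi>. weighted_inner \<Omega> \<psi> (\<lambda>z. g z - p z) h = 0)"
    using ex unfolding bergman_space_eq by (simp add: orth cong: conj_cong)
  from theI'[OF this] have p: "bergman_projection \<Omega> \<psi> g \<in> A"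
    "\<forall>h\<in>A. weighted_inner \<Omega> \<psi> (\<lambda>z. g z - bergman_projection \<Omega> \<psi> g z) h = 0"
    unfolding bergman_projection_def bergman_space_eq by blast+
  show "bergman_projection \<Omega> \<psi> g \<in> A" by (rule p(1))
  show "weighted_inner \<Omega> \<psi> f (bergman_projection \<Omega> \<psi> g) = weighted_inner \<Omega> \<psi> f g" if "f \<in> A"
    using p(2) that orth[OF p(1) that] by blast
qed

end

section \<open>Bell polynomials and derivatives of exponentials\<close>

text \<open>
  The step from \<open>k\<close> to \<open>Suc k\<close> in the Leibniz rule.
\<close>

lemma Pascal_convolution:
  fixes a c :: "nat \<Rightarrow> 'a::comm_semiring_1"
  shows "(\<Sum>i\<le>k. of_nat (k choose i) * (a (Suc i) * c (k - i) + a i * c (Suc k - i)))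
       = (\<Sum>i\<le>Suc k. of_nat (Suc k choose i) * (a i * c (Suc k - i)))"
proof -
  have "(\<Sum>i\<le>k. of_nat (k choose i) * (a i * c (Suc k - i)))
      = (\<Sum>i\<le>Suc k. of_nat (k choose i) * (a i * c (Suc k - i)))"
    by (simp add: binomial_eq_0)
  also have "\<dots> = a 0 * c (Suc k) + (\<Sum>i\<le>k. of_nat (k choose Suc i) * (a (Suc i) * c (k - i)))"
    by (subst sum.atMost_Suc_shift) simp
  finally have "(\<Sum>i\<le>k. of_nat (k choose i) * (a (Suc i) * c (k - i) + a i * c (Suc k - i)))
      = a 0 * c (Suc k) + (\<Sum>i\<le>k. of_nat (Suc k choose Suc i) * (a (Suc i) * c (k - i)))"
    by (simp add: distrib_left distrib_right sum.distrib add_ac)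
  also have "\<dots> = (\<Sum>i\<le>Suc k. of_nat (Suc k choose i) * (a i * c (Suc k - i)))"
    by (subst sum.atMost_Suc_shift) simp
  finally show ?thesis .
qed

text \<open>
  Partitions of \<open>k\<close> into parts of size at most \<open>N\<close>, where \<open>n j\<close> is the number of parts of size \<open>j\<close>. For
  \<open>k \<le> N\<close> the bound \<open>N\<close> is no restriction; keeping it fixed allows to compare Bell polynomials of
  different index. Functions that vanish off the range take the place of the extensional functions in
  \<open>complete_bell\<close>, so that changing one value preserves the set.
\<close>

definition partition_multiplicities :: "nat \<Rightarrow> nat \<Rightarrow> (nat \<Rightarrow> nat) set" where
  "partition_multiplicities N k = {n. (\<forall>j. j \<notin> {1..N} \<longrightarrow> n j = 0) \<and> (\<Sum>j=1..N. j * n j) = k}"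

lemma partition_multiplicities_large:
  assumes n: "n \<in> partition_multiplicities N k" and j: "j > k"
  shows "n j = 0"
proof (cases "j \<in> {1..N}")
  case True
  have "j * n j \<le> (\<Sum>j=1..N. j * n j)" using True by (intro member_le_sum) auto
  then have "j * n j \<le> k" using n by (simp add: partition_multiplicities_def)
  then show ?thesis using j by (cases "n j") auto
next
  case False
  then show ?thesis using n by (auto simp: partition_multiplicities_def)
qed

lemma partition_multiplicities_eq:
  assumes "k \<le> N"
  shows "partition_multiplicities N k = partition_multiplicities k k"
proof -
  have sum: "(\<Sum>j=1..N. j * n j) = (\<Sum>j=1..k. j * n j)" if "\<And>j. j > k \<Longrightarrow> n j = 0" for n :: "nat \<Rightarrow> nat"
    by (rule sum.mono_neutral_right) (use assms that in auto)
  show ?thesis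
  proof (intro subset_antisym subsetI)
    fix n assume n: "n \<in> partition_multiplicities N k"
    note z = partition_multiplicities_large[OF n]
    show "n \<in> partition_multiplicities k k"
      using n z sum[OF z] unfolding partition_multiplicities_def
      by auto
  next
    fix n assume n: "n \<in> partition_multiplicities k k"
    note z = partition_multiplicities_large[OF n]
    show "n \<in> partition_multiplicities N k"
      using n assms sum[OF z] unfolding partition_multiplicities_def by auto
  qed
qed

lemma partition_multiplicities_bij:
  "bij_betw (\<lambda>n. restrict n {1..k}) (partition_multiplicities k k)
     {n. n \<in> ({1..k} \<rightarrow>\<^sub>E (UNIV :: nat set)) \<and> (\<Sum>j=1..k. j * n j) = k}"
proof (rule bij_betw_byWitness[where f' = "\<lambda>n j. if j \<in> {1..k} then n j else 0"])
  show "\<forall>n\<in>partition_multiplicities k k. (\<lambda>j. if j \<in> {1..k} then restrict n {1..k} j else 0) = n"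
    by (auto simp: partition_multiplicities_def fun_eq_iff)
  show "\<forall>n\<in>{n. n \<in> ({1..k} \<rightarrow>\<^sub>E (UNIV :: nat set)) \<and> (\<Sum>j=1..k. j * n j) = k}.
      restrict (\<lambda>j. if j \<in> {1..k} then n j else 0) {1..k} = n"
    by (auto simp: fun_eq_iff PiE_def extensional_def)
qed (auto simp: partition_multiplicities_def)

lemma finite_partition_multiplicities: 
  assumes "k \<le> N"
  shows "finite (partition_multiplicities N k)"
proof -
  have "{n. n \<in> ({1..k} \<rightarrow>\<^sub>E (UNIV :: nat set)) \<and> (\<Sum>j=1..k. j * n j) = k} \<subseteq> {1..k} \<rightarrow>\<^sub>E {..k}"
  proof
    fix n assume "n \<in> {n. n \<in> ({1..k} \<rightarrow>\<^sub>E (UNIV :: nat set)) \<and> (\<Sum>j=1..k. j * n j) = k}"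
    then have n: "n \<in> {1..k} \<rightarrow>\<^sub>E (UNIV :: nat set)" "(\<Sum>j=1..k. j * n j) = k" by auto
    show "n \<in> {1..k} \<rightarrow>\<^sub>E {..k}"
    proof (rule PiE_I)
      fix j assume j: "j \<in> {1..k}"
      then have "j * n j \<le> (\<Sum>j=1..k. j * n j)" by (intro member_le_sum) auto
      then have "j * n j \<le> k" using n by simp
      moreover have "1 * n j \<le> j * n j" using j by (intro mult_right_mono) auto
      ultimately have "n j \<le> k" by linarith
      then show "n j \<in> {..k}" by simp
    qed (use n in auto)
  qed
  then have "finite {n. n \<in> ({1..k} \<rightarrow>\<^sub>E (UNIV :: nat set)) \<and> (\<Sum>j=1..k. j * n j) = k}"
    by (rule finite_subset) (intro finite_PiE; simp)
  then show ?thesis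
    using bij_betw_finite[OF partition_multiplicities_bij[of k]] partition_multiplicities_eq[OF assms] by simp
qed

lemma complete_bell_partitions:
  assumes "k \<le> N"
  shows "complete_bell k x / fact k =
    (\<Sum>n\<in>partition_multiplicities N k. \<Prod>j=1..N. (x j / fact j) ^ n j / fact (n j))"
proof -
  have "complete_bell k x =
      (\<Sum>n\<in>partition_multiplicities k k. fact k / (\<Prod>j=1..k. fact (restrict n {1..k} j))
         * (\<Prod>j=1..k. (x j / fact j) ^ restrict n {1..k} j))"
    unfolding complete_bell_def
    by (rule sum.reindex_bij_betw[OF partition_multiplicities_bij[of k], symmetric])
  also have "\<dots> = (\<Sum>n\<in>partition_multiplicities k k. fact k * (\<Prod>j=1..k. (x j / fact j) ^ n j / fact (n j)))"
    by (intro sum.cong refl) (simp add: prod_dividef)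
  finally have "complete_bell k x / fact k =
      (\<Sum>n\<in>partition_multiplicities k k. \<Prod>j=1..k. (x j / fact j) ^ n j / fact (n j))"
    by (simp add: sum_distrib_left[symmetric])
  also have "\<dots> = (\<Sum>n\<in>partition_multiplicities k k. \<Prod>j=1..N. (x j / fact j) ^ n j / fact (n j))"
    using assms by (intro sum.cong refl prod.mono_neutral_left) (auto simp: partition_multiplicities_large)
  finally show ?thesis by (simp add: partition_multiplicities_eq[OF assms])
qed

lemma complete_bell_0: "complete_bell 0 x = 1"
  by (simp add: complete_bell_def)

text \<open>
  Insert \<open>k = \<Sum>\<^sub>j j n\<^sub>j\<close> into the sum over partitions of \<open>k\<close> and collect the terms with factor \<open>n\<^sub>j\<close>:
  removing one part of size \<open>j\<close> is a bijection onto the partitions of \<open>k - j\<close> and takes the weight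
  \<open>n\<^sub>j (y\<^sub>j)^(n\<^sub>j) / n\<^sub>j!\<close> to \<open>y\<^sub>j\<close> times the weight of the smaller partition.
\<close>

lemma complete_bell_Newton:
  "real k * (complete_bell k x / fact k) =
    (\<Sum>j=1..k. real j * (x j / fact j) * (complete_bell (k - j) x / fact (k - j)))"
proof -
  define y where "y j = x j / fact j" for j
  define w where "w n = (\<Prod>j=1..k. y j ^ n j / fact (n j))" for n
  let ?P = "partition_multiplicities k"
  have fin: "finite (?P k)" by (rule finite_partition_multiplicities) simp
  have "real k * (complete_bell k x / fact k) = (\<Sum>n\<in>?P k. real k * w n)"
    by (simp add: complete_bell_partitions[OF order_refl] w_def y_def sum_distrib_left)
  also have "\<dots> = (\<Sum>n\<in>?P k. \<Sum>j=1..k. real j * (real (n j) * w n))"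
  proof (intro sum.cong refl)
    fix n assume "n \<in> ?P k"
    then have k: "k = (\<Sum>j=1..k. j * n j)" by (simp add: partition_multiplicities_def)
    have "real k = real (\<Sum>j=1..k. j * n j)" using k by simp
    then have "real k = (\<Sum>j=1..k. real j * real (n j))" by simp
    then show "real k * w n = (\<Sum>j=1..k. real j * (real (n j) * w n))"
      by (simp add: sum_distrib_right mult.assoc)
  qed
  also have "\<dots> = (\<Sum>j=1..k. real j * (\<Sum>n\<in>?P k. real (n j) * w n))"
    by (subst sum.swap) (simp add: sum_distrib_left)
  also have "\<dots> = (\<Sum>j=1..k. real j * (y j * (complete_bell (k - j) x / fact (k - j))))"
  proof (intro sum.cong refl arg_cong2[where f = "(*)"])
    fix j assume j: "j \<in> {1..k}"
    have bij: "bij_betw (\<lambda>n. n(j := Suc (n j))) (?P (k - j)) {n \<in> ?P k. n j \<noteq> 0}"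
    proof (rule bij_betw_byWitness[where f' = "\<lambda>n. n(j := n j - 1)"])
      have s: "(\<Sum>i=1..k. i * (n(j := v)) i) = (\<Sum>i\<in>{1..k}-{j}. i * n i) + j * v" for n v
        using j by (subst sum.remove[of _ j]) (auto intro!: sum.cong)
      have s0: "(\<Sum>i=1..k. i * n i) = (\<Sum>i\<in>{1..k}-{j}. i * n i) + j * n j" for n
        using s[of n "n j"] by simp
      show "(\<lambda>n. n(j := Suc (n j))) ` ?P (k - j) \<subseteq> {n \<in> ?P k. n j \<noteq> 0}"
      proof safe
        fix n assume n: "n \<in> ?P (k - j)"
        have "(\<Sum>i=1..k. i * (n(j := Suc (n j))) i) = k"
        proof -
          have "(\<Sum>i=1..k. i * n i) = k - j" using n by (simp add: partition_multiplicities_def)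
          then show ?thesis using j unfolding s s0 mult_Suc_right atLeastAtMost_iff by linarith
        qed
        then show "n(j := Suc (n j)) \<in> ?P k"
          using n j by (auto simp: partition_multiplicities_def)
      qed auto
      show "(\<lambda>n. n(j := n j - 1)) ` {n \<in> ?P k. n j \<noteq> 0} \<subseteq> ?P (k - j)"
      proof safe
        fix n assume n: "n \<in> ?P k" "n j > 0"
        have "j * n j = j * (n j - 1) + j" using n(2) by (cases "n j") auto
        moreover have "(\<Sum>i=1..k. i * n i) = k" using n(1) by (simp add: partition_multiplicities_def)
        ultimately have "(\<Sum>i=1..k. i * (n(j := n j - 1)) i) = k - j"
          unfolding s s0 by linarith
        then show "n(j := n j - 1) \<in> ?P (k - j)"
          using n(1) j by (auto simp: partition_multiplicities_def)
      qed
    qed auto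
    have w: "real (Suc (n j)) * w (n(j := Suc (n j))) = y j * w n" for n
    proof -
      have r: "w (n(j := v)) = (y j ^ v / fact v) * (\<Prod>i\<in>{1..k}-{j}. y i ^ n i / fact (n i))" for v
        unfolding w_def using j by (subst prod.remove[of _ j]) (auto intro!: prod.cong)
      have "w n = (y j ^ n j / fact (n j)) * (\<Prod>i\<in>{1..k}-{j}. y i ^ n i / fact (n i))"
        using r[of "n j"] by simp
      moreover have "real (Suc (n j)) * (y j ^ Suc (n j) / fact (Suc (n j))) = y j * (y j ^ n j / fact (n j))"
        by (simp add: fact_Suc del: of_nat_Suc)
      ultimately show ?thesis unfolding r by (simp only: mult.assoc[symmetric])
    qed
    have "(\<Sum>n\<in>?P k. real (n j) * w n) = (\<Sum>n\<in>{n \<in> ?P k. n j \<noteq> 0}. real (n j) * w n)"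
      by (rule sum.mono_neutral_right) (use fin in auto)
    also have "\<dots> = (\<Sum>n\<in>?P (k - j). real (Suc (n j)) * w (n(j := Suc (n j))))"
      by (subst sum.reindex_bij_betw[OF bij, symmetric]) simp
    also have "\<dots> = y j * (complete_bell (k - j) x / fact (k - j))"
      unfolding w by (simp add: complete_bell_partitions[of "k - j" k] w_def y_def sum_distrib_left)
    finally show "(\<Sum>n\<in>?P k. real (n j) * w n) = y j * (complete_bell (k - j) x / fact (k - j))" .
  qed
  finally show ?thesis by (simp add: y_def mult.assoc)
qed

lemma complete_bell_Suc:
  "complete_bell (Suc k) x = (\<Sum>i\<le>k. of_nat (k choose i) * (x (Suc i) * complete_bell (k - i) x))"
proof -
  have "complete_bell (Suc k) x = fact k * (real (Suc k) * (complete_bell (Suc k) x / fact (Suc k)))"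
    by simp
  also have "\<dots> = (\<Sum>j=1..Suc k. fact k * (real j * (x j / fact j) * (complete_bell (Suc k - j) x / fact (Suc k - j))))"
    by (simp only: complete_bell_Newton sum_distrib_left)
  also have "\<dots> = (\<Sum>i\<le>k. fact k * (real (Suc i) * (x (Suc i) / fact (Suc i)) * (complete_bell (k - i) x / fact (k - i))))"
    by (rule sum.reindex_bij_witness[where i = Suc and j = "\<lambda>j. j - 1"]) auto
  also have "\<dots> = (\<Sum>i\<le>k. of_nat (k choose i) * (x (Suc i) * complete_bell (k - i) x))"
  proof (intro sum.cong refl)
    fix i assume "i \<in> {..k}"
    then have b: "real (k choose i) = fact k / (fact i * fact (k - i))" by (simp add: binomial_fact)
    have f: "real (Suc i) * (x (Suc i) / fact (Suc i)) = x (Suc i) / fact i"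
      by (simp add: fact_Suc del: of_nat_Suc)
    show "fact k * (real (Suc i) * (x (Suc i) / fact (Suc i)) * (complete_bell (k - i) x / fact (k - i)))
      = of_nat (k choose i) * (x (Suc i) * complete_bell (k - i) x)"
      unfolding f b by simp
  qed
  finally show ?thesis .
qed

text \<open>
  If \<open>x (Suc j)\<close> is the derivative of \<open>x j\<close> for all \<open>j\<close>, then \<open>g\<^sub>k = exp(x\<^sub>0) B\<^sub>k(x\<^sub>1, \<dots>, x\<^sub>k)\<close> is the \<open>k\<close>th
  derivative of \<open>exp(x\<^sub>0)\<close>. The recursion for Bell polynomials says that
  \<open>g\<^bsub>k+1\<^esub> = \<Sum>\<^sub>i (k choose i) x\<^bsub>i+1\<^esub> g\<^bsub>k-i\<^esub>\<close>, which is the Leibniz rule for the derivatives of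
  \<open>g\<^sub>1 = x\<^sub>1 g\<^sub>0\<close>. Hence both sides of \<open>g\<^sub>k' = g\<^bsub>k+1\<^esub>\<close> satisfy the same recursion.
\<close>

lemma has_derivative_exp_complete_bell:
  fixes x :: "nat \<Rightarrow> real \<Rightarrow> real"
  assumes x: "\<And>j s. s \<in> S \<Longrightarrow> (x j has_real_derivative x (Suc j) s) (at s)" and s: "s \<in> S"
  shows "((\<lambda>s. exp (x 0 s) * complete_bell k (\<lambda>j. x j s)) has_real_derivative
           exp (x 0 s) * complete_bell (Suc k) (\<lambda>j. x j s)) (at s)"
proof -
  define g where "g k s = exp (x 0 s) * complete_bell k (\<lambda>j. x j s)" for k s
  have g_Suc: "g (Suc k) s = (\<Sum>i\<le>k. of_nat (k choose i) * (x (Suc i) s * g (k - i) s))" for k s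
    by (simp add: g_def complete_bell_Suc sum_distrib_left mult_ac)
  have "(g k has_real_derivative g (Suc k) s) (at s)"
  proof (induction k rule: less_induct)
    case (less k)
    show ?case
    proof (cases k)
      case 0
      have "g 0 = (\<lambda>s. exp (x 0 s))" by (simp add: g_def complete_bell_0 fun_eq_iff)
      moreover have "g (Suc 0) s = exp (x 0 s) * x (Suc 0) s" unfolding g_Suc by (simp add: g_def complete_bell_0)
      ultimately show ?thesis using 0 x[OF s, of 0] by (auto intro!: derivative_eq_intros)
    next
      case (Suc l)
      have eq: "g k = (\<lambda>s. \<Sum>i\<le>l. of_nat (l choose i) * (x (Suc i) s * g (l - i) s))"
        by (simp add: Suc g_Suc fun_eq_iff)
      have "(g k has_real_derivative (\<Sum>i\<le>l. of_nat (l choose i) *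
          (x (Suc (Suc i)) s * g (l - i) s + x (Suc i) s * g (Suc l - i) s))) (at s)"
        unfolding eq
      proof (intro DERIV_sum DERIV_cmult)
        fix i assume i: "i \<in> {..l}"
        have "(g (l - i) has_real_derivative g (Suc l - i) s) (at s)"
          using less[of "l - i"] Suc i by (simp add: Suc_diff_le)
        from DERIV_mult[OF x[OF s, of "Suc i"] this]
        show "((\<lambda>s. x (Suc i) s * g (l - i) s) has_real_derivative
           x (Suc (Suc i)) s * g (l - i) s + x (Suc i) s * g (Suc l - i) s) (at s)"
          by (simp add: mult.commute)
      qed
      also have "(\<Sum>i\<le>l. of_nat (l choose i) * (x (Suc (Suc i)) s * g (l - i) s + x (Suc i) s * g (Suc l - i) s))
          = g (Suc k) s"
        unfolding g_Suc Suc
        by (rule Pascal_convolution[where a = "\<lambda>i. x (Suc i) s" and c = "\<lambda>i. g i s"])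
      finally show ?thesis .
    qed
  qed
  then show ?thesis unfolding g_def .
qed

section \<open>Smooth dependence of the weight on the parameter\<close>

lemma smooth_on_frechet_derivative:
  assumes "smooth_on U f"
  shows "smooth_on U (\<lambda>x. frechet_derivative f (at x) v)"
  using assms unfolding smooth_on_def by (metis higher_differentiable_on.simps(2))

lemma smooth_on_imp_continuous_on: "smooth_on U f \<Longrightarrow> continuous_on U f"
  unfolding smooth_on_def by (metis higher_differentiable_on.simps(1))

lemma smooth_on_imp_differentiable: "smooth_on U f \<Longrightarrow> x \<in> U \<Longrightarrow> f differentiable (at x)"
  unfolding smooth_on_def by (metis higher_differentiable_on.simps(2))

text \<open>
  For functions of a real variable the iterated directional derivatives in the definition of smoothness
  are scalar multiples of the ordinary derivatives, hence the factor \<open>c\<close> in the induction.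
\<close>

lemma smooth_on_derivative_sequence:
  fixes g :: "nat \<Rightarrow> real \<Rightarrow> 'b::real_normed_vector"
  assumes D: "open D" and g: "\<And>m t. t \<in> D \<Longrightarrow> (g m has_vector_derivative g (Suc m) t) (at t)"
  shows "smooth_on D (g 0)" and "t \<in> D \<Longrightarrow> nth_vector_derivative m (g 0) t = g m t"
proof -
  have "higher_differentiable_on D f k" if "\<And>t. t \<in> D \<Longrightarrow> f t = c *\<^sub>R g m t" for f c m k
    using that
  proof (induction k arbitrary: f c m)
    case 0
    have "continuous_on D (g m)"
      using g by (meson continuous_at_imp_continuous_on has_vector_derivative_continuous)
    then have "continuous_on D (\<lambda>t. c *\<^sub>R g m t)" by (intro continuous_intros)
    then show ?case using 0 by (simp cong: continuous_on_cong)
  next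
    case (Suc k)
    have f: "(f has_derivative (\<lambda>v. (v * c) *\<^sub>R g (Suc m) t)) (at t)" if t: "t \<in> D" for t
    proof -
      have "((\<lambda>t. c *\<^sub>R g m t) has_derivative (\<lambda>v. c *\<^sub>R (v *\<^sub>R g (Suc m) t))) (at t)"
        using g[OF t, of m] unfolding has_vector_derivative_def by (intro has_derivative_scaleR_right)
      then have "(f has_derivative (\<lambda>v. c *\<^sub>R (v *\<^sub>R g (Suc m) t))) (at t)"
        by (rule has_derivative_transform_within_open[OF _ D t]) (simp add: Suc.prems)
      then show ?thesis by (simp add: mult.commute)
    qed
    have "higher_differentiable_on D (\<lambda>x. frechet_derivative f (at x) v) k" for v
      by (rule Suc.IH[of _ "v * c" "Suc m"]) (simp add: frechet_derivative_at[OF f, symmetric])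
    then show ?case using f by (auto simp: differentiable_def)
  qed
  from this[of "g 0" 1 0] show "smooth_on D (g 0)" by (simp add: smooth_on_def)
  show "nth_vector_derivative m (g 0) t = g m t" if "t \<in> D"
    using that
  proof (induction m arbitrary: t)
    case 0 then show ?case by (simp add: nth_vector_derivative_def)
  next
    case (Suc m)
    have "(nth_vector_derivative m (g 0) has_vector_derivative g (Suc m) t) (at t)"
      by (rule has_vector_derivative_transform_within_open[OF g D]) (use Suc in auto)
    then show ?case by (simp add: nth_vector_derivative_def vector_derivative_at)
  qed
qed

text \<open>
  The \<open>k\<close>th derivative of \<open>s \<mapsto> exp (- \<phi> z s)\<close>, in the form given by the Bell polynomials.
\<close>

definition weight_derivative :: "(complex ^ 'n \<Rightarrow> real \<Rightarrow> real) \<Rightarrow> nat \<Rightarrow> real \<Rightarrow> complex ^ 'n \<Rightarrow> real" where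
  "weight_derivative \<phi> k s z = exp (- \<phi> z s) * bell_neg_weight k \<phi> s z"

text \<open>
  On \<open>\<Omega>\<close> the derivatives in \<open>t\<close> agree with iterated derivatives in the direction \<open>(0, 1)\<close> of a smooth
  extension \<open>\<Phi>\<close> of \<open>\<phi>\<close> to a neighbourhood of a compact set. The latter are continuous there, hence
  bounded. The bounds are uniform in \<open>z\<close> because the
  extension exists up to the boundary.
\<close>

lemma weight_regularity:
  fixes \<Omega> :: "(complex ^ 'n) set"
  assumes D: "open D" and \<phi>: "smooth_on_closure_times \<Omega> D \<phi>" and \<Omega>: "bounded \<Omega>" and t: "t \<in> D"
  obtains \<delta> where "\<delta> > 0"
    and "\<And>s. \<bar>s - t\<bar> < \<delta> \<Longrightarrow> continuous_on \<Omega> (\<lambda>z. \<phi> z s)"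
    and "\<exists>B. \<forall>z\<in>\<Omega>. \<forall>s. \<bar>s - t\<bar> < \<delta> \<longrightarrow> \<bar>\<phi> z s\<bar> \<le> B"
    and "\<And>k s. \<bar>s - t\<bar> < \<delta> \<Longrightarrow> continuous_on \<Omega> (weight_derivative \<phi> k s)"
    and "\<And>k. \<exists>B. \<forall>z\<in>\<Omega>. \<forall>s. \<bar>s - t\<bar> < \<delta> \<longrightarrow> \<bar>weight_derivative \<phi> k s z\<bar> \<le> B"
    and "\<And>k s z. z \<in> \<Omega> \<Longrightarrow> \<bar>s - t\<bar> < \<delta> \<Longrightarrow>
           ((\<lambda>s. weight_derivative \<phi> k s z) has_real_derivative weight_derivative \<phi> (Suc k) s z) (at s)"
proof -
  obtain \<delta> where \<delta>: "\<delta> > 0" "cball t \<delta> \<subseteq> D" using D t open_contains_cball by blast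
  define I where "I = {t - \<delta>..t + \<delta>}"
  have I: "I = cball t \<delta>" by (simp add: I_def cball_eq_atLeastAtMost)
  have sI: "s \<in> I" if "\<bar>s - t\<bar> < \<delta>" for s using that by (auto simp: I_def)
  obtain U \<Phi> where U: "open U" "closure \<Omega> \<times> I \<subseteq> U" and \<Phi>: "smooth_on U \<Phi>"
    and \<Phi>\<phi>: "\<And>z s. z \<in> closure \<Omega> \<Longrightarrow> s \<in> I \<Longrightarrow> \<Phi> (z, s) = \<phi> z s"
    using \<phi>[unfolded smooth_on_closure_times_def, rule_format, of "t - \<delta>" "t + \<delta>"] \<delta>
    unfolding I_def cball_eq_atLeastAtMost by auto
  define X where "X j = ((\<lambda>f p. frechet_derivative f (at p) (0, 1)) ^^ j) \<Phi>" for j :: nat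
  have X_Suc: "X (Suc j) = (\<lambda>p. frechet_derivative (X j) (at p) (0, 1))" for j by (simp add: X_def)
  have X_smooth: "smooth_on U (X j)" for j
  proof (induction j)
    case 0 then show ?case using \<Phi> by (simp add: X_def)
  next
    case (Suc j) then show ?case unfolding X_Suc by (rule smooth_on_frechet_derivative)
  qed
  have X_deriv: "((\<lambda>s. X j (z, s)) has_real_derivative X (Suc j) (z, s)) (at s)" if "(z, s) \<in> U" for j z s
  proof -
    have d: "(X j has_derivative frechet_derivative (X j) (at (z, s))) (at (z, s))"
      using smooth_on_imp_differentiable[OF X_smooth that] frechet_derivative_works by blast
    have "((\<lambda>s. (z, s)) has_derivative (\<lambda>h. (0, h))) (at s)"
      by (intro derivative_eq_intros) auto
    from has_derivative_compose[OF this d]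
    have "((\<lambda>s. X j (z, s)) has_derivative (\<lambda>h. frechet_derivative (X j) (at (z, s)) (0, h))) (at s)" .
    moreover have "frechet_derivative (X j) (at (z, s)) (0, h) = h * X (Suc j) (z, s)" for h
    proof -
      have "frechet_derivative (X j) (at (z, s)) (h *\<^sub>R (0, 1)) = h *\<^sub>R frechet_derivative (X j) (at (z, s)) (0, 1)"
        using has_derivative_linear[OF d] by (rule linear_scale)
      then show ?thesis by (simp add: X_Suc)
    qed
    ultimately show ?thesis by (simp add: has_field_derivative_def mult.commute[of _ "X (Suc j) (z, s)"])
  qed
  have zU: "(z, s) \<in> U" if "z \<in> \<Omega>" "\<bar>s - t\<bar> < \<delta>" for z s
    using U sI that closure_subset[of \<Omega>] by blast
  \<comment> \<open>only the values near \<open>s\<close> matter, so \<open>\<phi>\<close> and its extension have the same derivatives inside the interval\<close>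
  have nth: "nth_vector_derivative j (\<lambda>s. - \<phi> z s) s = - X j (z, s)"
    if z: "z \<in> \<Omega>" and s: "\<bar>s - t\<bar> < \<delta>" for j z s
    using s
  proof (induction j arbitrary: s)
    case 0
    then show ?case using \<Phi>\<phi>[of z s] sI z closure_subset[of \<Omega>]
      by (auto simp: nth_vector_derivative_def X_def)
  next
    case (Suc j)
    have "((\<lambda>s. - X j (z, s)) has_real_derivative - X (Suc j) (z, s)) (at s)"
      by (intro DERIV_minus X_deriv zU z Suc)
    then have "((\<lambda>s. - X j (z, s)) has_vector_derivative - X (Suc j) (z, s)) (at s)"
      by (simp add: has_real_derivative_iff_has_vector_derivative)
    then have "(nth_vector_derivative j (\<lambda>s. - \<phi> z s) has_vector_derivative - X (Suc j) (z, s)) (at s)"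
      by (rule has_vector_derivative_transform_within_open[where S = "ball t \<delta>"])
         (use Suc in \<open>auto simp: dist_real_def abs_minus_commute\<close>)
    then show ?case by (simp add: nth_vector_derivative_def vector_derivative_at)
  qed
  have \<phi>X: "\<phi> z s = X 0 (z, s)" if "z \<in> \<Omega>" "\<bar>s - t\<bar> < \<delta>" for z s
    using \<Phi>\<phi>[of z s] sI that closure_subset[of \<Omega>] by (auto simp: X_def)
  define G where "G k p = exp (- X 0 p) * complete_bell k (\<lambda>j. - X j p)" for k p
  have wG: "weight_derivative \<phi> k s z = G k (z, s)" if "z \<in> \<Omega>" "\<bar>s - t\<bar> < \<delta>" for k z s
    by (simp add: weight_derivative_def bell_neg_weight_def G_def nth[OF that] \<phi>X[OF that])
  have X_cont: "continuous_on U (X j)" for j by (rule smooth_on_imp_continuous_on[OF X_smooth])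
  have G_cont: "continuous_on U (G k)" for k
    unfolding G_def complete_bell_def by (intro continuous_intros X_cont) auto
  have K: "compact (closure \<Omega> \<times> I)"
    using \<Omega> by (intro compact_Times) (auto simp: I compact_eq_bounded_closed)
  have bound: "\<exists>B. \<forall>z\<in>\<Omega>. \<forall>s. \<bar>s - t\<bar> < \<delta> \<longrightarrow> \<bar>H (z, s)\<bar> \<le> B" if "continuous_on U H" for H :: "_ \<Rightarrow> real"
  proof -
    have "bounded (H ` (closure \<Omega> \<times> I))"
      using compact_continuous_image[OF continuous_on_subset[OF that U(2)] K] by (rule compact_imp_bounded)
    then obtain B where B: "\<And>p. p \<in> closure \<Omega> \<times> I \<Longrightarrow> \<bar>H p\<bar> \<le> B" by (auto simp: bounded_iff)
    then have "\<forall>z\<in>\<Omega>. \<forall>s. \<bar>s - t\<bar> < \<delta> \<longrightarrow> \<bar>H (z, s)\<bar> \<le> B"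
      using sI closure_subset[of \<Omega>] by blast
    then show ?thesis ..
  qed
  have slice: "continuous_on \<Omega> (\<lambda>z. H (z, s))" if "continuous_on U H" "\<bar>s - t\<bar> < \<delta>" for H :: "_ \<Rightarrow> real" and s
    by (rule continuous_on_compose2[OF that(1)]) (use zU that in \<open>auto intro!: continuous_intros\<close>)
  show ?thesis
  proof
    show "\<delta> > 0" by fact
    show "continuous_on \<Omega> (\<lambda>z. \<phi> z s)" if "\<bar>s - t\<bar> < \<delta>" for s
      using slice[OF X_cont that, of 0] by (simp add: \<phi>X that cong: continuous_on_cong)
    show "\<exists>B. \<forall>z\<in>\<Omega>. \<forall>s. \<bar>s - t\<bar> < \<delta> \<longrightarrow> \<bar>\<phi> z s\<bar> \<le> B"
      using bound[OF X_cont[of 0]] by (metis \<phi>X)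
    show "continuous_on \<Omega> (weight_derivative \<phi> k s)" if "\<bar>s - t\<bar> < \<delta>" for k s
      using slice[OF G_cont that, of k] by (simp add: wG that cong: continuous_on_cong)
    show "\<exists>B. \<forall>z\<in>\<Omega>. \<forall>s. \<bar>s - t\<bar> < \<delta> \<longrightarrow> \<bar>weight_derivative \<phi> k s z\<bar> \<le> B" for k
      using bound[OF G_cont[of k]] by (metis wG)
    show "((\<lambda>s. weight_derivative \<phi> k s z) has_real_derivative weight_derivative \<phi> (Suc k) s z) (at s)"
      if z: "z \<in> \<Omega>" and s: "\<bar>s - t\<bar> < \<delta>" for k s z
    proof -
      have "((\<lambda>s. exp (- X 0 (z, s)) * complete_bell k (\<lambda>j. - X j (z, s))) has_real_derivative
          exp (- X 0 (z, s)) * complete_bell (Suc k) (\<lambda>j. - X j (z, s))) (at s)"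
        by (rule has_derivative_exp_complete_bell[where S = "ball t \<delta>" and x = "\<lambda>j s. - X j (z, s)"])
           (use s z in \<open>auto intro!: DERIV_minus X_deriv zU simp: dist_real_def abs_minus_commute\<close>)
      then have "((\<lambda>s. G k (z, s)) has_real_derivative G (Suc k) (z, s)) (at s)" by (simp add: G_def)
      then have "((\<lambda>s. weight_derivative \<phi> k s z) has_real_derivative G (Suc k) (z, s)) (at s)"
        by (rule has_field_derivative_transform_within_open[where S = "ball t \<delta>"])
           (use s z wG in \<open>auto simp: dist_real_def abs_minus_commute\<close>)
      then show ?thesis by (simp add: wG z s)
    qed
  qed
qed

text \<open>
  The constant combines bounds for three successive derivatives near \<open>t\<close>: the first one for the size,
  the second one for the Lipschitz estimate, the third one for the Taylor remainder.
\<close>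

lemma weight_derivative_multiplier:
  fixes \<Omega> :: "(complex ^ 'n) set"
  assumes \<Omega>o: "open \<Omega>" and D: "open D" and \<phi>: "smooth_on_closure_times \<Omega> D \<phi>" and \<Omega>: "bounded \<Omega>" and t: "t \<in> D"
  shows "multiplier_has_derivative (lebesgue_on \<Omega>) (weight_derivative \<phi> k) (weight_derivative \<phi> (Suc k) t) t"
proof -
  obtain \<delta> where \<delta>: "\<delta> > 0"
    and cont: "\<And>k s. \<bar>s - t\<bar> < \<delta> \<Longrightarrow> continuous_on \<Omega> (weight_derivative \<phi> k s)"
    and bd: "\<And>k. \<exists>B. \<forall>z\<in>\<Omega>. \<forall>s. \<bar>s - t\<bar> < \<delta> \<longrightarrow> \<bar>weight_derivative \<phi> k s z\<bar> \<le> B"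
    and der: "\<And>k s z. z \<in> \<Omega> \<Longrightarrow> \<bar>s - t\<bar> < \<delta> \<Longrightarrow>
           ((\<lambda>s. weight_derivative \<phi> k s z) has_real_derivative weight_derivative \<phi> (Suc k) s z) (at s)"
    using weight_regularity[OF D \<phi> \<Omega> t] by metis
  have meas: "weight_derivative \<phi> k s \<in> borel_measurable (lebesgue_on \<Omega>)" if "\<bar>s - t\<bar> < \<delta>" for k s
    by (rule continuous_imp_measurable_on_sets_lebesgue[OF cont[OF that]]) (simp add: \<Omega>o lebesgue_openin)
  let ?w = "weight_derivative \<phi>"
  obtain B0 B1 B2 where B0: "\<And>z s. z \<in> \<Omega> \<Longrightarrow> \<bar>s - t\<bar> < \<delta> \<Longrightarrow> \<bar>?w k s z\<bar> \<le> B0"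
    and B1: "\<And>z s. z \<in> \<Omega> \<Longrightarrow> \<bar>s - t\<bar> < \<delta> \<Longrightarrow> \<bar>?w (Suc k) s z\<bar> \<le> B1"
    and B2: "\<And>z s. z \<in> \<Omega> \<Longrightarrow> \<bar>s - t\<bar> < \<delta> \<Longrightarrow> \<bar>?w (Suc (Suc k)) s z\<bar> \<le> B2"
    using bd[of k] bd[of "Suc k"] bd[of "Suc (Suc k)"] by metis
  define C where "C = \<bar>B0\<bar> + \<bar>B1\<bar> + \<bar>B2\<bar>"
  have lip: "\<bar>?w j s z - ?w j r z\<bar> \<le> B * \<bar>s - r\<bar>"
    if "z \<in> \<Omega>" "\<bar>s - t\<bar> < \<delta>" "\<bar>r - t\<bar> < \<delta>" "\<And>s. \<bar>s - t\<bar> < \<delta> \<Longrightarrow> \<bar>?w (Suc j) s z\<bar> \<le> B" for j s r z B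
    using field_differentiable_bound[of "ball t \<delta>" "\<lambda>s. ?w j s z" "\<lambda>s. ?w (Suc j) s z" B s r] that
    by (auto simp: dist_real_def abs_minus_commute intro: has_field_derivative_at_within der)
  have Taylor: "\<bar>(?w k s z - ?w k t z) - (s - t) * ?w (Suc k) t z\<bar> \<le> C * (s - t)\<^sup>2"
    if z: "z \<in> \<Omega>" and s: "\<bar>s - t\<bar> < \<delta>" for s z
  proof -
    have near: "\<bar>r - t\<bar> \<le> \<bar>s - t\<bar>" if "r \<in> closed_segment t s" for r
      using that by (auto simp: closed_segment_eq_real_ivl split: if_splits)
    let ?h = "\<lambda>r. ?w k r z - (r - t) * ?w (Suc k) t z"
    have "norm (?h s - ?h t) \<le> B2 * \<bar>s - t\<bar> * norm (s - t)"
    proof (rule field_differentiable_bound[of "closed_segment t s" ?h "\<lambda>r. ?w (Suc k) r z - ?w (Suc k) t z"])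
      fix r assume r: "r \<in> closed_segment t s"
      then have rd: "\<bar>r - t\<bar> < \<delta>" using near s by fastforce
      show "(?h has_field_derivative ?w (Suc k) r z - ?w (Suc k) t z) (at r within closed_segment t s)"
        by (auto intro!: derivative_eq_intros has_field_derivative_at_within[OF der[OF z rd]])
      have "\<bar>?w (Suc k) r z - ?w (Suc k) t z\<bar> \<le> B2 * \<bar>r - t\<bar>"
        by (rule lip[OF z rd _ B2]) (use \<delta> z in auto)
      also have "\<dots> \<le> B2 * \<bar>s - t\<bar>"
        using near[OF r] B2[OF z s] by (intro mult_left_mono) auto
      finally show "norm (?w (Suc k) r z - ?w (Suc k) t z) \<le> B2 * \<bar>s - t\<bar>" by simp
    qed auto
    also have "\<dots> = B2 * (s - t)\<^sup>2" by (simp add: power2_eq_square mult.assoc)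
    also have "\<dots> \<le> C * (s - t)\<^sup>2" by (intro mult_right_mono) (auto simp: C_def)
    finally show ?thesis by (simp add: algebra_simps)
  qed
  have lipC: "\<bar>?w k s z - ?w k t z\<bar> \<le> C * \<bar>s - t\<bar>" if z: "z \<in> \<Omega>" and s: "\<bar>s - t\<bar> < \<delta>" for s z
  proof -
    have "\<bar>?w k s z - ?w k t z\<bar> \<le> B1 * \<bar>s - t\<bar>" by (rule lip[OF z s _ B1]) (use \<delta> z in auto)
    also have "\<dots> \<le> C * \<bar>s - t\<bar>" by (intro mult_right_mono) (auto simp: C_def)
    finally show ?thesis .
  qed
  have "\<forall>\<^sub>F s in nhds t. ?w k s \<in> borel_measurable (lebesgue_on \<Omega>) \<and>
      (\<forall>z\<in>space (lebesgue_on \<Omega>). \<bar>?w k s z\<bar> \<le> C \<and> \<bar>?w k s z - ?w k t z\<bar> \<le> C * \<bar>s - t\<bar> \<and>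
         \<bar>(?w k s z - ?w k t z) - (s - t) * ?w (Suc k) t z\<bar> \<le> C * (s - t)\<^sup>2)"
    unfolding eventually_nhds_metric
  proof (intro exI[of _ \<delta>] conjI allI impI ballI \<delta>)
    fix s z assume d: "dist s t < \<delta>"
    then have s: "\<bar>s - t\<bar> < \<delta>" by (simp add: dist_real_def)
    show "?w k s \<in> borel_measurable (lebesgue_on \<Omega>)" by (rule meas[OF s])
    assume "z \<in> space (lebesgue_on \<Omega>)"
    then have z: "z \<in> \<Omega>" by simp
    show "\<bar>?w k s z\<bar> \<le> C" using B0[OF z s] by (simp add: C_def)
    show "\<bar>?w k s z - ?w k t z\<bar> \<le> C * \<bar>s - t\<bar>" by (rule lipC[OF z s])
    show "\<bar>(?w k s z - ?w k t z) - (s - t) * ?w (Suc k) t z\<bar> \<le> C * (s - t)\<^sup>2" by (rule Taylor[OF z s])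
  qed
  moreover have "\<forall>z\<in>space (lebesgue_on \<Omega>). \<bar>?w (Suc k) t z\<bar> \<le> C"
  proof
    fix z assume "z \<in> space (lebesgue_on \<Omega>)"
    then have "\<bar>?w (Suc k) t z\<bar> \<le> B1" using B1[of z t] \<delta> by simp
    then show "\<bar>?w (Suc k) t z\<bar> \<le> C" by (simp add: C_def)
  qed
  moreover have "C \<ge> 0" by (simp add: C_def)
  ultimately show ?thesis
    unfolding multiplier_has_derivative_def using meas[of t "Suc k"] \<delta> by auto
qed

section \<open>Compositions\<close>

text \<open>
  The empty composition of zero is included, so that splitting off the last part stays inside these sets.
\<close>

definition all_compositions :: "nat \<Rightarrow> nat list set" where
  "all_compositions m = {\<alpha>. (\<forall>a\<in>set \<alpha>. 1 \<le> a) \<and> sum_list \<alpha> = m}"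

lemma length_le_sum_list: "(\<forall>a\<in>set \<alpha>. 1 \<le> a) \<Longrightarrow> length \<alpha> \<le> sum_list (\<alpha> :: nat list)"
  by (induction \<alpha>) auto

lemma compositions_eq: "1 \<le> m \<Longrightarrow> compositions m = all_compositions m"
  unfolding compositions_def all_compositions_def using length_le_sum_list by (auto simp: Suc_le_eq)

lemma all_compositions_0: "all_compositions 0 = {[]}"
proof -
  have "\<alpha> = []" if "\<alpha> \<in> all_compositions 0" for \<alpha>
    using that length_le_sum_list[of \<alpha>] unfolding all_compositions_def
    by (metis (mono_tags, lifting) le_zero_eq length_0_conv mem_Collect_eq)
  then show ?thesis by (auto simp: all_compositions_def)
qed

lemma finite_all_compositions: "finite (all_compositions m)"
proof (rule finite_subset)
  show "all_compositions m \<subseteq> {xs. set xs \<subseteq> {..m} \<and> length xs \<le> m}"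
    using length_le_sum_list member_le_sum_list by (fastforce simp: all_compositions_def)
  show "finite {xs. set xs \<subseteq> {..m} \<and> length xs \<le> m}" by (rule finite_lists_length_le) simp
qed

lemma sum_all_compositions_last:
  fixes F :: "nat list \<Rightarrow> 'c::comm_monoid_add"
  assumes "1 \<le> m"
  shows "(\<Sum>\<alpha>\<in>all_compositions m. F \<alpha>) = (\<Sum>j=1..m. \<Sum>\<beta>\<in>all_compositions (m - j). F (\<beta> @ [j]))"
proof -
  have "(\<Sum>j=1..m. \<Sum>\<beta>\<in>all_compositions (m - j). F (\<beta> @ [j]))
      = (\<Sum>(j, \<beta>)\<in>(SIGMA j:{1..m}. all_compositions (m - j)). F (\<beta> @ [j]))"
    by (rule sum.Sigma) (auto simp: finite_all_compositions)
  also have "\<dots> = (\<Sum>\<alpha>\<in>all_compositions m. F \<alpha>)"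
  proof (rule sum.reindex_bij_witness[where i = "\<lambda>\<alpha>. (last \<alpha>, butlast \<alpha>)" and j = "\<lambda>(j, \<beta>). \<beta> @ [j]"])
    fix \<alpha> assume \<alpha>: "\<alpha> \<in> all_compositions m"
    then have "\<alpha> \<noteq> []" using assms by (auto simp: all_compositions_def)
    then obtain \<beta> j where e: "\<alpha> = \<beta> @ [j]" by (metis rev_exhaust)
    show "(last \<alpha>, butlast \<alpha>) \<in> (SIGMA j:{1..m}. all_compositions (m - j))"
      using \<alpha> by (auto simp: e all_compositions_def)
    show "(case (last \<alpha>, butlast \<alpha>) of (j, \<beta>) \<Rightarrow> \<beta> @ [j]) = \<alpha>" by (simp add: e)
  qed (auto simp: all_compositions_def)
  finally show ?thesis by simp
qed

section \<open>Derivatives of the Bergman kernel\<close>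

locale weighted_bergman_family =
  fixes \<Omega> :: "(complex ^ 'n) set" and D :: "real set" and \<phi> :: "complex ^ 'n \<Rightarrow> real \<Rightarrow> real"
    and w :: "complex ^ 'n"
  assumes open_domain: "open \<Omega>" and bounded_domain: "bounded \<Omega>" and open_times: "open D"
    and weight_smooth: "smooth_on_closure_times \<Omega> D \<phi>" and point: "w \<in> \<Omega>"
begin

abbreviation "M \<equiv> lebesgue_on \<Omega>"
abbreviation "A \<equiv> unweighted_bergman_space \<Omega>"
abbreviation "\<omega> \<equiv> weight_derivative \<phi>"
abbreviation "K t \<equiv> \<lambda>x. bergman_kernel \<Omega> (\<lambda>y. \<phi> y t) x w"

text \<open>
  The formula for the derivatives of the kernel, extended to \<open>m = 0\<close> where it is the kernel itself.
\<close>

definition kernel_derivative :: "nat \<Rightarrow> real \<Rightarrow> complex ^ 'n \<Rightarrow> complex" where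
  "kernel_derivative m t z = (\<Sum>\<alpha>\<in>all_compositions m.
     fact m / prod_list (map fact \<alpha>) * bergman_op_comp \<Omega> \<phi> t \<alpha> (K t) z)"

lemma bounded_weight_at:
  assumes t: "t \<in> D"
  shows "bounded_weight \<Omega> (\<lambda>z. \<phi> z t)"
proof -
  obtain \<delta> B where \<delta>: "\<delta> > 0" "\<And>s. \<bar>s - t\<bar> < \<delta> \<Longrightarrow> continuous_on \<Omega> (\<lambda>z. \<phi> z s)"
    and B: "\<forall>z\<in>\<Omega>. \<forall>s. \<bar>s - t\<bar> < \<delta> \<longrightarrow> \<bar>\<phi> z s\<bar> \<le> B"
    using weight_regularity[OF open_times weight_smooth bounded_domain t] by metis
  have "bounded ((\<lambda>z. \<phi> z t) ` \<Omega>)"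
    using B \<delta>(1) by (intro boundedI[of _ B]) auto
  then show ?thesis
    by unfold_locales (use \<delta> open_domain in auto)
qed

lemma weight_derivative_0: "\<omega> 0 t z = exp (- \<phi> z t)"
  by (simp add: weight_derivative_def bell_neg_weight_def complete_bell_0)

lemma weight_derivative_bounded:
  assumes t: "t \<in> D"
  shows "\<omega> k t \<in> borel_measurable M" and "\<exists>B. \<forall>z\<in>\<Omega>. \<bar>\<omega> k t z\<bar> \<le> B"
proof -
  obtain \<delta> where \<delta>: "\<delta> > 0" "\<And>k s. \<bar>s - t\<bar> < \<delta> \<Longrightarrow> continuous_on \<Omega> (\<omega> k s)"
    "\<And>k. \<exists>B. \<forall>z\<in>\<Omega>. \<forall>s. \<bar>s - t\<bar> < \<delta> \<longrightarrow> \<bar>\<omega> k s z\<bar> \<le> B"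
    using weight_regularity[OF open_times weight_smooth bounded_domain t] by metis
  show "\<omega> k t \<in> borel_measurable M"
    by (rule continuous_imp_measurable_on_sets_lebesgue[OF \<delta>(2)])
       (use \<delta>(1) open_domain in \<open>auto simp: lebesgue_openin\<close>)
  show "\<exists>B. \<forall>z\<in>\<Omega>. \<bar>\<omega> k t z\<bar> \<le> B" using \<delta>(1) \<delta>(3)[of k] by force
qed

lemma weight_derivative_l2:
  assumes "t \<in> D" "f \<in> l2_space M"
  shows "(\<lambda>z. complex_of_real (\<omega> k t z) * f z) \<in> l2_space M"
proof -
  obtain B where "\<forall>z\<in>\<Omega>. \<bar>\<omega> k t z\<bar> \<le> B" using weight_derivative_bounded(2)[OF assms(1)] by blast
  then show ?thesis
    by (intro l2_space_multiplier[OF assms(2) weight_derivative_bounded(1)[OF assms(1)], of k B]) auto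
qed

lemma density_lower_bound:
  assumes t: "t \<in> D"
  shows "\<exists>m>0. \<forall>\<^sub>F s in nhds t. \<forall>z\<in>space M. m \<le> \<omega> 0 s z"
proof -
  obtain \<delta> B where \<delta>: "\<delta> > 0" "\<forall>z\<in>\<Omega>. \<forall>s. \<bar>s - t\<bar> < \<delta> \<longrightarrow> \<bar>\<phi> z s\<bar> \<le> B"
    using weight_regularity[OF open_times weight_smooth bounded_domain t] by metis
  have "\<forall>\<^sub>F s in nhds t. \<forall>z\<in>space M. exp (- B) \<le> \<omega> 0 s z"
    unfolding eventually_nhds_metric weight_derivative_0 using \<delta>
    by (intro exI[of _ \<delta>]) (fastforce simp: dist_real_def)
  then show ?thesis using exp_gt_zero by blast
qed

text \<open>
  On the level of pairings with \<open>A\<close>, the operator replaces the weight \<open>\<rho>\<^sub>t\<close> by its \<open>k\<close>th derivative, up to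
  sign.
\<close>

lemma bergman_op_properties:
  assumes t: "t \<in> D" and f: "f \<in> A"
  shows "bergman_op \<Omega> \<phi> t k f \<in> A"
    and "h \<in> A \<Longrightarrow> l2_pair M h (\<lambda>z. of_real (\<omega> 0 t z) * bergman_op \<Omega> \<phi> t k f z)
         = - l2_pair M h (\<lambda>z. of_real (\<omega> k t z) * f z)"
proof -
  interpret W: bounded_weight \<Omega> "\<lambda>z. \<phi> z t" by (rule bounded_weight_at[OF t])
  let ?g = "\<lambda>z. - f z * complex_of_real (bell_neg_weight k \<phi> t z)"
  have e: "exp (\<phi> z t) * \<omega> k t z = bell_neg_weight k \<phi> t z" for z
    by (simp add: weight_derivative_def mult.assoc[symmetric] exp_add[symmetric])
  note fL = unweighted_bergman_space_l2[OF f]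
  obtain B where B: "\<forall>z\<in>\<Omega>. \<bar>\<phi> z t\<bar> \<le> B" using W.weight_bounded by (auto simp: bounded_iff)
  have [measurable]: "(\<lambda>z. \<phi> z t) \<in> borel_measurable M" by (rule W.weight_measurable)
  have "(\<lambda>z. complex_of_real (exp (\<phi> z t)) * (- 1 * (complex_of_real (\<omega> k t z) * f z))) \<in> l2_space M"
    by (rule l2_space_multiplier[where C = "exp B"], rule l2_space_scale, rule weight_derivative_l2[OF t fL])
       (use B in \<open>auto intro: order_trans[OF abs_ge_self]\<close>)
  also have "(\<lambda>z. complex_of_real (exp (\<phi> z t)) * (- 1 * (complex_of_real (\<omega> k t z) * f z))) = ?g"
    unfolding e[symmetric] by (simp add: fun_eq_iff)
  finally have g: "?g \<in> l2_space M" .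
  show "bergman_op \<Omega> \<phi> t k f \<in> A"
    unfolding bergman_op_def by (rule W.bergman_projection_characterization(1)[OF g])
  assume h: "h \<in> A"
  have "l2_pair M h (\<lambda>z. of_real (\<omega> 0 t z) * bergman_op \<Omega> \<phi> t k f z)
      = weighted_inner \<Omega> (\<lambda>z. \<phi> z t) h (bergman_op \<Omega> \<phi> t k f)"
    by (simp add: W.weighted_inner_eq weight_derivative_0)
  also have "\<dots> = weighted_inner \<Omega> (\<lambda>z. \<phi> z t) h ?g"
    unfolding bergman_op_def by (rule W.bergman_projection_characterization(2)[OF g h])
  also have "\<dots> = l2_pair M h (\<lambda>z. (- 1) * (of_real (\<omega> k t z) * f z))"
    unfolding W.weighted_inner_eq by (rule l2_pair_cong) (simp_all add: weight_derivative_def)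
  also have "\<dots> = - l2_pair M h (\<lambda>z. of_real (\<omega> k t z) * f z)"
    by (subst l2_pair_scale_right) simp
  finally show "l2_pair M h (\<lambda>z. of_real (\<omega> 0 t z) * bergman_op \<Omega> \<phi> t k f z)
         = - l2_pair M h (\<lambda>z. of_real (\<omega> k t z) * f z)" .
qed

lemma kernel_properties:
  assumes t: "t \<in> D"
  shows "K t \<in> A" and "h \<in> A \<Longrightarrow> l2_pair M h (\<lambda>z. of_real (\<omega> 0 t z) * K t z) = h w"
proof -
  interpret W: bounded_weight \<Omega> "\<lambda>z. \<phi> z t" by (rule bounded_weight_at[OF t])
  show "K t \<in> A" by (rule W.bergman_kernel_characterization(1)[OF point])
  show "l2_pair M h (\<lambda>z. of_real (\<omega> 0 t z) * K t z) = h w" if "h \<in> A"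
    using W.bergman_kernel_characterization(2)[OF point that] by (simp add: W.weighted_inner_eq weight_derivative_0)
qed

lemma bergman_op_comp_mem:
  assumes "t \<in> D"
  shows "bergman_op_comp \<Omega> \<phi> t \<alpha> (K t) \<in> A"
  by (induction \<alpha> rule: rev_induct)
     (auto simp: bergman_op_comp_def kernel_properties assms intro: bergman_op_properties(1))

lemma kernel_derivative_mem:
  assumes "t \<in> D"
  shows "kernel_derivative m t \<in> A"
  unfolding kernel_derivative_def[abs_def]
  by (intro unweighted_bergman_space_sum bergman_op_comp_mem assms)

lemma kernel_derivative_0: "kernel_derivative 0 t = K t"
  by (simp add: kernel_derivative_def all_compositions_0 bergman_op_comp_def fun_eq_iff)

text \<open>
  The \<open>m\<close>th derivative of \<open>\<integral> h cnj(K\<^sub>t) \<rho>\<^sub>t = h w\<close>, solved for the term without derivatives of the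
  weight. It is obtained at fixed \<open>t\<close> by splitting off the last part \<open>j\<close> of a composition, whose operator
  is applied last and is unfolded into the \<open>j\<close>th derivative of the weight; the coefficients match since
  \<open>m! / (\<beta>! j!) = (m choose j) (m - j)! / \<beta>!\<close> for the remaining composition \<open>\<beta>\<close>.
\<close>

lemma kernel_derivative_pairing:
  assumes t: "t \<in> D" and h: "h \<in> A"
  shows "l2_pair M h (\<lambda>z. of_real (\<omega> 0 t z) * kernel_derivative m t z) = (if m = 0 then h w else 0)
     + l2_pair M h (\<lambda>z. \<Sum>j=1..m. - of_nat (m choose j) * (of_real (\<omega> j t z) * kernel_derivative (m - j) t z))"
proof (cases "m = 0")
  case True
  then show ?thesis using kernel_properties(2)[OF t h] by (simp add: kernel_derivative_0 l2_pair_def)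
next
  case False
  then have m: "1 \<le> m" by simp
  define P where "P \<alpha> = bergman_op_comp \<Omega> \<phi> t \<alpha> (K t)" for \<alpha>
  define c :: "nat \<Rightarrow> nat list \<Rightarrow> complex" where "c k \<alpha> = fact k / prod_list (map fact \<alpha>)" for k \<alpha>
  have PA: "P \<alpha> \<in> A" for \<alpha> unfolding P_def by (rule bergman_op_comp_mem[OF t])
  have hL: "h \<in> l2_space M" by (rule unweighted_bergman_space_l2[OF h])
  have PL: "(\<lambda>z. of_real (\<omega> k t z) * P \<alpha> z) \<in> l2_space M" for k \<alpha>
    by (intro weight_derivative_l2 t unweighted_bergman_space_l2 PA)
  have KL: "(\<lambda>z. of_real (\<omega> k t z) * kernel_derivative i t z) \<in> l2_space M" for k i
    by (intro weight_derivative_l2 t unweighted_bergman_space_l2 kernel_derivative_mem)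
  have cc: "cnj (c k \<alpha>) = c k \<alpha>" for k \<alpha>
  proof -
    have "c k \<alpha> = of_real (fact k / prod_list (map fact \<alpha>))"
      unfolding c_def by (induction \<alpha>) (auto simp: field_simps)
    then show ?thesis by (metis complex_cnj_complex_of_real)
  qed
  have expand: "l2_pair M h (\<lambda>z. of_real (\<omega> k t z) * kernel_derivative i t z)
      = (\<Sum>\<alpha>\<in>all_compositions i. c i \<alpha> * l2_pair M h (\<lambda>z. of_real (\<omega> k t z) * P \<alpha> z))" for k i
  proof -
    have "l2_pair M h (\<lambda>z. of_real (\<omega> k t z) * kernel_derivative i t z)
        = l2_pair M h (\<lambda>z. \<Sum>\<alpha>\<in>all_compositions i. c i \<alpha> * (of_real (\<omega> k t z) * P \<alpha> z))"
      by (simp add: kernel_derivative_def c_def P_def sum_distrib_left mult_ac)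
    also have "\<dots> = (\<Sum>\<alpha>\<in>all_compositions i. l2_pair M h (\<lambda>z. c i \<alpha> * (of_real (\<omega> k t z) * P \<alpha> z)))"
      by (intro l2_pair_sum_right l2_space_scale PL hL)
    finally show ?thesis by (simp add: l2_pair_scale_right cc)
  qed
  have snoc: "l2_pair M h (\<lambda>z. of_real (\<omega> 0 t z) * P (\<beta> @ [j]) z) = - l2_pair M h (\<lambda>z. of_real (\<omega> j t z) * P \<beta> z)"
    for \<beta> j
    using bergman_op_properties(2)[OF t PA h, of j \<beta>] by (simp add: P_def bergman_op_comp_def)
  have coeff: "c m (\<beta> @ [j]) = of_nat (m choose j) * c (m - j) \<beta>" if "j \<in> {1..m}" for j \<beta>
    using that by (simp add: c_def binomial_fact)
  have "l2_pair M h (\<lambda>z. of_real (\<omega> 0 t z) * kernel_derivative m t z)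
      = (\<Sum>j=1..m. \<Sum>\<beta>\<in>all_compositions (m - j). c m (\<beta> @ [j]) * (- l2_pair M h (\<lambda>z. of_real (\<omega> j t z) * P \<beta> z)))"
    unfolding expand sum_all_compositions_last[OF m] snoc ..
  also have "\<dots> = (\<Sum>j=1..m. - of_nat (m choose j) * l2_pair M h (\<lambda>z. of_real (\<omega> j t z) * kernel_derivative (m - j) t z))"
    unfolding expand by (intro sum.cong refl) (simp add: coeff sum_distrib_left sum_negf mult.assoc)
  also have "\<dots> = (\<Sum>j=1..m. l2_pair M h (\<lambda>z. - of_nat (m choose j) * (of_real (\<omega> j t z) * kernel_derivative (m - j) t z)))"
    by (intro sum.cong refl) (subst l2_pair_scale_right, simp)
  also have "\<dots> = l2_pair M h (\<lambda>z. \<Sum>j=1..m. - of_nat (m choose j) * (of_real (\<omega> j t z) * kernel_derivative (m - j) t z))"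
    by (intro l2_pair_sum_right[symmetric] l2_space_scale KL hL)
  finally show ?thesis using False by simp
qed

text \<open>
  Implicit differentiation of the pairing formula for \<open>m\<close>. Its right-hand side involves only kernel
  derivatives of order less than \<open>m\<close>, which are differentiable by induction, and by the Leibniz rule the
  differentiated formula is the pairing formula for \<open>Suc m\<close>.
\<close>

lemma kernel_derivative_l2_has_derivative:
  assumes t: "t \<in> D"
  shows "l2_has_derivative M (kernel_derivative m) (kernel_derivative (Suc m) t) t"
proof (induction m rule: less_induct)
  case (less m)
  define L where "L = kernel_derivative"
  define a where "a j s z = complex_of_real (\<omega> j s z)" for j s z
  define v where "v s z = (\<Sum>j=1..m. - of_nat (m choose j) * (a j s z * L (m - j) s z))" for s z
  define v' where "v' z = (\<Sum>j=1..m. - of_nat (m choose j) *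
      (a j t z * L (Suc m - j) t z + a (Suc j) t z * L (m - j) t z))" for z
  have LL: "L i s \<in> l2_space M" if "s \<in> D" for i s
    unfolding L_def by (intro unweighted_bergman_space_l2 kernel_derivative_mem that)
  have aLL: "(\<lambda>z. a j s z * L i s z) \<in> l2_space M" if "s \<in> D" for i j s
    unfolding a_def by (intro weight_derivative_l2 LL that)
  have nearD: "\<forall>\<^sub>F s in nhds t. s \<in> D" using open_times t by (rule eventually_nhds_in_open)
  have vd: "l2_has_derivative M v v' t"
    unfolding v_def v'_def
  proof (rule l2_has_derivative_sum)
    fix j assume j: "j \<in> {1..m}"
    have "l2_has_derivative M (L (m - j)) (L (Suc m - j) t) t"
      using less[of "m - j"] j by (simp add: L_def Suc_diff_le)
    then show "l2_has_derivative M (\<lambda>s z. a j s z * L (m - j) s z)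
        (\<lambda>z. a j t z * L (Suc m - j) t z + a (Suc j) t z * L (m - j) t z) t"
      unfolding a_def
      by (rule l2_has_derivative_mult[OF weight_derivative_multiplier[OF open_domain open_times weight_smooth bounded_domain t]])
         (use nearD LL t in \<open>auto elim: eventually_mono\<close>)
    show "\<forall>\<^sub>F s in nhds t. (\<lambda>z. a j s z * L (m - j) s z) \<in> l2_space M"
      using nearD by eventually_elim (rule aLL)
    show "(\<lambda>z. a j t z * L (Suc m - j) t z + a (Suc j) t z * L (m - j) t z) \<in> l2_space M"
      unfolding a_def by (intro l2_space_add weight_derivative_l2 LL t)
  qed simp
  have vL: "v s \<in> l2_space M" if "s \<in> D" for s
    unfolding v_def by (intro l2_space_sum l2_space_scale aLL that)
  have v'L: "v' \<in> l2_space M"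
    unfolding v'_def a_def by (intro l2_space_sum l2_space_scale l2_space_add weight_derivative_l2 LL t)
  have eq: "l2_pair M f (\<lambda>z. of_real (\<omega> 0 s z) * L m s z) = (if m = 0 then f w else 0) + l2_pair M f (v s)"
    if "s \<in> D" "f \<in> A" for s f
    using kernel_derivative_pairing[OF that, of m] unfolding v_def a_def L_def .
  have pascal: "v' z - a (Suc 0) t z * L m t z
      = (\<Sum>j=1..Suc m. - of_nat (Suc m choose j) * (a j t z * L (Suc m - j) t z))" for z
  proof -
    have "(\<Sum>j\<le>m. of_nat (m choose j) * (a (Suc j) t z * L (m - j) t z + a j t z * L (Suc m - j) t z))
        = (\<Sum>j\<le>Suc m. of_nat (Suc m choose j) * (a j t z * L (Suc m - j) t z))"
      by (rule Pascal_convolution[where a = "\<lambda>j. a j t z" and c = "\<lambda>i. L i t z"])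
    then have "a (Suc 0) t z * L m t z + (\<Sum>j=1..m. of_nat (m choose j) *
          (a (Suc j) t z * L (m - j) t z + a j t z * L (Suc m - j) t z))
        = (\<Sum>j=1..Suc m. of_nat (Suc m choose j) * (a j t z * L (Suc m - j) t z))"
      unfolding atMost_atLeast0 sum.atLeast_Suc_atMost[OF le0] by simp
    moreover have "v' z = - (\<Sum>j=1..m. of_nat (m choose j) *
          (a (Suc j) t z * L (m - j) t z + a j t z * L (Suc m - j) t z))"
      unfolding v'_def sum_negf[symmetric] by (intro sum.cong refl) (simp add: add.commute)
    moreover have "(\<Sum>j=1..Suc m. - of_nat (Suc m choose j) * (a j t z * L (Suc m - j) t z))
        = - (\<Sum>j=1..Suc m. of_nat (Suc m choose j) * (a j t z * L (Suc m - j) t z))"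
      unfolding sum_negf[symmetric] by (intro sum.cong refl) simp
    ultimately show ?thesis by (simp only: minus_add_distrib[symmetric] diff_conv_add_uminus add.commute)
  qed
  obtain \<epsilon> where \<epsilon>: "\<epsilon> > 0" "\<forall>\<^sub>F s in nhds t. \<forall>z\<in>space M. \<epsilon> \<le> \<omega> 0 s z"
    using density_lower_bound[OF t] by blast
  show ?case
    unfolding L_def[symmetric]
  proof (rule l2_has_derivative_implicit[where A = A and \<rho> = "\<omega> 0" and \<rho>' = "\<omega> (Suc 0) t" and m = \<epsilon>
        and v = v and v' = v' and c = "\<lambda>f. if m = 0 then f w else 0"])
    show "A \<subseteq> l2_space M" using unweighted_bergman_space_l2 by blast
    show "multiplier_has_derivative M (\<omega> 0) (\<omega> (Suc 0) t) t"
      by (rule weight_derivative_multiplier[OF open_domain open_times weight_smooth bounded_domain t])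
    show "\<forall>\<^sub>F s in nhds t. L m s \<in> A"
      using nearD by eventually_elim (simp add: L_def kernel_derivative_mem)
    show "L (Suc m) t \<in> A" unfolding L_def by (rule kernel_derivative_mem[OF t])
    show "\<forall>\<^sub>F s in nhds t. v s \<in> l2_space M" using nearD by eventually_elim (rule vL)
    show "\<forall>\<^sub>F s in nhds t. \<forall>f\<in>A. l2_pair M f (\<lambda>z. of_real (\<omega> 0 s z) * L m s z)
        = (if m = 0 then f w else 0) + l2_pair M f (v s)"
      using nearD by eventually_elim (use eq in blast)
    show "l2_pair M f (\<lambda>z. of_real (\<omega> 0 t z) * L (Suc m) t z)
        = l2_pair M f (\<lambda>z. v' z - of_real (\<omega> (Suc 0) t z) * L m t z)" if "f \<in> A" for f
      using kernel_derivative_pairing[OF t that, of "Suc m"]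
      unfolding pascal[unfolded a_def L_def] L_def by simp
  qed (use unweighted_bergman_space_linear \<epsilon> v'L vd in auto)
qed

lemma kernel_derivative_has_vector_derivative:
  assumes t: "t \<in> D" and z: "z \<in> \<Omega>"
  shows "((\<lambda>s. kernel_derivative m s z) has_vector_derivative kernel_derivative (Suc m) t z) (at t)"
proof -
  define L where "L = kernel_derivative"
  obtain r where r: "r > 0" "ball z r \<subseteq> \<Omega>" using open_domain z openE by blast
  define c where "c = inverse (sqrt (measure lborel (ball (0 :: complex ^ 'n) r)))"
  define q where "q s x = (L m s x - L m t x) / of_real (s - t) - L (Suc m) t x" for s x
  have q0: "((\<lambda>s. l2_norm M (q s)) \<longlongrightarrow> 0) (at t)"
    using kernel_derivative_l2_has_derivative[OF t, of m] unfolding l2_has_derivative_def q_def L_def .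
  have "\<forall>\<^sub>F s in nhds t. s \<in> D" using open_times t by (rule eventually_nhds_in_open)
  then have "\<forall>\<^sub>F s in at t. s \<in> D" by (simp add: eventually_nhds_conv_at)
  with eventually_neq_at_within[of t t UNIV]
  have "\<forall>\<^sub>F s in at t. norm (norm ((L m s z - L m t z) - (s - t) *\<^sub>R L (Suc m) t z) / norm (s - t)) \<le> c * l2_norm M (q s)"
  proof eventually_elim
    case (elim s)
    have "q s = (\<lambda>x. (1 / of_real (s - t)) * (L m s x - L m t x) - L (Suc m) t x)"
      by (simp add: q_def fun_eq_iff)
    also have "\<dots> \<in> A" unfolding L_def
      by (intro unweighted_bergman_space_linear kernel_derivative_mem t elim)
    finally have "cmod (q s z) \<le> c * l2_norm M (q s)"
      unfolding c_def by (rule bergman_evaluation_bound[OF open_domain _ r])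
    moreover have "norm ((L m s z - L m t z) - (s - t) *\<^sub>R L (Suc m) t z) / norm (s - t) = cmod (q s z)"
    proof -
      have factor: "y - d * e = d * (y / d - e)" if "d \<noteq> 0" for d e y :: complex
        using that by (simp add: field_simps)
      have "(L m s z - L m t z) - (s - t) *\<^sub>R L (Suc m) t z = of_real (s - t) * q s z"
        unfolding q_def scaleR_conv_of_real by (rule factor) (use elim in simp)
      then show ?thesis using elim by (simp add: norm_mult del: of_real_diff)
    qed
    ultimately show ?case by simp
  qed
  moreover have "((\<lambda>s. c * l2_norm M (q s)) \<longlongrightarrow> 0) (at t)"
    using tendsto_mult_left[OF q0, of c] by simp
  ultimately have "((\<lambda>s. norm ((L m s z - L m t z) - (s - t) *\<^sub>R L (Suc m) t z) / norm (s - t)) \<longlongrightarrow> 0) (at t)"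
    by (rule Lim_null_comparison)
  then show ?thesis
    unfolding has_vector_derivative_def has_derivative_iff_norm L_def
    by (auto intro: bounded_linear_scaleR_left)
qed

end

theorem theorem1p1:
  fixes \<Omega> :: "(complex ^ 'n) set" and D :: "real set"
    and \<phi> :: "complex ^ 'n \<Rightarrow> real \<Rightarrow> real"
  assumes "open \<Omega>" and "connected \<Omega>" and "\<Omega> \<noteq> {}" and "bounded \<Omega>"
    and "open D"
    and "smooth_on_closure_times \<Omega> D \<phi>"
  shows "(\<forall>z\<in>\<Omega>. \<forall>w\<in>\<Omega>. smooth_on D (\<lambda>t. bergman_kernel \<Omega> (\<lambda>x. \<phi> x t) z w)) \<and>
    (\<forall>z\<in>\<Omega>. \<forall>w\<in>\<Omega>. \<forall>t\<in>D. \<forall>m\<ge>1.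
       nth_vector_derivative m (\<lambda>s. bergman_kernel \<Omega> (\<lambda>x. \<phi> x s) z w) t =
       (\<Sum>\<alpha>\<in>compositions m. fact m / prod_list (map fact \<alpha>) *
          bergman_op_comp \<Omega> \<phi> t \<alpha> (\<lambda>x. bergman_kernel \<Omega> (\<lambda>y. \<phi> y t) x w) z))"
proof -
  have main: "smooth_on D (\<lambda>t. bergman_kernel \<Omega> (\<lambda>x. \<phi> x t) z w) \<and>
     (\<forall>t\<in>D. \<forall>m\<ge>1. nth_vector_derivative m (\<lambda>s. bergman_kernel \<Omega> (\<lambda>x. \<phi> x s) z w) t =
       (\<Sum>\<alpha>\<in>compositions m. fact m / prod_list (map fact \<alpha>) *
          bergman_op_comp \<Omega> \<phi> t \<alpha> (\<lambda>x. bergman_kernel \<Omega> (\<lambda>y. \<phi> y t) x w) z))"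
    if z: "z \<in> \<Omega>" and w: "w \<in> \<Omega>" for z w
  proof -
    interpret weighted_bergman_family \<Omega> D \<phi> w
      by unfold_locales (use assms w in auto)
    have zero: "(\<lambda>t. bergman_kernel \<Omega> (\<lambda>x. \<phi> x t) z w) = (\<lambda>t. kernel_derivative 0 t z)"
      by (simp add: kernel_derivative_0)
    note seq = smooth_on_derivative_sequence[OF open_times, where g = "\<lambda>m t. kernel_derivative m t z",
        OF kernel_derivative_has_vector_derivative[OF _ z]]
    show ?thesis
      unfolding zero using seq by (simp add: kernel_derivative_def compositions_eq)
  qed
  show ?thesis using main by blast
qed

end
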